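(* Given a finite dimensional hereditary algebra $\Lambda$ over a field $K$ and a nonrigid $\Lambda$-module $M$, the semistability set $D(M)$ does not meet the interior of any simplex of the cluster complex of $\Lambda$ of codimension $0$ or $1$.
   Context: Modules are finite dimensional right modules. $S_1,\dots,S_n$ are the simple $\Lambda$-modules, $P_i$ the projective cover of $S_i$, $f_i=\dim_K\mathrm{End}_\Lambda(S_i)$, and $\underline{\dim}\,M\in\mathbb N^n$ records the multiplicities of the $S_i$ in a composition series of $M$. A module $M$ is rigid if $\mathrm{Ext}^1_\Lambda(M,M)=0$, and exceptional if it is rigid and its endomorphism ring is a division algebra. $D(M)=\{x\in\mathbb R^n: x\cdot\underline{\dim}\,M=0\text{ and } x\cdot\underline{\dim}\,M'\le0\text{ for all submodules }M'\subseteq M\}$. Let $\mathcal D^b$ be the bounded derived category of $\text{mod-}\Lambda$ and $\mathcal C_\Lambda$ the cluster category (the orbit category of $\mathcal D^b$ by $\tau^{-1}[1]$). Its exceptional objects are represented by the exceptional modules and the $P_i[1]$. The $g$-vector of $P_i[1]$ is $g(P_i[1])=-f_ie_i$ ($e_i$ the $i$th unit vector); the $g$-vector $g(M)$ of an exceptional module $M$ with minimal projective presentation $\coprod P_i^{n_i}\to\coprod P_i^{m_i}\to M$ has $i$th coordinate $f_i(m_i-n_i)$. A cluster tilting object is $T=T_1\oplus\cdots\oplus T_n$ with $T_i$ pairwise nonisomorphic exceptional objects and $\mathrm{Ext}^1_{\mathcal C_\Lambda}(T,T)=0$ (equivalently $\mathrm{Ext}^1_{\mathcal D^b}(T,T)=0$).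 $R(T)\subset\mathbb R^n$ is the cone of nonnegative linear combinations of $g(T_1),\dots,g(T_n)$ (a conical simplex). The cluster complex is the simplicial fan formed by all $R(T)$ and their faces; a simplex of codimension $k$ is a cone spanned by the $g$-vectors of $n-k$ of the summands of some cluster tilting object, and its interior is its relative interior (strictly positive combinations of these $g$-vectors). *)

theory Defs
  imports "HOL-Analysis.Analysis" "HOL-Library.Function_Algebras"
begin

text \<open>
  A finite dimensional algebra over a field \<open>'k\<close> is a unital ring type \<open>'a\<close> together with a
  scalar multiplication \<open>sc\<close>.  (The class of rings excludes only the zero algebra, over
  which every module is rigid.)
\<close>

locale fd_algebra = vector_space sc
  for sc :: "'k::field \<Rightarrow> 'a::ring_1 \<Rightarrow> 'a" +
  assumes sc_mult_left: "sc c x * y = sc c (x * y)"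
    and sc_mult_right: "x * sc c y = sc c (x * y)"
    and finite_dim: "\<exists>B. finite B \<and> span B = UNIV"


section \<open>Finite dimensional right modules\<close>

text \<open>
  The carrier of a module is a subspace of an ambient \<open>'k\<close>-vector space (the type \<open>'m\<close> with
  \<open>scl\<close>); \<open>act M x a\<close> is \<open>x \<cdot> a\<close> and is relevant only for \<open>x\<close> in the carrier.
\<close>

record ('k, 'a, 'm) rmod =
  car :: "'m set"
  scl :: "'k \<Rightarrow> 'm \<Rightarrow> 'm"
  act :: "'m \<Rightarrow> 'a \<Rightarrow> 'm"

locale fd_rmodule =
  fixes sc :: "'k::field \<Rightarrow> 'a::ring_1 \<Rightarrow> 'a"
    and M :: "('k, 'a, 'm::ab_group_add) rmod"
  assumes vector_space_scl: "vector_space (scl M)"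
    and finite_dim: "\<exists>B. finite B \<and> car M = module.span (scl M) B"
    and act_closed: "x \<in> car M \<Longrightarrow> act M x a \<in> car M"
    and act_add_left: "x \<in> car M \<Longrightarrow> y \<in> car M \<Longrightarrow> act M (x + y) a = act M x a + act M y a"
    and act_add_right: "x \<in> car M \<Longrightarrow> act M x (a + b) = act M x a + act M x b"
    and act_mult: "x \<in> car M \<Longrightarrow> act M x (a * b) = act M (act M x a) b"
    and act_one: "x \<in> car M \<Longrightarrow> act M x 1 = x"
    and act_sc: "x \<in> car M \<Longrightarrow> act M x (sc c a) = scl M c (act M x a)"

text \<open>
  Quantification over all modules (in the definitions of \<open>Ext\<^sup>1\<close>, projectivity, the derived
  category) ranges over modules whose carrier consists of sequences in \<open>'k\<close>.  As \<open>'k ^ d\<close> embeds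
  into the sequences for every \<open>d\<close>, each finite dimensional module is isomorphic to one of these.
\<close>

type_synonym ('k, 'a) umod = "('k, 'a, nat \<Rightarrow> 'k) rmod"

definition submodule :: "('k, 'a, 'm::ab_group_add) rmod \<Rightarrow> 'm set \<Rightarrow> bool" where
  "submodule M N \<longleftrightarrow> N \<subseteq> car M \<and> 0 \<in> N \<and> (\<forall>x\<in>N. \<forall>y\<in>N. x + y \<in> N) \<and> (\<forall>x\<in>N. \<forall>a. act M x a \<in> N)"

abbreviation submod :: "('k, 'a, 'm) rmod \<Rightarrow> 'm set \<Rightarrow> ('k, 'a, 'm) rmod" where
  "submod M N \<equiv> M\<lparr>car := N\<rparr>"

text \<open>Homomorphisms are extended by zero outside the carrier, so that they form a vector space.\<close>

definition homs :: "('k, 'a, 'm::ab_group_add) rmod \<Rightarrow> ('k, 'a, 'n::ab_group_add) rmod \<Rightarrow> ('m \<Rightarrow> 'n) set" where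
  "homs M N = {f. (\<forall>x\<in>car M. f x \<in> car N) \<and>
                  (\<forall>x\<in>car M. \<forall>y\<in>car M. f (x + y) = f x + f y) \<and>
                  (\<forall>x\<in>car M. \<forall>a. f (act M x a) = act N (f x) a) \<and>
                  (\<forall>x. x \<notin> car M \<longrightarrow> f x = 0)}"

definition kernel :: "('k, 'a, 'm) rmod \<Rightarrow> ('m \<Rightarrow> 'n::zero) \<Rightarrow> 'm set" where
  "kernel M f = {x \<in> car M. f x = 0}"

definition iso :: "('k, 'a, 'm::ab_group_add) rmod \<Rightarrow> ('k, 'a, 'n::ab_group_add) rmod \<Rightarrow> bool" where
  "iso M N \<longleftrightarrow> (\<exists>f\<in>homs M N. bij_betw f (car M) (car N))"

definition hom_dim :: "('k::field, 'a, 'm::ab_group_add) rmod \<Rightarrow> ('k, 'a, 'n::ab_group_add) rmod \<Rightarrow> nat" where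
  "hom_dim M N = vector_space.dim (\<lambda>c f x. scl N c (f x)) (homs M N)"

text \<open>\<open>Ext\<^sup>1(M, N) = 0\<close>: every extension of \<open>M\<close> by \<open>N\<close> splits.\<close>

definition short_exact ::
  "('k, 'a, 'n::ab_group_add) rmod \<Rightarrow> ('n \<Rightarrow> 'e) \<Rightarrow> ('k, 'a, 'e::ab_group_add) rmod \<Rightarrow> ('e \<Rightarrow> 'm) \<Rightarrow>
    ('k, 'a, 'm::ab_group_add) rmod \<Rightarrow> bool" where
  "short_exact N i E p M \<longleftrightarrow> i \<in> homs N E \<and> p \<in> homs E M \<and>
     inj_on i (car N) \<and> p ` car E = car M \<and> i ` car N = kernel E p"

definition ext1_zero ::
  "('k::field \<Rightarrow> 'a::ring_1 \<Rightarrow> 'a) \<Rightarrow> ('k, 'a, 'm::ab_group_add) rmod \<Rightarrow> ('k, 'a, 'n::ab_group_add) rmod \<Rightarrow> bool" where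
  "ext1_zero sc M N \<longleftrightarrow>
     (\<forall>(E :: ('k, 'a) umod) i p. fd_rmodule sc E \<and> short_exact N i E p M \<longrightarrow>
        (\<exists>s\<in>homs M E. \<forall>x\<in>car M. p (s x) = x))"

definition rigid :: "('k::field \<Rightarrow> 'a::ring_1 \<Rightarrow> 'a) \<Rightarrow> ('k, 'a, 'm::ab_group_add) rmod \<Rightarrow> bool" where
  "rigid sc M \<longleftrightarrow> ext1_zero sc M M"

definition exceptional :: "('k::field \<Rightarrow> 'a::ring_1 \<Rightarrow> 'a) \<Rightarrow> ('k, 'a, 'm::ab_group_add) rmod \<Rightarrow> bool" where
  "exceptional sc M \<longleftrightarrow> rigid sc M \<and> car M \<noteq> {0} \<and>
     (\<forall>f\<in>homs M M. f \<noteq> 0 \<longrightarrow> (\<exists>g\<in>homs M M. \<forall>x\<in>car M. g (f x) = x \<and> f (g x) = x))"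

definition projective :: "('k::field \<Rightarrow> 'a::ring_1 \<Rightarrow> 'a) \<Rightarrow> ('k, 'a, 'm::ab_group_add) rmod \<Rightarrow> bool" where
  "projective sc P \<longleftrightarrow>
     (\<forall>(X :: ('k, 'a) umod) (Y :: ('k, 'a) umod). \<forall>p\<in>homs X Y. \<forall>f\<in>homs P Y.
        fd_rmodule sc X \<and> fd_rmodule sc Y \<and> p ` car X = car Y \<longrightarrow>
        (\<exists>h\<in>homs P X. \<forall>x\<in>car P. p (h x) = f x))"

definition hereditary :: "('k::field \<Rightarrow> 'a::ring_1 \<Rightarrow> 'a) \<Rightarrow> bool" where
  "hereditary sc \<longleftrightarrow>
     (\<forall>(P :: ('k, 'a) umod) N. fd_rmodule sc P \<and> projective sc P \<and> submodule P N \<longrightarrow>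
        projective sc (submod P N))"

definition projective_cover ::
  "('k::field \<Rightarrow> 'a::ring_1 \<Rightarrow> 'a) \<Rightarrow> ('k, 'a, 'p::ab_group_add) rmod \<Rightarrow> ('p \<Rightarrow> 'm) \<Rightarrow>
    ('k, 'a, 'm::ab_group_add) rmod \<Rightarrow> bool" where
  "projective_cover sc P p M \<longleftrightarrow> fd_rmodule sc P \<and> projective sc P \<and> p \<in> homs P M \<and> p ` car P = car M \<and>
     (\<forall>N. submodule P N \<and> p ` N = car M \<longrightarrow> N = car P)"

definition simple :: "('k, 'a, 'm::ab_group_add) rmod \<Rightarrow> bool" where
  "simple M \<longleftrightarrow> car M \<noteq> {0} \<and> (\<forall>N. submodule M N \<longrightarrow> N = {0} \<or> N = car M)"

text \<open>\<open>S\<close> lists the simple modules up to isomorphism; in particular \<open>n = CARD('n)\<close>.\<close>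

definition simple_modules :: "('k::field \<Rightarrow> 'a::ring_1 \<Rightarrow> 'a) \<Rightarrow> ('n::finite \<Rightarrow> ('k, 'a) umod) \<Rightarrow> bool" where
  "simple_modules sc S \<longleftrightarrow>
     (\<forall>i. fd_rmodule sc (S i) \<and> simple (S i)) \<and>
     (\<forall>i j. iso (S i) (S j) \<longrightarrow> i = j) \<and>
     (\<forall>X :: ('k, 'a) umod. fd_rmodule sc X \<and> simple X \<longrightarrow> (\<exists>i. iso X (S i)))"


section \<open>Dimension vectors and semistability sets\<close>

text \<open>\<open>N / L \<cong> S\<close>, expressed through the projection \<open>N \<rightarrow> S\<close> with kernel \<open>L\<close>.\<close>

definition factor_iso ::
  "('k, 'a, 'm::ab_group_add) rmod \<Rightarrow> 'm set \<Rightarrow> 'm set \<Rightarrow> ('k, 'a, 's::ab_group_add) rmod \<Rightarrow> bool" where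
  "factor_iso M N L S \<longleftrightarrow>
     (\<exists>p\<in>homs (submod M N) S. p ` N = car S \<and> kernel (submod M N) p = L)"

definition composition_series :: "('k, 'a, 'm::ab_group_add) rmod \<Rightarrow> 'm set list \<Rightarrow> bool" where
  "composition_series M Ns \<longleftrightarrow> Ns \<noteq> [] \<and> hd Ns = {0} \<and> last Ns = car M \<and>
     (\<forall>N\<in>set Ns. submodule M N) \<and>
     (\<forall>j. Suc j < length Ns \<longrightarrow> Ns ! j \<subset> Ns ! Suc j \<and>
        (\<forall>L. submodule M L \<and> Ns ! j \<subseteq> L \<and> L \<subseteq> Ns ! Suc j \<longrightarrow> L = Ns ! j \<or> L = Ns ! Suc j))"

text \<open>By the Jordan--Hoelder theorem the choice of the series does not matter.\<close>

definition multiplicity ::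
  "('k, 'a, 's::ab_group_add) rmod \<Rightarrow> ('k, 'a, 'm::ab_group_add) rmod \<Rightarrow> nat" where
  "multiplicity S M =
     (let Ns = (SOME Ns. composition_series M Ns)
      in card {j. Suc j < length Ns \<and> factor_iso M (Ns ! Suc j) (Ns ! j) S})"

definition dim_vec ::
  "('n::finite \<Rightarrow> ('k, 'a, 's::ab_group_add) rmod) \<Rightarrow> ('k, 'a, 'm::ab_group_add) rmod \<Rightarrow> real ^ 'n" where
  "dim_vec S M = (\<chi> i. real (multiplicity (S i) M))"

definition semistability_set ::
  "('n::finite \<Rightarrow> ('k, 'a, 's::ab_group_add) rmod) \<Rightarrow> ('k, 'a, 'm::ab_group_add) rmod \<Rightarrow> (real ^ 'n) set" where
  "semistability_set S M =
     {x. x \<bullet> dim_vec S M = 0 \<and> (\<forall>N. submodule M N \<longrightarrow> x \<bullet> dim_vec S (submod M N) \<le> 0)}"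


section \<open>Minimal projective presentations and g-vectors\<close>

text \<open>\<open>dsum P m\<close> is the direct sum over \<open>i\<close> of \<open>m i\<close> copies of \<open>P i\<close>.\<close>

definition dsum :: "('n \<Rightarrow> ('k, 'a, 'm::ab_group_add) rmod) \<Rightarrow> ('n \<Rightarrow> nat) \<Rightarrow> ('k, 'a, 'n \<times> nat \<Rightarrow> 'm) rmod" where
  "dsum P m =
     \<lparr>car = {\<phi>. \<forall>i j. if j < m i then \<phi> (i, j) \<in> car (P i) else \<phi> (i, j) = 0},
      scl = (\<lambda>c \<phi> (i, j). scl (P i) c (\<phi> (i, j))),
      act = (\<lambda>\<phi> a (i, j). if j < m i then act (P i) (\<phi> (i, j)) a else 0)\<rparr>"

text \<open>\<open>dsum P n \<rightarrow> dsum P m \<rightarrow> M\<close> is a minimal projective presentation.\<close>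

definition min_presentation ::
  "('k::field \<Rightarrow> 'a::ring_1 \<Rightarrow> 'a) \<Rightarrow> ('n \<Rightarrow> ('k, 'a) umod) \<Rightarrow> ('k, 'a, 'm::ab_group_add) rmod \<Rightarrow>
    ('n \<Rightarrow> nat) \<Rightarrow> ('n \<Rightarrow> nat) \<Rightarrow> bool" where
  "min_presentation sc P M m n \<longleftrightarrow>
     (\<exists>p d. projective_cover sc (dsum P m) p M \<and>
            projective_cover sc (dsum P n) d (submod (dsum P m) (kernel (dsum P m) p)))"

text \<open>The exponents of a minimal presentation are unique by the Krull--Schmidt theorem.\<close>

definition g_module ::
  "('k::field \<Rightarrow> 'a::ring_1 \<Rightarrow> 'a) \<Rightarrow> ('n::finite \<Rightarrow> ('k, 'a) umod) \<Rightarrow> ('n \<Rightarrow> ('k, 'a) umod) \<Rightarrow>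
    ('k, 'a, 'm::ab_group_add) rmod \<Rightarrow> real ^ 'n" where
  "g_module sc S P M =
     (let (m, n) = (SOME (m, n). min_presentation sc P M m n)
      in (\<chi> i. real (hom_dim (S i) (S i)) * (real (m i) - real (n i))))"


section \<open>The bounded derived category\<close>

text \<open>Objects are bounded cochain complexes of finite dimensional modules.\<close>

record ('k, 'a, 'm) cpx =
  ob :: "int \<Rightarrow> ('k, 'a, 'm) rmod"
  dif :: "int \<Rightarrow> 'm \<Rightarrow> 'm"

type_synonym ('k, 'a) ucpx = "('k, 'a, nat \<Rightarrow> 'k) cpx"

definition bounded_complex :: "('k::field \<Rightarrow> 'a::ring_1 \<Rightarrow> 'a) \<Rightarrow> ('k, 'a, 'm::ab_group_add) cpx \<Rightarrow> bool" where
  "bounded_complex sc X \<longleftrightarrow>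
     (\<forall>i. fd_rmodule sc (ob X i)) \<and>
     (\<forall>i. dif X i \<in> homs (ob X i) (ob X (i + 1))) \<and>
     (\<forall>i. \<forall>x\<in>car (ob X i). dif X (i + 1) (dif X i x) = 0) \<and>
     finite {i. car (ob X i) \<noteq> {0}}"

definition chain_map ::
  "('k, 'a, 'm::ab_group_add) cpx \<Rightarrow> ('k, 'a, 'm) cpx \<Rightarrow> (int \<Rightarrow> 'm \<Rightarrow> 'm) \<Rightarrow> bool" where
  "chain_map X Y f \<longleftrightarrow>
     (\<forall>i. f i \<in> homs (ob X i) (ob Y i)) \<and>
     (\<forall>i. \<forall>x\<in>car (ob X i). f (i + 1) (dif X i x) = dif Y i (f i x))"

definition null_homotopic ::
  "('k, 'a, 'm::ab_group_add) cpx \<Rightarrow> ('k, 'a, 'm) cpx \<Rightarrow> (int \<Rightarrow> 'm \<Rightarrow> 'm) \<Rightarrow> bool" where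
  "null_homotopic X Y f \<longleftrightarrow>
     (\<exists>h. (\<forall>i. h i \<in> homs (ob X i) (ob Y (i - 1))) \<and>
          (\<forall>i. \<forall>x\<in>car (ob X i). f i x = dif Y (i - 1) (h i x) + h (i + 1) (dif X i x)))"

definition cycles :: "('k, 'a, 'm::ab_group_add) cpx \<Rightarrow> int \<Rightarrow> 'm set" where
  "cycles X i = kernel (ob X i) (dif X i)"

definition boundaries :: "('k, 'a, 'm::ab_group_add) cpx \<Rightarrow> int \<Rightarrow> 'm set" where
  "boundaries X i = dif X (i - 1) ` car (ob X (i - 1))"

text \<open>The last two conjuncts say that \<open>f\<close> is injective and surjective on cohomology.\<close>

definition quasi_iso ::
  "('k, 'a, 'm::ab_group_add) cpx \<Rightarrow> ('k, 'a, 'm) cpx \<Rightarrow> (int \<Rightarrow> 'm \<Rightarrow> 'm) \<Rightarrow> bool" where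
  "quasi_iso X Y f \<longleftrightarrow> chain_map X Y f \<and>
     (\<forall>i. \<forall>x\<in>cycles X i. f i x \<in> boundaries Y i \<longrightarrow> x \<in> boundaries X i) \<and>
     (\<forall>i. \<forall>y\<in>cycles Y i. \<exists>x\<in>cycles X i. y - f i x \<in> boundaries Y i)"

text \<open>
  A morphism \<open>X \<rightarrow> Y\<close> in the derived category is a roof \<open>X \<leftarrow> Z \<rightarrow> Y\<close> whose left leg is a
  quasi-isomorphism.  It is zero iff its right leg becomes null-homotopic after composition with
  some quasi-isomorphism \<open>W \<rightarrow> Z\<close>, and an isomorphism iff its right leg is a quasi-isomorphism.
\<close>

definition hom_D_zero :: "('k::field \<Rightarrow> 'a::ring_1 \<Rightarrow> 'a) \<Rightarrow> ('k, 'a) ucpx \<Rightarrow> ('k, 'a) ucpx \<Rightarrow> bool" where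
  "hom_D_zero sc X Y \<longleftrightarrow>
     (\<forall>(Z :: ('k, 'a) ucpx) s f. bounded_complex sc Z \<and> quasi_iso Z X s \<and> chain_map Z Y f \<longrightarrow>
        (\<exists>(W :: ('k, 'a) ucpx) t. bounded_complex sc W \<and> quasi_iso W Z t \<and>
           null_homotopic W Y (\<lambda>i x. f i (t i x))))"

definition iso_D :: "('k::field \<Rightarrow> 'a::ring_1 \<Rightarrow> 'a) \<Rightarrow> ('k, 'a) ucpx \<Rightarrow> ('k, 'a) ucpx \<Rightarrow> bool" where
  "iso_D sc X Y \<longleftrightarrow>
     (\<exists>(Z :: ('k, 'a) ucpx) s f. bounded_complex sc Z \<and> quasi_iso Z X s \<and> quasi_iso Z Y f)"

definition shift :: "('k, 'a, 'm::ab_group_add) cpx \<Rightarrow> int \<Rightarrow> ('k, 'a, 'm) cpx" where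
  "shift X k = \<lparr>ob = (\<lambda>i. ob X (i + k)), dif = (\<lambda>i x. if even k then dif X (i + k) x else - dif X (i + k) x)\<rparr>"

definition ext1_D_zero :: "('k::field \<Rightarrow> 'a::ring_1 \<Rightarrow> 'a) \<Rightarrow> ('k, 'a) ucpx \<Rightarrow> ('k, 'a) ucpx \<Rightarrow> bool" where
  "ext1_D_zero sc X Y \<longleftrightarrow> hom_D_zero sc X (shift Y 1)"

definition stalk :: "('k, 'a, 'm::ab_group_add) rmod \<Rightarrow> ('k, 'a, 'm) cpx" where
  "stalk M = \<lparr>ob = (\<lambda>i. if i = 0 then M else submod M {0}), dif = (\<lambda>i x. 0)\<rparr>"


section \<open>The cluster complex\<close>

text \<open>
  Representatives of the exceptional objects of the cluster category: exceptional modules \<open>Mod M\<close>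
  and shifted projectives \<open>Sh i\<close>, i.e. \<open>P\<^sub>i[1]\<close>.  They lie in the usual fundamental domain, so two of
  them are isomorphic in the cluster category iff they are isomorphic in the derived category.
\<close>

datatype ('k, 'a, 'n) cobj = Mod "('k, 'a) umod" | Sh 'n

fun complex_of :: "('n \<Rightarrow> ('k::field, 'a) umod) \<Rightarrow> ('k, 'a, 'n) cobj \<Rightarrow> ('k, 'a) ucpx" where
  "complex_of P (Mod M) = stalk M"
| "complex_of P (Sh i) = shift (stalk (P i)) 1"

fun exceptional_object :: "('k::field \<Rightarrow> 'a::ring_1 \<Rightarrow> 'a) \<Rightarrow> ('k, 'a, 'n) cobj \<Rightarrow> bool" where
  "exceptional_object sc (Mod M) \<longleftrightarrow> fd_rmodule sc M \<and> exceptional sc M"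
| "exceptional_object sc (Sh i) \<longleftrightarrow> True"

fun g_vec ::
  "('k::field \<Rightarrow> 'a::ring_1 \<Rightarrow> 'a) \<Rightarrow> ('n::finite \<Rightarrow> ('k, 'a) umod) \<Rightarrow> ('n \<Rightarrow> ('k, 'a) umod) \<Rightarrow>
    ('k, 'a, 'n) cobj \<Rightarrow> real ^ 'n" where
  "g_vec sc S P (Mod M) = g_module sc S P M"
| "g_vec sc S P (Sh i) = - real (hom_dim (S i) (S i)) *\<^sub>R axis i 1"

text \<open>
  A cluster tilting object is given by its \<open>n = CARD('n)\<close> indecomposable summands.  On the chosen
  representatives, vanishing of \<open>Ext\<^sup>1\<close> in the cluster category is equivalent to vanishing
  of \<open>Ext\<^sup>1\<close> in the derived category; the latter is checked on pairs of summands.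
\<close>

definition cluster_tilting ::
  "('k::field \<Rightarrow> 'a::ring_1 \<Rightarrow> 'a) \<Rightarrow> ('n::finite \<Rightarrow> ('k, 'a) umod) \<Rightarrow> ('n \<Rightarrow> ('k, 'a, 'n) cobj) \<Rightarrow> bool" where
  "cluster_tilting sc P T \<longleftrightarrow>
     (\<forall>i. exceptional_object sc (T i)) \<and>
     (\<forall>i j. i \<noteq> j \<longrightarrow> \<not> iso_D sc (complex_of P (T i)) (complex_of P (T j))) \<and>
     (\<forall>i j. ext1_D_zero sc (complex_of P (T i)) (complex_of P (T j)))"

text \<open>The interiors of the simplices of codimension \<open>k\<close> of the cluster complex.\<close>

definition simplex_interiors ::
  "('k::field \<Rightarrow> 'a::ring_1 \<Rightarrow> 'a) \<Rightarrow> ('n::finite \<Rightarrow> ('k, 'a) umod) \<Rightarrow> ('n \<Rightarrow> ('k, 'a) umod) \<Rightarrow> nat \<Rightarrow>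
    (real ^ 'n) set set" where
  "simplex_interiors sc S P k =
     {{\<Sum>j\<in>J. c j *\<^sub>R g_vec sc S P (T j) | c. \<forall>j\<in>J. c j > (0::real)} | T J.
        cluster_tilting sc P T \<and> card J + k = CARD('n)}"

end

theory Submission
  imports Defs
begin

text \<open>
  Let \<open>x = \<Sum> c\<^sub>j g(T\<^sub>j)\<close> with \<open>c\<^sub>j > 0\<close> lie in \<open>D(M)\<close>.  Pairing with a \<open>g\<close>-vector is the Euler form:
  \<open>g(T) \<bullet> dim Y = hom(T, Y) - ext(T, Y)\<close>.  Applied to the trace of the modules \<open>T\<^sub>j\<close> in \<open>M\<close>, on which all
  \<open>Ext\<^sup>1(T\<^sub>j, -)\<close> vanish, semistability forces \<open>Hom(T\<^sub>j, M) = 0\<close>, and then \<open>x \<bullet> dim M = 0\<close> forces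
  \<open>Ext\<^sup>1(T\<^sub>j, M) = 0\<close>.  So \<open>M\<close> lies in the wide subcategory perpendicular to all but at most one of the \<open>T\<^sub>j\<close>.

  By the Happel--Ringel lemma the nonzero maps between the \<open>T\<^sub>j\<close> contain no cycles, so the Gram matrix of
  the Euler form on the classes of the \<open>T\<^sub>j\<close> is triangular with positive diagonal.  Hence the dimension
  vectors of the perpendicular category lie on one line, on which the Euler form is positive definite.
  A module \<open>X\<close> of smallest dimension in this category is then a brick; counting dimensions over its
  endomorphism ring gives \<open>Ext\<^sup>1(X, X) = 0\<close>.  All objects are iterated extensions of \<open>X\<close>, hence rigid.
\<close>

section \<open>Finite dimensional subspaces\<close>

definition fin_sub :: "('k::field \<Rightarrow> 'v::ab_group_add \<Rightarrow> 'v) \<Rightarrow> 'v set \<Rightarrow> bool" where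
  "fin_sub s V \<longleftrightarrow> vector_space s \<and> (\<exists>B. finite B \<and> V = module.span s B)"

lemma vs_module: "vector_space s \<Longrightarrow> module s"
  by (simp add: module_iff_vector_space)

lemma fin_sub_subspace: "fin_sub s V \<Longrightarrow> module.subspace s V"
  unfolding fin_sub_def using module.subspace_span vs_module by blast

lemma fin_sub_basis:
  assumes "fin_sub s V"
  obtains B where "finite B" "B \<subseteq> V" "\<not> module.dependent s B" "module.span s B = V"
    "vector_space.dim s V = card B"
proof -
  from assms interpret vector_space s by (simp add: fin_sub_def)
  obtain T where T: "finite T" "V = span T" using assms by (auto simp: fin_sub_def)
  obtain B where B: "B \<subseteq> V" "independent B" "V \<subseteq> span B"
    using maximal_independent_subset by blast
  have "finite B" using independent_span_bound[OF T(1) B(2)] B(1) T(2) by blast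
  moreover have "span B = V"
    using B T span_minimal[OF B(1)] by auto
  ultimately show ?thesis using that B basis_card_eq_dim[OF B(1,3,2)] by simp
qed

lemma fin_sub_mono:
  assumes "fin_sub s V" "module.subspace s U" "U \<subseteq> V"
  shows "fin_sub s U"
proof -
  from assms interpret vector_space s by (simp add: fin_sub_def)
  obtain T where T: "finite T" "V = span T" using assms by (auto simp: fin_sub_def)
  obtain B where B: "B \<subseteq> U" "independent B" "U \<subseteq> span B"
    using maximal_independent_subset by blast
  have "finite B" using independent_span_bound[OF T(1) B(2)] B(1) T(2) assms(3) by blast
  moreover have "span B = U"
    using B assms span_minimal[OF B(1)] by auto
  ultimately show ?thesis using vector_space_axioms by (auto simp: fin_sub_def)
qed

lemma (in vector_space) span_disjoint_independent:
  assumes "independent C" "A \<subseteq> C" "B \<subseteq> C" "A \<inter> B = {}" "x \<in> span A" "x \<in> span B"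
  shows "x = 0"
proof -
  have "representation A x = representation B x"
    using assms representation_extend by metis
  then have "representation A x b = 0" for b
    using representation_ne_zero[of A x b] representation_ne_zero[of B x b] assms(4) by auto
  then show ?thesis
    using sum_nonzero_representation_eq[OF independent_mono[OF assms(1,2)] assms(5)] by simp
qed

lemma rank_nullity_linear:
  assumes lin: "Vector_Spaces.linear s1 s2 f" and V: "fin_sub s1 V"
  shows "fin_sub s1 {x\<in>V. f x = 0}" "fin_sub s2 (f ` V)"
    "vector_space.dim s1 V = vector_space.dim s1 {x\<in>V. f x = 0} + vector_space.dim s2 (f ` V)"
proof -
  interpret Vector_Spaces.linear s1 s2 f by (rule lin)
  let ?K = "{x\<in>V. f x = 0}"
  have "vs1.subspace ?K"
    using vs1.subspace_inter[OF fin_sub_subspace[OF V] subspace_kernel]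
    by (simp add: Collect_conj_eq)
  then show K: "fin_sub s1 ?K" by (rule fin_sub_mono[OF V]) auto
  obtain BK where BK: "finite BK" "BK \<subseteq> ?K" "vs1.independent BK" "vs1.span BK = ?K" "vs1.dim ?K = card BK"
    by (rule fin_sub_basis[OF K])
  obtain C where C: "BK \<subseteq> C" "C \<subseteq> V" "vs1.independent C" "V \<subseteq> vs1.span C"
    using vs1.maximal_independent_subset_extend[of BK V] BK by blast
  have spC: "vs1.span C = V"
    using C vs1.span_minimal[OF C(2) fin_sub_subspace[OF V]] by auto
  obtain T where T: "finite T" "V = vs1.span T" using V by (auto simp: fin_sub_def)
  have finC: "finite C"
    using vs1.independent_span_bound[OF T(1) C(3)] C(2) T(2) by blast
  let ?D = "C - BK"
  have indD: "vs1.independent ?D" by (rule vs1.independent_mono[OF C(3)]) auto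
  have inj: "inj_on f (vs1.span ?D)"
  proof (subst inj_on_iff_eq_0)
    show "\<forall>x\<in>vs1.span ?D. f x = 0 \<longrightarrow> x = 0"
    proof (intro ballI impI)
      fix x assume x: "x \<in> vs1.span ?D" "f x = 0"
      have "x \<in> V" using x(1) vs1.span_mono[of ?D C] spC by auto
      then have "x \<in> vs1.span BK" using BK x by auto
      then show "x = 0"
        using vs1.span_disjoint_independent[OF C(3), of ?D BK x] C x by auto
    qed
  qed auto
  have indim: "vs2.independent (f ` ?D)"
    by (rule independent_injective_image[OF indD inj])
  have "f ` V = vs2.span (f ` C)" using spC span_image by metis
  also have "f ` C \<subseteq> insert 0 (f ` ?D)" using BK by auto
  then have "vs2.span (f ` C) \<subseteq> vs2.span (f ` ?D)"
    using vs2.span_mono[of "f ` C" "insert 0 (f ` ?D)"] by simp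
  then have "vs2.span (f ` C) = vs2.span (f ` ?D)"
    using vs2.span_mono[of "f ` ?D" "f ` C"] by auto
  finally have sp: "f ` V = vs2.span (f ` ?D)" .
  show "fin_sub s2 (f ` V)"
    unfolding fin_sub_def sp
    by (intro conjI exI[of _ "f ` ?D"] vs2.vector_space_axioms finite_imageI finite_Diff finC refl)
  have "vs2.dim (f ` V) = card (f ` ?D)"
    using sp vs2.dim_span_eq_card_independent[OF indim] by simp
  also have "\<dots> = card ?D"
    using inj vs1.span_superset[of ?D] by (meson card_image inj_on_subset)
  also have "\<dots> = card C - card BK" using C(1) finC by (simp add: card_Diff_subset BK(1))
  finally show "vs1.dim V = vs1.dim ?K + vs2.dim (f ` V)"
    using BK(5) vs1.dim_span_eq_card_independent[OF C(3)] spC card_mono[OF finC C(1)] by simp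
qed

lemma extend_to_linear:
  assumes "vector_space s1" "vector_space s2" "module.subspace s1 V"
    and add: "\<And>x y. x \<in> V \<Longrightarrow> y \<in> V \<Longrightarrow> f (x + y) = f x + f y"
    and sc: "\<And>c x. x \<in> V \<Longrightarrow> f (s1 c x) = s2 c (f x)"
  obtains g where "Vector_Spaces.linear s1 s2 g" "\<And>x. x \<in> V \<Longrightarrow> g x = f x"
proof -
  interpret vector_space_pair s1 s2
    using assms by (simp add: vector_space_pair_def)
  obtain B where B: "B \<subseteq> V" "vs1.independent B" "V \<subseteq> vs1.span B"
    using vs1.maximal_independent_subset by blast
  define g where "g = construct B f"
  have lin: "Vector_Spaces.linear s1 s2 g" unfolding g_def by (rule linear_construct[OF B(2)])
  interpret g: Vector_Spaces.linear s1 s2 g by (rule lin)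
  have "x \<in> V \<and> g x = f x" if "x \<in> vs1.span B" for x
    using that
  proof (induction rule: vs1.span_induct_alt)
    case base
    have "f 0 = 0" using sc[of 0 0] vs1.subspace_0[OF assms(3)] by simp
    then show ?case using vs1.subspace_0[OF assms(3)] by simp
  next
    case (step c x y)
    have "x \<in> V" using step B by auto
    moreover have "g x = f x" unfolding g_def using step by (simp add: construct_basis[OF B(2)])
    ultimately show ?case using step add sc
      by (simp add: g.add g.scale vs1.subspace_add[OF assms(3)] vs1.subspace_scale[OF assms(3)])
  qed
  then show ?thesis using that[OF lin] B(3) by blast
qed

lemma rank_nullity:
  assumes "vector_space s2" and V: "fin_sub s1 V"
    and add: "\<And>x y. x \<in> V \<Longrightarrow> y \<in> V \<Longrightarrow> f (x + y) = f x + f y"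
    and sc: "\<And>c x. x \<in> V \<Longrightarrow> f (s1 c x) = s2 c (f x)"
  shows "fin_sub s1 {x\<in>V. f x = 0}" "fin_sub s2 (f ` V)"
    "vector_space.dim s1 V = vector_space.dim s1 {x\<in>V. f x = 0} + vector_space.dim s2 (f ` V)"
proof -
  have vs: "vector_space s1" using V by (simp add: fin_sub_def)
  obtain g where g: "Vector_Spaces.linear s1 s2 g" "\<And>x. x \<in> V \<Longrightarrow> g x = f x"
  proof (rule extend_to_linear[OF vs assms(1) fin_sub_subspace[OF V], of f])
  qed (simp_all add: add sc)
  have e: "{x\<in>V. f x = 0} = {x\<in>V. g x = 0}" "f ` V = g ` V" using g(2) by auto
  show "fin_sub s1 {x\<in>V. f x = 0}" "fin_sub s2 (f ` V)"
    "vector_space.dim s1 V = vector_space.dim s1 {x\<in>V. f x = 0} + vector_space.dim s2 (f ` V)"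
    unfolding e by (rule rank_nullity_linear[OF g(1) V])+
qed

lemma dim_zero_space: "vector_space s \<Longrightarrow> vector_space.dim s {0} = 0"
proof -
  assume "vector_space s"
  then interpret vector_space s .
  show ?thesis using dim_span_eq_card_independent[OF independent_empty] by simp
qed

lemma fin_sub_zero: "vector_space s \<Longrightarrow> fin_sub s {0}"
  unfolding fin_sub_def using module.span_empty[OF vs_module] by blast

lemma fin_sub_dim_0:
  assumes "fin_sub s V" "vector_space.dim s V = 0" shows "V = {0}"
proof -
  interpret vector_space s using assms by (simp add: fin_sub_def)
  obtain B where "finite B" "span B = V" "dim V = card B"
    by (rule fin_sub_basis[OF assms(1)])
  then have "B = {}" "span B = V" using assms(2) by auto
  then show ?thesis by simp
qed

lemma dim_inj:
  assumes "vector_space s2" and V: "fin_sub s1 V"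
    and add: "\<And>x y. x \<in> V \<Longrightarrow> y \<in> V \<Longrightarrow> f (x + y) = f x + f y"
    and sc: "\<And>c x. x \<in> V \<Longrightarrow> f (s1 c x) = s2 c (f x)"
    and inj: "\<And>x. x \<in> V \<Longrightarrow> f x = 0 \<Longrightarrow> x = 0"
  shows "vector_space.dim s2 (f ` V) = vector_space.dim s1 V"
proof -
  have vs: "vector_space s1" using V by (simp add: fin_sub_def)
  have f0: "f 0 = 0" using sc[of 0 0] module.subspace_0[OF vs_module[OF vs] fin_sub_subspace[OF V]]
      module.scale_zero_left[OF vs_module[OF vs]] module.scale_zero_left[OF vs_module[OF assms(1)]] by metis
  have "{x\<in>V. f x = 0} = {0}"
    using inj f0 module.subspace_0[OF vs_module[OF vs] fin_sub_subspace[OF V]] by auto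
  moreover have "vector_space.dim s1 V = vector_space.dim s1 {x\<in>V. f x = 0} + vector_space.dim s2 (f ` V)"
    by (rule rank_nullity(3)[where f=f, OF assms(1) V]) (simp_all add: add sc)
  ultimately show ?thesis using dim_zero_space[OF vs] by simp
qed

lemma subspace_projection:
  assumes "vector_space s" "module.subspace s U"
  obtains g where "Vector_Spaces.linear s s g" "\<And>x. g x = 0 \<longleftrightarrow> x \<in> U" "\<And>x. x - g x \<in> U"
proof -
  interpret vector_space_pair s s
    using assms by (simp add: vector_space_pair_def)
  interpret id: Vector_Spaces.linear s s id
    by (rule vs1.linear_id)
  obtain h where h: "range h \<subseteq> U" "Vector_Spaces.linear s s h" "\<forall>v\<in>U. h (id v) = v"
    using linear_exists_left_inverse_on[OF id.linear_axioms assms(2)] by auto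
  interpret h: Vector_Spaces.linear s s h by (rule h(2))
  have "Vector_Spaces.linear s s (\<lambda>x. x - h x)"
    by (rule linear_compose_sub[OF vs1.linear_ident h(2)])
  moreover have "x - h x = 0 \<longleftrightarrow> x \<in> U" for x using h by auto
  moreover have "x - (x - h x) \<in> U" for x using h by auto
  ultimately show ?thesis using that by blast
qed

lemma fin_sub_dim_le:
  assumes "fin_sub s W" "module.subspace s U" "U \<subseteq> W"
  shows "vector_space.dim s U \<le> vector_space.dim s W"
    and "vector_space.dim s U = vector_space.dim s W \<Longrightarrow> U = W"
proof -
  have vs: "vector_space s" using assms by (simp add: fin_sub_def)
  obtain g where g: "Vector_Spaces.linear s s g" "\<And>x. g x = 0 \<longleftrightarrow> x \<in> U"
    by (rule subspace_projection[OF vs assms(2)]) blast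
  have e: "{x\<in>W. g x = 0} = U" using g assms(3) by auto
  note r = rank_nullity_linear[OF g(1) assms(1), unfolded e]
  show "vector_space.dim s U \<le> vector_space.dim s W" using r by simp
  assume "vector_space.dim s U = vector_space.dim s W"
  then have "g ` W = {0}" using fin_sub_dim_0[OF r(2)] r(3) by simp
  then show "U = W" using g assms(3) by auto
qed

lemma fin_sub_dim_disjoint:
  assumes W: "fin_sub s W" and U: "module.subspace s U" "U \<subseteq> W"
    and V: "module.subspace s V" "V \<subseteq> W" and "U \<inter> V = {0}"
  shows "vector_space.dim s U + vector_space.dim s V \<le> vector_space.dim s W"
proof -
  have vs: "vector_space s" using W by (simp add: fin_sub_def)
  obtain g where g: "Vector_Spaces.linear s s g" "\<And>x. g x = 0 \<longleftrightarrow> x \<in> U"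
    by (rule subspace_projection[OF vs U(1)]) blast
  interpret g: Vector_Spaces.linear s s g by (rule g(1))
  have e: "{x\<in>W. g x = 0} = U" using g U by auto
  note r = rank_nullity_linear[OF g(1) W, unfolded e]
  have "vector_space.dim s (g ` V) = vector_space.dim s V"
    by (rule dim_inj[OF vs fin_sub_mono[OF W V]])
      (use g assms in \<open>auto simp: g.add g.scale\<close>)
  moreover have "vector_space.dim s (g ` V) \<le> vector_space.dim s (g ` W)"
    by (rule fin_sub_dim_le[OF r(2)]) (use g.subspace_image[OF V(1)] V(2) in auto)
  ultimately show ?thesis using r(3) by simp
qed

lemma fin_sub_eval:
  assumes s1: "vector_space s1" and V: "module.subspace s1 V"
    and s2: "vector_space s2" and Y: "fin_sub s2 Y"
    and lin: "Vector_Spaces.linear s1 s2 f" and "f ` V \<subseteq> Y" and K: "fin_sub s1 {x\<in>V. f x = 0}"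
  shows "fin_sub s1 V"
proof -
  interpret Vector_Spaces.linear s1 s2 f by (rule lin)
  have "fin_sub s2 (f ` V)"
    by (rule fin_sub_mono[OF Y]) (use assms subspace_image[OF V] in auto)
  then obtain B where B: "finite B" "f ` V = vs2.span B" by (auto simp: fin_sub_def)
  obtain A where A: "finite A" "{x\<in>V. f x = 0} = vs1.span A" using K by (auto simp: fin_sub_def)
  have "B \<subseteq> f ` V" using B vs2.span_superset by auto
  then obtain C where C: "C \<subseteq> V" "finite C" "B = f ` C" using finite_subset_image[OF B(1)] by blast
  have "V \<subseteq> vs1.span (A \<union> C)"
  proof
    fix x assume x: "x \<in> V"
    then have "f x \<in> f ` vs1.span C" using B C span_image by blast
    then obtain y where y: "y \<in> vs1.span C" "f y = f x" by auto
    have "y \<in> V" using y C vs1.span_minimal V by blast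
    then have "x - y \<in> vs1.span A" using A y x V vs1.subspace_diff by (auto simp: diff)
    then have "(x - y) + y \<in> vs1.span (A \<union> C)" using y unfolding vs1.span_Un by blast
    then show "x \<in> vs1.span (A \<union> C)" by simp
  qed
  moreover have "A \<union> C \<subseteq> V" using A C vs1.span_superset by auto
  ultimately have "V = vs1.span (A \<union> C)" using vs1.span_minimal[OF _ V] by blast
  then show ?thesis using A C s1 by (auto simp: fin_sub_def)
qed

lemma sum_apply: "(\<Sum>i\<in>I. f i) x = (\<Sum>i\<in>I. f i x)"
  by (induction I rule: infinite_finite_induct) auto

lemma vs_seq: "vector_space (\<lambda>(c::'k::field) (f::nat \<Rightarrow> 'k) i. c * f i)"
  by unfold_locales (auto simp: algebra_simps fun_eq_iff)

lemma vs_fun: "vector_space s \<Longrightarrow> vector_space (\<lambda>c f x. s c (f x))"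
proof -
  assume "vector_space s"
  then interpret vector_space s .
  show ?thesis by unfold_locales (auto simp: fun_eq_iff scale_right_distrib scale_left_distrib)
qed

lemma fin_sub_embed:
  fixes s :: "'k::field \<Rightarrow> 'v::ab_group_add \<Rightarrow> 'v"
  assumes "fin_sub s V"
  obtains f :: "'v \<Rightarrow> nat \<Rightarrow> 'k" where "Vector_Spaces.linear s (\<lambda>c f i. c * f i) f" "inj_on f V"
proof -
  interpret vector_space_pair s "\<lambda>c (f::nat \<Rightarrow> 'k) i. c * f i"
    using assms by (simp add: vector_space_pair_def fin_sub_def vs_seq)
  obtain B where B: "finite B" "B \<subseteq> V" "vs1.independent B" "vs1.span B = V"
    by (rule fin_sub_basis[OF assms])
  obtain e :: "'v \<Rightarrow> nat" where e: "inj_on e B" using finite_imp_inj_to_nat_seg[OF B(1)] by auto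
  define f where "f = construct B (\<lambda>b i. if i = e b then 1 else (0::'k))"
  have lin: "Vector_Spaces.linear s (\<lambda>c f i. c * f i) f"
    unfolding f_def by (rule linear_construct[OF B(3)])
  interpret f: Vector_Spaces.linear s "\<lambda>c (f::nat \<Rightarrow> 'k) i. c * f i" f by (rule lin)
  have "inj_on f V"
  proof (subst f.inj_on_iff_eq_0)
    show "vs1.subspace V" using fin_sub_subspace[OF assms] .
    show "\<forall>x\<in>V. f x = 0 \<longrightarrow> x = 0"
    proof (intro ballI impI)
      fix x assume x: "x \<in> V" "f x = 0"
      obtain u where u: "x = (\<Sum>b\<in>B. s (u b) b)"
        using x(1) B(1,4) vs1.span_finite by (metis (no_types, lifting) imageE)
      have fx: "f x = (\<Sum>b\<in>B. (\<lambda>i. u b * (if i = e b then 1 else 0)))"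
        unfolding u f.sum f.scale by (rule sum.cong) (auto simp: f_def construct_basis[OF B(3)])
      then have "(\<Sum>b\<in>B. u b * (if i = e b then 1 else 0)) = 0" for i
        using fun_cong[OF fx, of i] unfolding x(2) sum_apply by simp
      then have "(\<Sum>b\<in>B. u b * (if e b' = e b then 1 else 0)) = 0" for b' .
      moreover have "(\<Sum>b\<in>B. u b * (if e b' = e b then 1 else 0)) = (\<Sum>b\<in>B. if b = b' then u b else 0)"
        if "b' \<in> B" for b'
        by (rule sum.cong) (use that e in \<open>auto simp: inj_on_def\<close>)
      ultimately have "u b' = 0" if "b' \<in> B" for b' using that B(1) by simp
      then show "x = 0" unfolding u by simp
    qed
  qed
  then show ?thesis using that lin by blast
qed

lemma nat_fun_induct [case_names zero step]:
  fixes m :: "'n::finite \<Rightarrow> nat"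
  assumes "Q (\<lambda>_. 0)" "\<And>m i. Q m \<Longrightarrow> Q (m(i := Suc (m i)))"
  shows "Q m"
proof (induction "sum m UNIV" arbitrary: m)
  case 0
  then have "m = (\<lambda>_. 0)" by auto
  then show ?case using assms by simp
next
  case (Suc k)
  then obtain i where i: "m i \<noteq> 0" by (metis Zero_not_Suc sum.neutral)
  let ?m = "m(i := m i - 1)"
  have "sum m UNIV = m i + sum m (UNIV - {i})" by (rule sum.remove) auto
  moreover have "sum ?m UNIV = ?m i + sum ?m (UNIV - {i})" by (rule sum.remove) auto
  moreover have "sum ?m (UNIV - {i}) = sum m (UNIV - {i})" by (rule sum.cong) auto
  ultimately have "k = sum ?m UNIV" using Suc.hyps(2) i by simp
  from Suc.hyps(1)[OF this] assms(2)[of ?m i] i show ?case by simp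
qed

text \<open>
  In the second part \<open>d = \<Sum> a\<^sub>j t\<^sub>j\<close>, where \<open>a\<^sub>i = 0\<close> for all \<open>i\<close> strictly above \<open>k\<close>, so that
  \<open>E d d = a\<^sub>k E (t\<^sub>k) d = a\<^sub>k\<^sup>2 E (t\<^sub>k) (t\<^sub>k)\<close>.
\<close>

lemma triangular_gram:
  fixes E :: "real ^ 'n \<Rightarrow> real ^ 'n \<Rightarrow> real" and t :: "'n::finite \<Rightarrow> real ^ 'n"
  assumes bil: "bounded_bilinear E" and wf: "wf {(i, j). i \<noteq> j \<and> E (t i) (t j) \<noteq> 0}"
    and pos: "\<And>i. E (t i) (t i) > 0"
  shows "(\<forall>j. E (t j) y = 0) \<Longrightarrow> y = 0"
    and "(\<And>j. j \<noteq> k \<Longrightarrow> E (t j) d = 0) \<Longrightarrow> d \<noteq> 0 \<Longrightarrow> E d d > 0"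
proof -
  interpret bounded_bilinear E by (rule bil)
  let ?R = "{(i, j). i \<noteq> j \<and> E (t i) (t j) \<noteq> 0}"
  have acyc: "acyclic ?R" by (rule wf_acyclic[OF wf])
  have wf': "wf (?R\<inverse>)" by (rule finite_acyclic_wf_converse[OF _ acyc]) (rule finite)
  define L where "L a = (\<Sum>j\<in>UNIV. a $ j *\<^sub>R t j)" for a :: "real ^ 'n"
  have EL: "E x (L a) = (\<Sum>j\<in>UNIV. a $ j * E x (t j))" for x a
    by (simp add: L_def sum_right scaleR_right)
  have EL': "E (L a) x = (\<Sum>j\<in>UNIV. a $ j * E (t j) x)" for x a
    by (simp add: L_def sum_left scaleR_left)
  have single: "E (t i) (L a) = a $ i * E (t i) (t i)"
    if "\<And>j. (i, j) \<in> ?R \<Longrightarrow> a $ j = 0" for a i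
  proof -
    have "E (t i) (L a) = (\<Sum>j\<in>UNIV. if j = i then a $ i * E (t i) (t i) else 0)"
      unfolding EL using that by (intro sum.cong) auto
    then show ?thesis by simp
  qed
  have nondeg: "a = 0" if a: "\<And>i. E (t i) (L a) = 0" for a
  proof (rule ccontr)
    assume "a \<noteq> 0"
    then obtain i0 where i0: "i0 \<in> {i. a $ i \<noteq> 0}" by (auto simp: vec_eq_iff)
    obtain i where i: "a $ i \<noteq> 0" "\<And>j. (j, i) \<in> ?R\<inverse> \<Longrightarrow> j \<notin> {i. a $ i \<noteq> 0}"
      by (rule wfE_min[OF wf' i0]) auto
    then have "a $ i * E (t i) (t i) = 0" using single[of i a] a[of i] by auto
    then show False using i(1) pos[of i] by simp
  qed
  have linL: "linear L" by (rule linearI) (simp_all add: L_def algebra_simps sum.distrib scaleR_sum_right)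
  have "inj L"
    by (subst linear_injective_0[OF linL]) (use nondeg zero_right in auto)
  then have "surj L" by (rule linear_injective_imp_surjective[OF linL _ refl])
  then have L: "\<exists>a. x = L a" for x by (metis surjD)
  show c1: "y = 0" if y: "\<forall>j. E (t j) y = 0" for y
  proof -
    obtain a where a: "y = L a" using L by blast
    then have "a = 0" using nondeg y by blast
    then show ?thesis using a by (simp add: L_def)
  qed
  show "E d d > 0" if d: "\<And>j. j \<noteq> k \<Longrightarrow> E (t j) d = 0" and "d \<noteq> 0"
  proof -
    obtain a where a: "d = L a" using L by blast
    have succ: "(k, i) \<in> ?R\<^sup>+ \<Longrightarrow> a $ i = 0" for i
    proof (induction i rule: wf_induct_rule[OF wf'])
      case (1 i)
      have "i \<noteq> k" using "1.prems" acyc by (auto simp: acyclic_def)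
      then have "E (t i) (L a) = 0" using d a by simp
      moreover have "a $ j = 0" if "(i, j) \<in> ?R" for j
        by (rule "1.IH") (use that trancl_into_trancl[OF "1.prems" that] in auto)
      ultimately have "a $ i * E (t i) (t i) = 0" using single[of i a] by simp
      then show ?case using pos[of i] by simp
    qed
    then have k: "E (t k) d = a $ k * E (t k) (t k)" unfolding a by (intro single succ r_into_trancl)
    have "E d d = (\<Sum>j\<in>UNIV. a $ j * E (t j) d)" using EL'[of a d] a by simp
    also have "\<dots> = (\<Sum>j\<in>UNIV. if j = k then a $ k * E (t k) d else 0)"
      using d by (intro sum.cong) auto
    finally have dd: "E d d = (a $ k)\<^sup>2 * E (t k) (t k)" by (simp add: k power2_eq_square)
    have "a $ k \<noteq> 0"
    proof
      assume "a $ k = 0"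
      then have "E (t j) d = 0" for j using k d by (cases "j = k") auto
      then show False using c1[of d] \<open>d \<noteq> 0\<close> by blast
    qed
    then show ?thesis using dd pos[of k] by simp
  qed
qed

section \<open>Homomorphisms, submodules and quotients\<close>

locale fin_dim_alg =
  fixes sc :: "'k::field \<Rightarrow> 'a::ring_1 \<Rightarrow> 'a"
  assumes alg: "fd_algebra sc"
begin

abbreviation fdm :: "('k, 'a, 'm::ab_group_add) rmod \<Rightarrow> bool" where
  "fdm \<equiv> fd_rmodule sc"

lemma mod_vs: "fdm M \<Longrightarrow> vector_space (scl M)"
  by (simp add: fd_rmodule_def)

lemma mod_fin: "fdm M \<Longrightarrow> fin_sub (scl M) (car M)"
  by (auto simp: fd_rmodule_def fin_sub_def)

lemma mod_subspace: "fdm M \<Longrightarrow> module.subspace (scl M) (car M)"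
  by (simp add: mod_fin fin_sub_subspace)

lemma mod_module: "fdm M \<Longrightarrow> module (scl M)"
  by (simp add: mod_vs vs_module)

lemma mod_0: "fdm M \<Longrightarrow> 0 \<in> car M"
  by (rule module.subspace_0[OF mod_module mod_subspace])

lemma mod_add: "fdm M \<Longrightarrow> x \<in> car M \<Longrightarrow> y \<in> car M \<Longrightarrow> x + y \<in> car M"
  by (rule module.subspace_add[OF mod_module mod_subspace])

lemma mod_diff: "fdm M \<Longrightarrow> x \<in> car M \<Longrightarrow> y \<in> car M \<Longrightarrow> x - y \<in> car M"
  by (rule module.subspace_diff[OF mod_module mod_subspace])

lemma mod_neg: "fdm M \<Longrightarrow> x \<in> car M \<Longrightarrow> - x \<in> car M"
  by (rule module.subspace_neg[OF mod_module mod_subspace])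

lemma mod_scl: "fdm M \<Longrightarrow> x \<in> car M \<Longrightarrow> scl M c x \<in> car M"
  by (rule module.subspace_scale[OF mod_module mod_subspace])

lemma mod_act: "fdm M \<Longrightarrow> x \<in> car M \<Longrightarrow> act M x a \<in> car M"
  by (simp add: fd_rmodule_def)

lemma act_add: "fdm M \<Longrightarrow> x \<in> car M \<Longrightarrow> y \<in> car M \<Longrightarrow> act M (x + y) a = act M x a + act M y a"
  by (simp add: fd_rmodule_def)

lemma act_0: "fdm M \<Longrightarrow> act M 0 a = 0"
  using act_add[of M 0 0 a] mod_0[of M] by simp

lemma act_neg: "fdm M \<Longrightarrow> x \<in> car M \<Longrightarrow> act M (- x) a = - act M x a"
  using act_add[of M x "-x" a] mod_neg[of M x] act_0[of M a] by (simp add: eq_neg_iff_add_eq_0 add.commute)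

lemma act_diff: "fdm M \<Longrightarrow> x \<in> car M \<Longrightarrow> y \<in> car M \<Longrightarrow> act M (x - y) a = act M x a - act M y a"
  using act_add[of M x "-y" a] mod_neg[of M y] act_neg[of M y a] by simp

lemma scl_act: "fdm M \<Longrightarrow> x \<in> car M \<Longrightarrow> scl M c x = act M x (sc c 1)"
  by (simp add: fd_rmodule_def)

lemma act_scl:
  assumes "fdm M" "x \<in> car M" shows "act M (scl M c x) a = scl M c (act M x a)"
proof -
  have "act M (scl M c x) a = act M x (sc c 1 * a)"
    using assms by (simp add: scl_act) (simp add: fd_rmodule_def)
  also have "sc c 1 * a = sc c a"
    using alg by (simp add: fd_algebra.sc_mult_left)
  finally show ?thesis using assms by (simp add: fd_rmodule_def)
qed

lemma homsI:
  assumes "\<And>x. x \<in> car M \<Longrightarrow> f x \<in> car N"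
    "\<And>x y. x \<in> car M \<Longrightarrow> y \<in> car M \<Longrightarrow> f (x + y) = f x + f y"
    "\<And>x a. x \<in> car M \<Longrightarrow> f (act M x a) = act N (f x) a"
    "\<And>x. x \<notin> car M \<Longrightarrow> f x = 0"
  shows "f \<in> homs M N"
  using assms by (simp add: homs_def)

lemma hom_in: "f \<in> homs M N \<Longrightarrow> x \<in> car M \<Longrightarrow> f x \<in> car N"
  and hom_add: "f \<in> homs M N \<Longrightarrow> x \<in> car M \<Longrightarrow> y \<in> car M \<Longrightarrow> f (x + y) = f x + f y"
  and hom_act: "f \<in> homs M N \<Longrightarrow> x \<in> car M \<Longrightarrow> f (act M x a) = act N (f x) a"
  and hom_out: "f \<in> homs M N \<Longrightarrow> x \<notin> car M \<Longrightarrow> f x = 0"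
  by (simp_all add: homs_def)

lemma hom_0: "f \<in> homs M N \<Longrightarrow> f 0 = 0"
  by (cases "0 \<in> car M") (use hom_add[of f M N 0 0] hom_out[of f M N 0] in auto)

lemma hom_in_all: "f \<in> homs M N \<Longrightarrow> fdm N \<Longrightarrow> f x \<in> car N"
  by (cases "x \<in> car M") (auto simp: hom_in hom_out mod_0)

lemma hom_neg: "fdm M \<Longrightarrow> f \<in> homs M N \<Longrightarrow> x \<in> car M \<Longrightarrow> f (- x) = - f x"
  using hom_add[of f M N x "-x"] mod_neg[of M x] hom_0[of f M N]
  by (simp add: eq_neg_iff_add_eq_0 add.commute)

lemma hom_diff: "fdm M \<Longrightarrow> f \<in> homs M N \<Longrightarrow> x \<in> car M \<Longrightarrow> y \<in> car M \<Longrightarrow> f (x - y) = f x - f y"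
  using hom_add[of f M N x "-y"] mod_neg[of M y] hom_neg[of M f N y] by simp

lemma hom_scl: "fdm M \<Longrightarrow> fdm N \<Longrightarrow> f \<in> homs M N \<Longrightarrow> x \<in> car M \<Longrightarrow> f (scl M c x) = scl N c (f x)"
  by (simp add: scl_act hom_act hom_in)

lemma hom_eqI:
  assumes "f \<in> homs M N" "g \<in> homs M N'" "\<And>x. x \<in> car M \<Longrightarrow> f x = g x" shows "f = g"
  using assms hom_out by (metis ext)

lemma hom_comp: "f \<in> homs X Y \<Longrightarrow> g \<in> homs Y Z \<Longrightarrow> (\<lambda>x. g (f x)) \<in> homs X Z"
  by (rule homsI) (simp_all add: hom_in hom_add hom_act hom_out hom_0)

lemma hom_zero: "fdm Y \<Longrightarrow> (\<lambda>x. 0) \<in> homs X Y"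
  by (rule homsI) (simp_all add: mod_0 act_0)

lemma hom_plus:
  assumes "fdm Y" "f \<in> homs X Y" "g \<in> homs X Y" shows "(\<lambda>x. f x + g x) \<in> homs X Y"
  using assms by (intro homsI) (simp_all add: hom_in hom_add hom_act hom_out mod_add act_add)

lemma hom_minus:
  assumes "fdm Y" "f \<in> homs X Y" "g \<in> homs X Y" shows "(\<lambda>x. f x - g x) \<in> homs X Y"
  using assms by (intro homsI) (simp_all add: hom_in hom_add hom_act hom_out mod_diff act_diff)

lemma hom_scale:
  assumes "fdm Y" "f \<in> homs X Y" shows "(\<lambda>x. scl Y c (f x)) \<in> homs X Y"
  using assms by (intro homsI)
    (simp_all add: hom_in hom_add hom_act hom_out mod_scl act_scl
      module.scale_right_distrib[OF mod_module] module.scale_zero_right[OF mod_module])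

lemma submoduleI:
  assumes "N \<subseteq> car M" "0 \<in> N" "\<And>x y. x \<in> N \<Longrightarrow> y \<in> N \<Longrightarrow> x + y \<in> N"
    "\<And>x a. x \<in> N \<Longrightarrow> act M x a \<in> N"
  shows "submodule M N"
  using assms by (simp add: submodule_def)

lemma submodule_car: "fdm M \<Longrightarrow> submodule M (car M)"
  by (intro submoduleI) (auto simp: mod_0 mod_add mod_act)

lemma submodule_0: "fdm M \<Longrightarrow> submodule M {0}"
  by (intro submoduleI) (auto simp: mod_0 act_0)

lemma sub_in: "submodule M N \<Longrightarrow> x \<in> N \<Longrightarrow> x \<in> car M"
  and sub_le: "submodule M N \<Longrightarrow> N \<subseteq> car M"
  and sub_0: "submodule M N \<Longrightarrow> 0 \<in> N"
  and sub_add: "submodule M N \<Longrightarrow> x \<in> N \<Longrightarrow> y \<in> N \<Longrightarrow> x + y \<in> N"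
  and sub_act: "submodule M N \<Longrightarrow> x \<in> N \<Longrightarrow> act M x a \<in> N"
  by (auto simp: submodule_def)

lemma sub_scl: "fdm M \<Longrightarrow> submodule M N \<Longrightarrow> x \<in> N \<Longrightarrow> scl M c x \<in> N"
  by (simp add: scl_act sub_in sub_act)

lemma sub_subspace: "fdm M \<Longrightarrow> submodule M N \<Longrightarrow> module.subspace (scl M) N"
  by (intro module.subspaceI mod_module) (auto intro: sub_0 sub_add sub_scl)

lemma sub_diff: "fdm M \<Longrightarrow> submodule M N \<Longrightarrow> x \<in> N \<Longrightarrow> y \<in> N \<Longrightarrow> x - y \<in> N"
  by (meson sub_subspace mod_module module.subspace_diff)

lemma sub_fin: "fdm M \<Longrightarrow> submodule M N \<Longrightarrow> fin_sub (scl M) N"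
  by (rule fin_sub_mono[OF mod_fin]) (auto intro: sub_subspace sub_in)

lemma sub_fdm:
  assumes M: "fdm M" and N: "submodule M N" shows "fdm (submod M N)"
proof -
  have "\<exists>B. finite B \<and> N = module.span (scl M) B"
    using sub_fin[OF M N] by (simp add: fin_sub_def)
  moreover have "x \<in> N \<Longrightarrow> x \<in> car M" for x using sub_in[OF N] .
  ultimately show ?thesis using M sub_act[OF N] by (simp add: fd_rmodule_def)
qed

lemma submodule_trans:
  "submodule M N \<Longrightarrow> submodule (submod M N) L \<longleftrightarrow> submodule M L \<and> L \<subseteq> N"
  by (auto simp: submodule_def)

lemma hom_sub_cod: "f \<in> homs X (submod Y N) \<longleftrightarrow> f \<in> homs X Y \<and> f ` car X \<subseteq> N"
  if "N \<subseteq> car Y" using that by (auto simp: homs_def)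

definition restr :: "'m set \<Rightarrow> ('m \<Rightarrow> 'n::zero) \<Rightarrow> 'm \<Rightarrow> 'n" where
  "restr N f x = (if x \<in> N then f x else 0)"

lemma restr_hom: "f \<in> homs X Y \<Longrightarrow> submodule X N \<Longrightarrow> restr N f \<in> homs (submod X N) Y"
  by (rule homsI) (auto simp: restr_def hom_in hom_add hom_act sub_in sub_add sub_act)

lemma incl_hom: "submodule X N \<Longrightarrow> restr N (\<lambda>x. x) \<in> homs (submod X N) X"
  by (rule homsI) (auto simp: restr_def sub_in sub_add sub_act)

lemma id_hom: "fdm X \<Longrightarrow> restr (car X) (\<lambda>x. x) \<in> homs X X"
  by (rule homsI) (auto simp: restr_def mod_add mod_act)

lemma kernel_in: "x \<in> kernel X f \<longleftrightarrow> x \<in> car X \<and> f x = 0"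
  by (simp add: kernel_def)

lemma kernel_submodule: "fdm X \<Longrightarrow> fdm Y \<Longrightarrow> f \<in> homs X Y \<Longrightarrow> submodule X (kernel X f)"
  by (rule submoduleI)
    (auto simp: kernel_def mod_0 hom_0 hom_add mod_add mod_act hom_act act_0)

lemma image_submodule:
  assumes "fdm X" "f \<in> homs X Y" "submodule X N" shows "submodule Y (f ` N)"
proof (rule submoduleI)
  show "f ` N \<subseteq> car Y" using assms sub_in hom_in by blast
  show "0 \<in> f ` N" using hom_0[OF assms(2)] sub_0[OF assms(3)] by force
  fix x assume "x \<in> f ` N"
  then obtain u where u: "u \<in> N" "x = f u" by auto
  show "act Y x a \<in> f ` N" for a
    using u sub_act[OF assms(3) u(1), of a] hom_act[OF assms(2) sub_in[OF assms(3) u(1)], of a] by force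
  fix y assume "y \<in> f ` N"
  then obtain v where v: "v \<in> N" "y = f v" by auto
  show "x + y \<in> f ` N"
    using u v sub_add[OF assms(3) u(1) v(1)]
      hom_add[OF assms(2) sub_in[OF assms(3) u(1)] sub_in[OF assms(3) v(1)]] by force
qed

lemma vimage_submodule:
  assumes "fdm X" "f \<in> homs X Y" "submodule Y N" shows "submodule X {x\<in>car X. f x \<in> N}"
  using assms by (intro submoduleI)
    (auto simp: mod_0 hom_0 hom_add mod_add mod_act hom_act sub_0 sub_add sub_act)

lemma sum_submodule:
  assumes "fdm X" "submodule X N" "submodule X L" shows "submodule X {x + y | x y. x \<in> N \<and> y \<in> L}"
proof (rule submoduleI)
  show "{x + y | x y. x \<in> N \<and> y \<in> L} \<subseteq> car X" using assms by (auto simp: mod_add sub_in)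
  show "0 \<in> {x + y | x y. x \<in> N \<and> y \<in> L}"
    using sub_0[OF assms(2)] sub_0[OF assms(3)] by (intro CollectI exI[of _ 0]) auto
  fix x assume "x \<in> {x + y | x y. x \<in> N \<and> y \<in> L}"
  then obtain u v where x: "x = u + v" "u \<in> N" "v \<in> L" by auto
  have "act X x a = act X u a + act X v a" for a
    using assms x by (simp add: act_add sub_in)
  then show "act X x a \<in> {x + y | x y. x \<in> N \<and> y \<in> L}" for a
    using sub_act[OF assms(2) x(2), of a] sub_act[OF assms(3) x(3), of a] by blast
  fix y assume "y \<in> {x + y | x y. x \<in> N \<and> y \<in> L}"
  then obtain u' v' where y: "y = u' + v'" "u' \<in> N" "v' \<in> L" by auto
  have "x + y = (u + u') + (v + v')" using x y by (simp add: algebra_simps)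
  then show "x + y \<in> {x + y | x y. x \<in> N \<and> y \<in> L}"
    using sub_add[OF assms(2) x(2) y(2)] sub_add[OF assms(3) x(3) y(3)] by blast
qed

lemma inter_submodule: "submodule X N \<Longrightarrow> submodule X L \<Longrightarrow> submodule X (N \<inter> L)"
  by (auto simp: submodule_def)

lemma hom_injD:
  assumes "fdm X" "f \<in> homs X Y" "kernel X f = {0}" shows "inj_on f (car X)"
proof (rule inj_onI)
  fix x y assume "x \<in> car X" "y \<in> car X" "f x = f y"
  then have "x - y \<in> kernel X f"
    using mod_diff[OF assms(1)] hom_diff[OF assms(1,2)] by (simp add: kernel_in)
  then have "x - y = 0" unfolding assms(3) by simp
  then show "x = y" by simp
qed

lemma inj_kernel:
  assumes "fdm X" "f \<in> homs X Y" "inj_on f (car X)" shows "kernel X f = {0}"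
  using assms mod_0[OF assms(1)] hom_0[OF assms(2)] by (auto simp: kernel_def inj_on_def)

lemma hom_factor:
  assumes X: "fdm X" and q: "q \<in> homs X Y" "q ` car X = car Y"
    and f: "f \<in> homs X Z" and ker: "kernel X q \<subseteq> kernel X f"
  obtains h where "h \<in> homs Y Z" "\<And>x. x \<in> car X \<Longrightarrow> h (q x) = f x"
proof -
  define h where "h y = (if y \<in> car Y then f (SOME x. x \<in> car X \<and> q x = y) else 0)" for y
  have h: "h (q x) = f x" if x: "x \<in> car X" for x
  proof -
    let ?z = "SOME z. z \<in> car X \<and> q z = q x"
    have z: "?z \<in> car X \<and> q ?z = q x" by (rule someI[of _ x]) (use x in auto)
    then have "?z - x \<in> kernel X q" using x X q by (simp add: kernel_def mod_diff hom_diff)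
    then have "f (?z - x) = 0" using ker by (auto simp: kernel_def)
    then have "f ?z = f x" using z x X f by (simp add: hom_diff)
    then show ?thesis unfolding h_def using x hom_in[OF q(1)] by simp
  qed
  have "h \<in> homs Y Z"
  proof (rule homsI)
    fix y assume "y \<in> car Y"
    then obtain x where x: "x \<in> car X" "y = q x" using q(2) by auto
    show "h y \<in> car Z" using x h f hom_in by metis
    show "h (act Y y a) = act Z (h y) a" for a
      using x h[OF mod_act[OF X x(1)], of a] h[OF x(1)] hom_act[OF q(1) x(1)] hom_act[OF f x(1)] by simp
    fix y' assume "y' \<in> car Y"
    then obtain x' where x': "x' \<in> car X" "y' = q x'" using q(2) by auto
    show "h (y + y') = h y + h y'"
      using x x' h[OF mod_add[OF X x(1) x'(1)]] h[OF x(1)] h[OF x'(1)] hom_add[OF q(1) x(1) x'(1)]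
        hom_add[OF f x(1) x'(1)] by simp
  qed (simp add: h_def)
  then show ?thesis using that h by blast
qed

lemma iso_inverse:
  assumes X: "fdm X" and f: "f \<in> homs X Y" "bij_betw f (car X) (car Y)"
  obtains g where "g \<in> homs Y X" "bij_betw g (car Y) (car X)"
    "\<And>x. x \<in> car X \<Longrightarrow> g (f x) = x" "\<And>y. y \<in> car Y \<Longrightarrow> f (g y) = y"
proof -
  have im: "f ` car X = car Y" and inj: "inj_on f (car X)" using f(2) by (auto simp: bij_betw_def)
  have "kernel X f \<subseteq> kernel X (restr (car X) (\<lambda>x. x))"
    using inj_kernel[OF X f(1) inj] by (auto simp: kernel_def restr_def mod_0 X)
  then obtain g where g: "g \<in> homs Y X" "\<And>x. x \<in> car X \<Longrightarrow> g (f x) = restr (car X) (\<lambda>x. x) x"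
    by (rule hom_factor[OF X f(1) im id_hom[OF X]]) auto
  have g1: "g (f x) = x" if "x \<in> car X" for x using g(2)[OF that] that by (simp add: restr_def)
  moreover have g2: "f (g y) = y" if "y \<in> car Y" for y using that unfolding im[symmetric] by (auto simp: g1)
  moreover have "bij_betw g (car Y) (car X)"
    by (rule bij_betw_byWitness[where f'=f]) (use g1 g2 hom_in[OF g(1)] hom_in[OF f(1)] in auto)
  ultimately show ?thesis using that g(1) by blast
qed

lemma iso_sym: "fdm X \<Longrightarrow> iso X Y \<Longrightarrow> iso Y X"
  unfolding iso_def by (metis iso_inverse)

lemma iso_trans: "iso X Y \<Longrightarrow> iso Y Z \<Longrightarrow> iso X Z"
proof -
  assume "iso X Y" "iso Y Z"
  then obtain f g where "f \<in> homs X Y" "bij_betw f (car X) (car Y)" "g \<in> homs Y Z" "bij_betw g (car Y) (car Z)"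
    by (auto simp: iso_def)
  then have "(\<lambda>x. g (f x)) \<in> homs X Z" "bij_betw (\<lambda>x. g (f x)) (car X) (car Z)"
    using hom_comp bij_betw_trans[of f "car X" "car Y" g "car Z"] by (auto simp: comp_def)
  then show ?thesis by (auto simp: iso_def)
qed

text \<open>The quotient is realised on a vector space complement of \<open>N\<close>.\<close>

lemma quotient_exists:
  fixes X :: "('k, 'a, 'm::ab_group_add) rmod"
  assumes X: "fdm X" and N: "submodule X N"
  obtains Y :: "('k, 'a, 'm) rmod" and q where "fdm Y" "q \<in> homs X Y" "q ` car X = car Y" "kernel X q = N"
proof -
  obtain g where g: "Vector_Spaces.linear (scl X) (scl X) g" "\<And>x. g x = 0 \<longleftrightarrow> x \<in> N" "\<And>x. x - g x \<in> N"
    using subspace_projection[OF mod_vs[OF X] sub_subspace[OF X N]] by blast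
  interpret g: Vector_Spaces.linear "scl X" "scl X" g by (rule g(1))
  define Y where "Y = X\<lparr>car := g ` car X, act := \<lambda>x a. g (act X x a)\<rparr>"
  have gin: "g x \<in> car X" if "x \<in> car X" for x
    using mod_diff[OF X that sub_in[OF N g(3)[of x]]] by simp
  have gact: "g (act X (g x) a) = g (act X x a)" if x: "x \<in> car X" for x a
  proof -
    have "act X (x - g x) a \<in> N" using sub_act[OF N g(3)] .
    then have "g (act X x a - act X (g x) a) = 0" using g(2) x gin X by (simp add: act_diff)
    then show ?thesis by (simp add: g.diff)
  qed
  have gact2: "g (act X (act X (g x) a) b) = g (act X (act X x a) b)" if x: "x \<in> car X" for x a b
    using gact[OF mod_act[OF X x], of a b] gact[OF mod_act[OF X gin[OF x]], of a b] gact[OF x, of a] by simp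
  have gg: "g (g x) = g x" for x
    using g(2)[of "x - g x"] g(3)[of x] by (simp add: g.diff)
  note rk = rank_nullity_linear[OF g(1) mod_fin[OF X]]
  have a: "\<exists>B. finite B \<and> g ` car X = g.vs1.span B" using rk(2) by (auto simp: fin_sub_def)
  have Xm: "act X x (b + c) = act X x b + act X x c" "act X x (b * c) = act X (act X x b) c" "act X x 1 = x"
     "act X x (sc d b) = scl X d (act X x b)"
    if "x \<in> car X" for x b c d
    using X that by (simp_all add: fd_rmodule_def)
  have "fdm Y"
    unfolding fd_rmodule_def Y_def
    by (auto simp: mod_vs[OF X] a act_add[OF X] g.add g.scale gact gact2 gg Xm mod_act[OF X] gin)
  moreover have "restr (car X) g \<in> homs X Y"
    by (rule homsI) (auto simp: Y_def restr_def g.add gact mod_add[OF X] mod_act[OF X])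
  moreover have "restr (car X) g ` car X = car Y" by (auto simp: Y_def restr_def)
  moreover have "kernel X (restr (car X) g) = N"
    using g(2) sub_in[OF N] by (auto simp: kernel_def restr_def)
  ultimately show ?thesis using that by blast
qed

lemma umod_exists:
  fixes X :: "('k, 'a, 'm::ab_group_add) rmod"
  assumes X: "fdm X"
  obtains Y :: "('k, 'a) umod" and f where "fdm Y" "f \<in> homs X Y" "bij_betw f (car X) (car Y)"
proof -
  obtain f :: "'m \<Rightarrow> nat \<Rightarrow> 'k" where f: "Vector_Spaces.linear (scl X) (\<lambda>c f i. c * f i) f" "inj_on f (car X)"
    using fin_sub_embed[OF mod_fin[OF X]] by blast
  interpret f: Vector_Spaces.linear "scl X" "\<lambda>c (f::nat \<Rightarrow> 'k) i. c * f i" f by (rule f(1))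
  let ?g = "the_inv_into (car X) f"
  define Y :: "('k, 'a) umod" where
    "Y = \<lparr>car = f ` car X, scl = (\<lambda>c f i. c * f i), act = (\<lambda>y a. f (act X (?g y) a))\<rparr>"
  have g: "?g (f x) = x" if "x \<in> car X" for x using that f(2) by (simp add: the_inv_into_f_f)
  have fin: "\<exists>B. finite B \<and> f ` car X = f.vs2.span B"
    using rank_nullity_linear(2)[OF f(1) mod_fin[OF X]] by (simp add: fin_sub_def)
  have Xm: "act X x (b + c) = act X x b + act X x c" "act X x (b * c) = act X (act X x b) c" "act X x 1 = x"
     "act X x (sc d b) = scl X d (act X x b)"
    if "x \<in> car X" for x b c d
    using X that by (simp_all add: fd_rmodule_def)
  have gadd: "?g (f x + f y) = x + y" if "x \<in> car X" "y \<in> car X" for x y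
    using g[OF mod_add[OF X that]] by (simp add: f.add)
  have "fdm Y"
    unfolding fd_rmodule_def Y_def
    by (auto simp: vs_seq fin g gadd act_add[OF X] f.add Xm mod_act[OF X] simp flip: f.scale)
  moreover have "restr (car X) f \<in> homs X Y"
    by (rule homsI) (auto simp: Y_def restr_def g f.add mod_add[OF X] mod_act[OF X])
  moreover have "bij_betw (restr (car X) f) (car X) (car Y)"
    using f(2) by (auto simp: Y_def bij_betw_def inj_on_def restr_def)
  ultimately show ?thesis using that by blast
qed

section \<open>Dimensions of Hom spaces\<close>

abbreviation hscl :: "('k, 'a, 'n::ab_group_add) rmod \<Rightarrow> 'k \<Rightarrow> ('m \<Rightarrow> 'n) \<Rightarrow> 'm \<Rightarrow> 'n" where
  "hscl Y \<equiv> (\<lambda>c f x. scl Y c (f x))"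

lemma hom_vs: "fdm Y \<Longrightarrow> vector_space (hscl Y)"
  by (rule vs_fun[OF mod_vs])

lemma hom_zero': "fdm Y \<Longrightarrow> 0 \<in> homs X Y"
  using hom_zero by (simp add: zero_fun_def)

lemma hom_subspace: "fdm Y \<Longrightarrow> module.subspace (hscl Y) (homs X Y)"
  by (intro module.subspaceI vs_module hom_vs)
    (auto simp: plus_fun_def hom_zero' hom_plus hom_scale)

lemma eval_linear: "vector_space s \<Longrightarrow> Vector_Spaces.linear (\<lambda>c f x. s c (f x)) s (\<lambda>f. f b)"
  by (simp add: Vector_Spaces.linear_iff vs_fun)

lemma hom_fin:
  assumes X: "fdm X" and Y: "fdm Y" shows "fin_sub (hscl Y) (homs X Y)"
proof -
  note hv = hom_vs[OF Y] and sub = hom_subspace[OF Y]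
  have step: "finite C \<Longrightarrow> fin_sub (hscl Y) {f\<in>homs X Y. \<forall>b\<in>C. f b = 0} \<Longrightarrow> fin_sub (hscl Y) (homs X Y)" for C
  proof (induction C rule: finite_induct)
    case (insert b C)
    let ?V = "{f\<in>homs X Y. \<forall>b\<in>C. f b = 0}"
    have "fin_sub (hscl Y) ?V"
    proof (rule fin_sub_eval[OF hv _ mod_vs[OF Y] mod_fin[OF Y] eval_linear[OF mod_vs[OF Y], of b]])
      show "module.subspace (hscl Y) ?V"
        using sub by (auto simp: module.subspace_def[OF vs_module[OF hv]] module.scale_zero_right[OF mod_module[OF Y]])
      show "(\<lambda>f. f b) ` ?V \<subseteq> car Y" using hom_in_all[OF _ Y] by auto
      have "{f \<in> ?V. f b = 0} = {f\<in>homs X Y. \<forall>b\<in>insert b C. f b = 0}" by auto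
      then show "fin_sub (hscl Y) {f \<in> ?V. f b = 0}" using insert.prems by simp
    qed
    then show ?case by (rule insert.IH)
  qed simp
  obtain B where B: "finite B" "car X = module.span (scl X) B" using mod_fin[OF X] by (auto simp: fin_sub_def)
  have "f = 0" if f: "f \<in> homs X Y" "\<forall>b\<in>B. f b = 0" for f
  proof -
    have "B \<subseteq> kernel X f"
      using B f module.span_superset[OF mod_module[OF X]] by (auto simp: kernel_def)
    then have "module.span (scl X) B \<subseteq> kernel X f"
      by (rule module.span_minimal[OF mod_module[OF X]])
        (rule sub_subspace[OF X kernel_submodule[OF X Y f(1)]])
    then show "f = 0" using B f hom_out[OF f(1)] by (auto simp: kernel_def fun_eq_iff)
  qed
  then have "{f\<in>homs X Y. \<forall>b\<in>B. f b = 0} = {0}" using hom_zero'[OF Y] by auto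
  then show ?thesis using step[OF B(1)] fin_sub_zero[OF hv] by simp
qed

lemma hom_dim_0: "fdm X \<Longrightarrow> fdm Y \<Longrightarrow> hom_dim X Y = 0 \<longleftrightarrow> homs X Y = {0}"
  unfolding hom_dim_def using fin_sub_dim_0[OF hom_fin] dim_zero_space[OF hom_vs] by metis

lemma hom_dim_pos: "fdm X \<Longrightarrow> fdm Y \<Longrightarrow> f \<in> homs X Y \<Longrightarrow> f \<noteq> 0 \<Longrightarrow> hom_dim X Y > 0"
  using hom_dim_0[of X Y] by auto

lemma hom_dim_posE:
  assumes "fdm X" "fdm Y" "hom_dim X Y > 0"
  obtains f where "f \<in> homs X Y" "f \<noteq> 0"
  using assms hom_dim_0[of X Y] hom_zero'[of Y X] by auto

lemma hom_rank:
  assumes X: "fdm X" and Y: "fdm Y" and Y': "fdm Y'"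
    and add: "\<And>f g. f \<in> homs X Y \<Longrightarrow> g \<in> homs X Y \<Longrightarrow> \<Phi> (f + g) = \<Phi> f + \<Phi> g"
    and scl: "\<And>c f. f \<in> homs X Y \<Longrightarrow> \<Phi> (\<lambda>x. scl Y c (f x)) = (\<lambda>x. scl Y' c (\<Phi> f x))"
  shows "hom_dim X Y = vector_space.dim (hscl Y) {f\<in>homs X Y. \<Phi> f = 0} + vector_space.dim (hscl Y') (\<Phi> ` homs X Y)"
    and "fin_sub (hscl Y') (\<Phi> ` homs X Y)"
proof -
  note r = rank_nullity[where f=\<Phi>, OF hom_vs[OF Y'] hom_fin[OF X Y]]
  show "hom_dim X Y = vector_space.dim (hscl Y) {f\<in>homs X Y. \<Phi> f = 0} + vector_space.dim (hscl Y') (\<Phi> ` homs X Y)"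
    unfolding hom_dim_def by (rule r(3)) (simp_all add: add scl)
  show "fin_sub (hscl Y') (\<Phi> ` homs X Y)"
    by (rule r(2)) (simp_all add: add scl)
qed

lemma hom_rank_inj:
  assumes X: "fdm X" and Y: "fdm Y" and Y': "fdm Y'"
    and add: "\<And>f g. f \<in> homs X Y \<Longrightarrow> g \<in> homs X Y \<Longrightarrow> \<Phi> (f + g) = \<Phi> f + \<Phi> g"
    and scl: "\<And>c f. f \<in> homs X Y \<Longrightarrow> \<Phi> (\<lambda>x. scl Y c (f x)) = (\<lambda>x. scl Y' c (\<Phi> f x))"
    and inj: "\<And>f. f \<in> homs X Y \<Longrightarrow> \<Phi> f = 0 \<Longrightarrow> f = 0"
  shows "vector_space.dim (hscl Y') (\<Phi> ` homs X Y) = hom_dim X Y"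
  unfolding hom_dim_def
  by (rule dim_inj[OF hom_vs[OF Y'] hom_fin[OF X Y]]) (simp_all add: add scl inj)

lemma hom_postcomp_rank:
  assumes X: "fdm X" and Y: "fdm Y" and Z: "fdm Z" and q: "q \<in> homs Y Z"
  shows "hom_dim X Y = hom_dim X (submod Y (kernel Y q)) +
      vector_space.dim (hscl Z) ((\<lambda>f x. q (f x)) ` homs X Y)"
proof -
  have "{f\<in>homs X Y. (\<lambda>x. q (f x)) = 0} = homs X (submod Y (kernel Y q))"
  proof (intro set_eqI iffI)
    fix f assume "f \<in> {f\<in>homs X Y. (\<lambda>x. q (f x)) = 0}"
    then show "f \<in> homs X (submod Y (kernel Y q))"
      by (subst hom_sub_cod) (auto simp: kernel_def hom_in fun_eq_iff)
  next
    fix f assume "f \<in> homs X (submod Y (kernel Y q))"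
    then have f: "f \<in> homs X Y" "f ` car X \<subseteq> kernel Y q"
      using hom_sub_cod[of "kernel Y q" Y f X] by (auto simp: kernel_def)
    have "q (f x) = 0" for x
      by (cases "x \<in> car X") (use f hom_out[OF f(1)] hom_0[OF q] in \<open>auto simp: kernel_def\<close>)
    then show "f \<in> {f\<in>homs X Y. (\<lambda>x. q (f x)) = 0}" using f by (simp add: fun_eq_iff)
  qed
  moreover have "hom_dim X Y = vector_space.dim (hscl Y) {f\<in>homs X Y. (\<lambda>x. q (f x)) = 0} +
      vector_space.dim (hscl Z) ((\<lambda>f x. q (f x)) ` homs X Y)"
    by (rule hom_rank(1)[OF X Y Z])
      (auto simp: fun_eq_iff hom_in_all[OF _ Y] hom_add[OF q] hom_scl[OF Y Z q])
  ultimately show ?thesis by (simp add: hom_dim_def)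
qed

lemma hom_dim_iso2:
  assumes X: "fdm X" and Y: "fdm Y" and Z: "fdm Z" and "iso Y Z"
  shows "hom_dim X Y = hom_dim X Z"
proof -
  obtain f where f: "f \<in> homs Y Z" "bij_betw f (car Y) (car Z)" using assms by (auto simp: iso_def)
  obtain g where g: "g \<in> homs Z Y" "\<And>x. x \<in> car Y \<Longrightarrow> g (f x) = x" "\<And>y. y \<in> car Z \<Longrightarrow> f (g y) = y"
    by (rule iso_inverse[OF Y f]) blast
  have "vector_space.dim (hscl Z) ((\<lambda>h x. f (h x)) ` homs X Y) = hom_dim X Y"
  proof (rule hom_rank_inj[OF X Y Z])
    fix h assume h: "h \<in> homs X Y" "(\<lambda>x. f (h x)) = 0"
    then have "g (f (h x)) = 0" for x using hom_0[OF g(1)] by (simp add: fun_eq_iff)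
    then show "h = 0" using g(2) hom_in_all[OF h(1) Y] by (simp add: fun_eq_iff)
  qed (auto simp: fun_eq_iff hom_in_all[OF _ Y] hom_add[OF f(1)] hom_scl[OF Y Z f(1)])
  moreover have "(\<lambda>h x. f (h x)) ` homs X Y = homs X Z"
  proof (intro equalityI subsetI)
    fix u assume u: "u \<in> homs X Z"
    have e: "u = (\<lambda>x. f (g (u x)))" using g(3) hom_in_all[OF u Z] by auto
    show "u \<in> (\<lambda>h x. f (h x)) ` homs X Y"
    proof (rule image_eqI)
      show "u = (\<lambda>h x. f (h x)) (\<lambda>x. g (u x))" by (rule e)
    qed (rule hom_comp[OF u g(1)])
  qed (auto intro: hom_comp[OF _ f(1)])
  ultimately show ?thesis by (simp add: hom_dim_def)
qed

lemma hom_precomp_epi: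
  assumes P: "fdm P" and X: "fdm X" and Y: "fdm Y"
    and p: "p \<in> homs P X" "p ` car P = car X"
  shows "vector_space.dim (hscl Y) {f\<in>homs P Y. \<forall>x\<in>kernel P p. f x = 0} = hom_dim X Y"
proof -
  have "vector_space.dim (hscl Y) ((\<lambda>h x. h (p x)) ` homs X Y) = hom_dim X Y"
  proof (rule hom_rank_inj[OF X Y Y])
    fix h assume h: "h \<in> homs X Y" "(\<lambda>x. h (p x)) = 0"
    have "h y = 0" for y
    proof (cases "y \<in> car X")
      case True
      then obtain x where "y = p x" using p(2) by auto
      then show ?thesis using h(2) by (simp add: fun_eq_iff)
    qed (simp add: hom_out[OF h(1)])
    then show "h = 0" by (simp add: fun_eq_iff)
  qed (auto simp: fun_eq_iff)
  moreover have "(\<lambda>h x. h (p x)) ` homs X Y = {f\<in>homs P Y. \<forall>x\<in>kernel P p. f x = 0}"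
  proof (intro equalityI subsetI)
    fix f assume "f \<in> (\<lambda>h x. h (p x)) ` homs X Y"
    then show "f \<in> {f\<in>homs P Y. \<forall>x\<in>kernel P p. f x = 0}"
      using hom_comp[OF p(1)] hom_0 by (fastforce simp: kernel_def)
  next
    fix f assume f: "f \<in> {f\<in>homs P Y. \<forall>x\<in>kernel P p. f x = 0}"
    then have fh: "f \<in> homs P Y" "kernel P p \<subseteq> kernel P f" by (auto simp: kernel_def)
    obtain h where h: "h \<in> homs X Y" "\<And>x. x \<in> car P \<Longrightarrow> h (p x) = f x"
      by (rule hom_factor[OF P p fh]) blast
    have "f = (\<lambda>x. h (p x))"
      by (rule hom_eqI[OF fh(1) hom_comp[OF p(1) h(1)]]) (simp add: h(2))
    then show "f \<in> (\<lambda>h x. h (p x)) ` homs X Y" using h(1) by blast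
  qed
  ultimately show ?thesis by simp
qed

lemma hom_dim_iso1:
  assumes X: "fdm X" and Y: "fdm Y" and Z: "fdm Z" and "iso X Y"
  shows "hom_dim X Z = hom_dim Y Z"
proof -
  obtain f where f: "f \<in> homs X Y" "bij_betw f (car X) (car Y)" using assms by (auto simp: iso_def)
  have im: "f ` car X = car Y" and inj: "inj_on f (car X)" using f(2) by (auto simp: bij_betw_def)
  have "{h\<in>homs X Z. \<forall>x\<in>kernel X f. h x = 0} = homs X Z"
    unfolding inj_kernel[OF X f(1) inj] using hom_0 by auto
  then show ?thesis using hom_precomp_epi[OF X Y Z f(1) im] by (simp add: hom_dim_def)
qed

lemma hom_dim_restrict:
  assumes P: "fdm P" and X: "fdm X" and Y: "fdm Y"
    and p: "p \<in> homs P X" "p ` car P = car X"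
  shows "hom_dim P Y = hom_dim X Y + vector_space.dim (hscl Y) (restr (kernel P p) ` homs P Y)"
    and "fin_sub (hscl Y) (restr (kernel P p) ` homs P Y)"
proof -
  have "{f\<in>homs P Y. restr (kernel P p) f = 0} = {f\<in>homs P Y. \<forall>x\<in>kernel P p. f x = 0}"
    by (auto simp: restr_def fun_eq_iff)
  then show "hom_dim P Y = hom_dim X Y + vector_space.dim (hscl Y) (restr (kernel P p) ` homs P Y)"
    using hom_rank(1)[OF P Y Y, of "restr (kernel P p)"] hom_precomp_epi[OF P X Y p]
    by (auto simp: restr_def fun_eq_iff module.scale_zero_right[OF mod_module[OF Y]])
  show "fin_sub (hscl Y) (restr (kernel P p) ` homs P Y)"
    by (rule hom_rank(2)[OF P Y Y])
     (auto simp: restr_def fun_eq_iff module.scale_zero_right[OF mod_module[OF Y]])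
qed

section \<open>Projective modules\<close>

lemma proj_lift:
  assumes P: "projective sc P" and X: "fdm X" and Y: "fdm Y"
    and p: "p \<in> homs X Y" "p ` car X = car Y" and f: "f \<in> homs P Y"
  obtains h where "h \<in> homs P X" "\<And>x. x \<in> car P \<Longrightarrow> p (h x) = f x"
proof -
  obtain X' :: "('k, 'a) umod" and a where X': "fdm X'" and a: "a \<in> homs X X'" "bij_betw a (car X) (car X')"
    by (rule umod_exists[OF X])
  obtain a' where a': "a' \<in> homs X' X" "bij_betw a' (car X') (car X)"
    by (rule iso_inverse[OF X a]) blast
  obtain Y' :: "('k, 'a) umod" and b where Y': "fdm Y'" and b: "b \<in> homs Y Y'" "bij_betw b (car Y) (car Y')"
    by (rule umod_exists[OF Y])
  have "(\<lambda>x. b (p (a' x))) ` car X' = b ` p ` a' ` car X'" by (simp add: image_image)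
  also have "\<dots> = car Y'" using a'(2) b(2) p(2) by (simp add: bij_betw_def)
  finally have im: "(\<lambda>x. b (p (a' x))) ` car X' = car Y'" .
  have "\<exists>h\<in>homs P X'. \<forall>x\<in>car P. b (p (a' (h x))) = b (f x)"
    using P[unfolded projective_def, rule_format, OF hom_comp[OF hom_comp[OF a'(1) p(1)] b(1)] hom_comp[OF f b(1)]]
      X' Y' im by simp
  then obtain h where h: "h \<in> homs P X'" "\<And>x. x \<in> car P \<Longrightarrow> b (p (a' (h x))) = b (f x)" by blast
  have "p (a' (h x)) = f x" if "x \<in> car P" for x
    by (rule inj_onD[OF bij_betw_imp_inj_on[OF b(2)] h(2)[OF that]])
      (use that hom_in[OF f] hom_in[OF p(1)] hom_in[OF a'(1)] hom_in[OF h(1)] in auto)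
  then show ?thesis using that[OF hom_comp[OF h(1) a'(1)]] by blast
qed

lemma proj_iso:
  assumes P: "fdm P" and pr: "projective sc P" and "iso P Q"
  shows "projective sc Q"
  unfolding projective_def
proof (intro allI ballI impI, elim conjE)
  fix X Y :: "('k, 'a) umod" and p f
  assume p: "p \<in> homs X Y" and f: "f \<in> homs Q Y" and X: "fdm X" and Y: "fdm Y" and im: "p ` car X = car Y"
  obtain a where a: "a \<in> homs P Q" "bij_betw a (car P) (car Q)" using assms by (auto simp: iso_def)
  obtain a' where a': "a' \<in> homs Q P" "\<And>y. y \<in> car Q \<Longrightarrow> a (a' y) = y"
    by (rule iso_inverse[OF P a]) blast
  obtain h where h: "h \<in> homs P X" "\<And>x. x \<in> car P \<Longrightarrow> p (h x) = f (a x)"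
    by (rule proj_lift[OF pr X Y p im hom_comp[OF a(1) f]]) blast
  show "\<exists>h\<in>homs Q X. \<forall>x\<in>car Q. p (h x) = f x"
    using hom_comp[OF a'(1) h(1)] h(2) hom_in[OF a'(1)] a'(2) by (intro bexI[of _ "\<lambda>x. h (a' x)"]) auto
qed

lemma iso_sub:
  assumes P: "fdm P" and f: "f \<in> homs P Q" "bij_betw f (car P) (car Q)" and N: "submodule P N"
  shows "iso (submod P N) (submod Q (f ` N))"
proof -
  have "restr N f \<in> homs (submod P N) (submod Q (f ` N))"
    by (subst hom_sub_cod) (use sub_le[OF image_submodule[OF P f(1) N]] restr_hom[OF f(1) N] in \<open>auto simp: restr_def\<close>)
  moreover have "bij_betw (restr N f) N (f ` N)"
    using f(2) sub_le[OF N] by (auto simp: bij_betw_def inj_on_def restr_def)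
  ultimately show ?thesis by (auto simp: iso_def)
qed

lemma hereditary_sub:
  assumes her: "hereditary sc" and P: "fdm P" and pr: "projective sc P" and N: "submodule P N"
  shows "projective sc (submod P N)"
proof -
  obtain P' :: "('k, 'a) umod" and a where P': "fdm P'" and a: "a \<in> homs P P'" "bij_betw a (car P) (car P')"
    by (rule umod_exists[OF P])
  have pr': "projective sc P'" by (rule proj_iso[OF P pr]) (use a in \<open>auto simp: iso_def\<close>)
  have N': "submodule P' (a ` N)" by (rule image_submodule[OF P a(1) N])
  have "projective sc (submod P' (a ` N))" using her P' pr' N' by (auto simp: hereditary_def)
  then show ?thesis
    by (rule proj_iso[OF sub_fdm[OF P' N']]) (rule iso_sym[OF sub_fdm[OF P N] iso_sub[OF P a N]])
qed

lemma hom_dim_exact: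
  assumes P: "fdm P" "projective sc P" and Y: "fdm Y" and Z: "fdm Z" and q: "q \<in> homs Y Z" "q ` car Y = car Z"
  shows "hom_dim P Y = hom_dim P (submod Y (kernel Y q)) + hom_dim P Z"
proof -
  have "(\<lambda>f x. q (f x)) ` homs P Y = homs P Z"
  proof (intro equalityI subsetI)
    fix f assume f: "f \<in> homs P Z"
    obtain h where h: "h \<in> homs P Y" "\<And>x. x \<in> car P \<Longrightarrow> q (h x) = f x"
      by (rule proj_lift[OF P(2) Y Z q f]) blast
    have "f = (\<lambda>x. q (h x))" by (rule hom_eqI[OF f hom_comp[OF h(1) q(1)]]) (simp add: h(2))
    then show "f \<in> (\<lambda>f x. q (f x)) ` homs P Y" using h(1) by blast
  qed (auto intro: hom_comp[OF _ q(1)])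
  then show ?thesis using hom_postcomp_rank[OF P(1) Y Z q(1)] by (simp add: hom_dim_def)
qed

section \<open>Vanishing of the extension group\<close>

definition extends :: "('k, 'a, 'p::ab_group_add) rmod \<Rightarrow> 'p set \<Rightarrow> ('k, 'a, 'm::ab_group_add) rmod \<Rightarrow> bool" where
  "extends P N Y \<longleftrightarrow> (\<forall>h\<in>homs (submod P N) Y. \<exists>H\<in>homs P Y. \<forall>x\<in>N. H x = h x)"

definition proj_epi :: "('k, 'a, 'p::ab_group_add) rmod \<Rightarrow> ('p \<Rightarrow> 'm) \<Rightarrow> ('k, 'a, 'm::ab_group_add) rmod \<Rightarrow> bool" where
  "proj_epi P p X \<longleftrightarrow> fdm P \<and> projective sc P \<and> p \<in> homs P X \<and> p ` car P = car X"

text \<open>\<open>Ext\<^sup>1(X, Y) = 0\<close>, read off from the projective presentations of \<open>X\<close>; one presentation suffices.\<close>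

definition Ext0 :: "('k, 'a, 'm::ab_group_add) rmod \<Rightarrow> ('k, 'a, 'n::ab_group_add) rmod \<Rightarrow> bool" where
  "Ext0 X Y \<longleftrightarrow> (\<forall>(P :: ('k, 'a) umod) p. proj_epi P p X \<longrightarrow> extends P (kernel P p) Y)"

lemma extends_compare:
  assumes X: "fdm X" and Y: "fdm Y" and P: "proj_epi P p X" and Q: "proj_epi Q q X"
    and ext: "extends P (kernel P p) Y"
  shows "extends Q (kernel Q q) Y"
  unfolding extends_def
proof
  fix h assume h: "h \<in> homs (submod Q (kernel Q q)) Y"
  have P: "fdm P" "projective sc P" "p \<in> homs P X" "p ` car P = car X"
    and Q: "fdm Q" "projective sc Q" "q \<in> homs Q X" "q ` car Q = car X"
    using P Q by (auto simp: proj_epi_def)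
  have kP: "submodule P (kernel P p)" and kQ: "submodule Q (kernel Q q)"
    using kernel_submodule P Q X by auto
  obtain a where a: "a \<in> homs Q P" "\<And>x. x \<in> car Q \<Longrightarrow> p (a x) = q x"
    by (rule proj_lift[OF Q(2) P(1) X P(3,4) Q(3)]) blast
  obtain b where b: "b \<in> homs P Q" "\<And>x. x \<in> car P \<Longrightarrow> q (b x) = p x"
    by (rule proj_lift[OF P(2) Q(1) X Q(3,4) P(3)]) blast
  have "restr (kernel P p) b \<in> homs (submod P (kernel P p)) (submod Q (kernel Q q))"
    by (subst hom_sub_cod)
      (use restr_hom[OF b(1) kP] b hom_in[OF b(1)] in \<open>auto simp: restr_def kernel_def\<close>)
  from hom_comp[OF this h] obtain H where H: "H \<in> homs P Y"
    "\<And>x. x \<in> kernel P p \<Longrightarrow> H x = h (b x)"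
    using ext by (auto simp: extends_def restr_def)
  let ?d = "\<lambda>x. restr (car Q) (\<lambda>x. x) x - b (a x)"
  have "?d \<in> homs Q (submod Q (kernel Q q))"
    by (subst hom_sub_cod)
      (use hom_minus[OF Q(1) id_hom[OF Q(1)] hom_comp[OF a(1) b(1)]] a b Q hom_in[OF a(1)] hom_in[OF b(1)] in
        \<open>auto simp: restr_def kernel_def mod_diff hom_diff\<close>)
  then have "(\<lambda>x. H (a x) + h (?d x)) \<in> homs Q Y"
    by (intro hom_plus[OF Y] hom_comp[OF a(1) H(1)] hom_comp[OF _ h])
  moreover have "H (a x) + h (?d x) = h x" if x: "x \<in> kernel Q q" for x
  proof -
    have xQ: "x \<in> car Q" using x by (simp add: kernel_def)
    have ax: "a x \<in> kernel P p" using x a hom_in[OF a(1)] by (simp add: kernel_def)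
    have bax: "b (a x) \<in> kernel Q q" using ax b hom_in[OF b(1)] by (simp add: kernel_def)
    have "h (x - b (a x)) = h x - h (b (a x))"
      using hom_diff[OF sub_fdm[OF Q(1) kQ] h] x bax by simp
    then show ?thesis using H(2)[OF ax] xQ by (simp add: restr_def)
  qed
  ultimately show "\<exists>H\<in>homs Q Y. \<forall>x\<in>kernel Q q. H x = h x"
    by (intro bexI[of _ "\<lambda>x. H (a x) + h (?d x)"] ballI)
qed

lemma Ext0I:
  assumes "fdm X" "fdm Y" "proj_epi P p X" "extends P (kernel P p) Y" shows "Ext0 X Y"
  unfolding Ext0_def using extends_compare[OF assms(1,2,3) _ assms(4)] by blast

lemma proj_epi_umod:
  assumes X: "fdm X" and P: "proj_epi P p X"
  obtains P' :: "('k, 'a) umod" and f where "proj_epi P' (\<lambda>x. p (f x)) X" "f \<in> homs P' P" "bij_betw f (car P') (car P)"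
proof -
  have P: "fdm P" "projective sc P" "p \<in> homs P X" "p ` car P = car X"
    using P by (auto simp: proj_epi_def)
  obtain P' :: "('k, 'a) umod" and a where P': "fdm P'" and a: "a \<in> homs P P'" "bij_betw a (car P) (car P')"
    by (rule umod_exists[OF P(1)])
  have pr': "projective sc P'" by (rule proj_iso[OF P(1,2)]) (use a in \<open>auto simp: iso_def\<close>)
  obtain f where f: "f \<in> homs P' P" "bij_betw f (car P') (car P)"
    by (rule iso_inverse[OF P(1) a]) blast
  have "(\<lambda>x. p (f x)) ` car P' = p ` f ` car P'" by (simp add: image_image)
  also have "\<dots> = car X" using f(2) P(4) by (simp add: bij_betw_def)
  finally have "proj_epi P' (\<lambda>x. p (f x)) X"
    using P' pr' hom_comp[OF f(1) P(3)] by (simp add: proj_epi_def)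
  then show ?thesis using that f by blast
qed

lemma Ext0D:
  assumes X: "fdm X" and Y: "fdm Y" and P: "proj_epi P p X" and "Ext0 X Y"
  shows "extends P (kernel P p) Y"
proof -
  obtain P' :: "('k, 'a) umod" and f where P': "proj_epi P' (\<lambda>x. p (f x)) X"
    by (rule proj_epi_umod[OF X P])
  then show ?thesis using extends_compare[OF X Y P' P] assms(4) by (auto simp: Ext0_def)
qed

lemma Ext0_E:
  assumes "fdm X" "fdm Y" "proj_epi P p X" "Ext0 X Y" "h \<in> homs (submod P (kernel P p)) Y"
  obtains H where "H \<in> homs P Y" "\<And>x. x \<in> kernel P p \<Longrightarrow> H x = h x"
  using Ext0D[OF assms(1-4)] assms(5) by (auto simp: extends_def)

lemma Ext0_dim:
  assumes X: "fdm X" and Y: "fdm Y" and P: "proj_epi P p X"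
  shows "hom_dim P Y \<le> hom_dim X Y + hom_dim (submod P (kernel P p)) Y"
    and "hom_dim P Y = hom_dim X Y + hom_dim (submod P (kernel P p)) Y \<longleftrightarrow> Ext0 X Y"
proof -
  have PP: "fdm P" "projective sc P" "p \<in> homs P X" "p ` car P = car X"
    using P by (auto simp: proj_epi_def)
  let ?N = "kernel P p"
  have k: "submodule P ?N" using kernel_submodule PP X by auto
  note r = hom_dim_restrict[OF PP(1) X Y PP(3,4)]
  have le: "restr ?N ` homs P Y \<subseteq> homs (submod P ?N) Y" using restr_hom[OF _ k] by blast
  note d = fin_sub_dim_le[OF hom_fin[OF sub_fdm[OF PP(1) k] Y] fin_sub_subspace[OF r(2)] le]
  show "hom_dim P Y \<le> hom_dim X Y + hom_dim (submod P ?N) Y" using r(1) d(1) by (simp add: hom_dim_def)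
  have "hom_dim P Y = hom_dim X Y + hom_dim (submod P ?N) Y \<longleftrightarrow> restr ?N ` homs P Y = homs (submod P ?N) Y"
    using r(1) d(2) by (auto simp: hom_dim_def)
  also have "\<dots> \<longleftrightarrow> extends P ?N Y"
  proof
    assume e: "restr ?N ` homs P Y = homs (submod P ?N) Y"
    show "extends P ?N Y" unfolding extends_def
    proof
      fix h assume "h \<in> homs (submod P ?N) Y"
      then obtain H where "H \<in> homs P Y" "h = restr ?N H" using e by blast
      then show "\<exists>H\<in>homs P Y. \<forall>x\<in>?N. H x = h x" by (auto simp: restr_def)
    qed
  next
    assume e: "extends P ?N Y"
    have "h \<in> restr ?N ` homs P Y" if h: "h \<in> homs (submod P ?N) Y" for h
    proof -
      obtain H where H: "H \<in> homs P Y" "\<forall>x\<in>?N. H x = h x" using e h by (auto simp: extends_def)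
      have "h = restr ?N H"
        by (rule hom_eqI[OF h restr_hom[OF H(1) k]]) (simp add: H(2) restr_def)
      then show ?thesis using H(1) by blast
    qed
    then show "restr ?N ` homs P Y = homs (submod P ?N) Y" using le by blast
  qed
  also have "\<dots> \<longleftrightarrow> Ext0 X Y" using Ext0I[OF X Y P] Ext0D[OF X Y P] by blast
  finally show "hom_dim P Y = hom_dim X Y + hom_dim (submod P ?N) Y \<longleftrightarrow> Ext0 X Y" .
qed

section \<open>Direct sums\<close>

definition biprod :: "('k, 'a, 'q::ab_group_add) rmod \<Rightarrow> ('k, 'a, 'm::ab_group_add) rmod \<Rightarrow> ('k, 'a, 'n::ab_group_add) rmod \<Rightarrow>
    ('m \<Rightarrow> 'q) \<Rightarrow> ('q \<Rightarrow> 'm) \<Rightarrow> ('n \<Rightarrow> 'q) \<Rightarrow> ('q \<Rightarrow> 'n) \<Rightarrow> bool" where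
  "biprod Q X Y i1 p1 i2 p2 \<longleftrightarrow> i1 \<in> homs X Q \<and> p1 \<in> homs Q X \<and> i2 \<in> homs Y Q \<and> p2 \<in> homs Q Y \<and>
     (\<forall>x\<in>car X. p1 (i1 x) = x \<and> p2 (i1 x) = 0) \<and> (\<forall>y\<in>car Y. p1 (i2 y) = 0 \<and> p2 (i2 y) = y) \<and>
     (\<forall>z\<in>car Q. i1 (p1 z) + i2 (p2 z) = z)"

lemma biprodD:
  assumes "biprod Q X Y i1 p1 i2 p2"
  shows "i1 \<in> homs X Q" "p1 \<in> homs Q X" "i2 \<in> homs Y Q" "p2 \<in> homs Q Y"
    "\<And>z. z \<in> car Q \<Longrightarrow> i1 (p1 z) + i2 (p2 z) = z"
    "\<And>x. x \<in> car X \<Longrightarrow> p1 (i1 x) = x" "\<And>x. x \<in> car X \<Longrightarrow> p2 (i1 x) = 0"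
    "\<And>y. y \<in> car Y \<Longrightarrow> p1 (i2 y) = 0" "\<And>y. y \<in> car Y \<Longrightarrow> p2 (i2 y) = y"
  using assms by (auto simp: biprod_def)

lemma biprod_surj:
  assumes "biprod Q X Y i1 p1 i2 p2" shows "p2 ` car Q = car Y"
proof (intro equalityI subsetI)
  note b = biprodD[OF assms]
  fix y assume "y \<in> car Y"
  then show "y \<in> p2 ` car Q" using b(9)[of y] hom_in[OF b(3)] by (metis imageI)
qed (auto intro: hom_in[OF biprodD(4)[OF assms]])

lemma biprod_projective:
  assumes b: "biprod Q X Y i1 p1 i2 p2" and X: "projective sc X" and Y: "projective sc Y"
  shows "projective sc Q"
  unfolding projective_def
proof (intro allI ballI impI, elim conjE)
  fix A B :: "('k, 'a) umod" and p f
  assume p: "p \<in> homs A B" and f: "f \<in> homs Q B" and A: "fdm A" and B: "fdm B" and im: "p ` car A = car B"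
  note b = biprodD[OF b]
  obtain g where g: "g \<in> homs X A" "\<And>x. x \<in> car X \<Longrightarrow> p (g x) = f (i1 x)"
    by (rule proj_lift[OF X A B p im hom_comp[OF b(1) f]]) blast
  obtain h where h: "h \<in> homs Y A" "\<And>x. x \<in> car Y \<Longrightarrow> p (h x) = f (i2 x)"
    by (rule proj_lift[OF Y A B p im hom_comp[OF b(3) f]]) blast
  have "(\<lambda>z. g (p1 z) + h (p2 z)) \<in> homs Q A"
    by (intro hom_plus[OF A] hom_comp[OF b(2) g(1)] hom_comp[OF b(4) h(1)])
  moreover have "p (g (p1 z) + h (p2 z)) = f z" if z: "z \<in> car Q" for z
  proof -
    have "p (g (p1 z) + h (p2 z)) = f (i1 (p1 z)) + f (i2 (p2 z))"
      using g h b z p by (simp add: hom_add[OF p] hom_in[OF g(1)] hom_in[OF h(1)] hom_in[OF b(2)] hom_in[OF b(4)])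
    also have "\<dots> = f (i1 (p1 z) + i2 (p2 z))"
      using z by (simp add: hom_add[OF f] hom_in[OF b(1)] hom_in[OF b(2)] hom_in[OF b(3)] hom_in[OF b(4)])
    finally show ?thesis using b(5) z by simp
  qed
  ultimately show "\<exists>h\<in>homs Q A. \<forall>x\<in>car Q. p (h x) = f x"
    by (intro bexI[of _ "\<lambda>z. g (p1 z) + h (p2 z)"] ballI)
qed

lemma biprod_hom_dim:
  assumes bp: "biprod Q X Y i1 p1 i2 p2" and Q: "fdm Q" and X: "fdm X" and Y: "fdm Y" and Z: "fdm Z"
  shows "hom_dim Q Z = hom_dim X Z + hom_dim Y Z"
proof -
  note b = biprodD[OF bp] and im = biprod_surj[OF bp]
  have ker: "{f\<in>homs Q Z. (\<lambda>x. f (i1 x)) = 0} = {f\<in>homs Q Z. \<forall>x\<in>kernel Q p2. f x = 0}"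
  proof (intro set_eqI iffI)
    fix f assume "f \<in> {f\<in>homs Q Z. (\<lambda>x. f (i1 x)) = 0}"
    then have f: "f \<in> homs Q Z" "\<And>x. f (i1 x) = 0" by (auto simp: fun_eq_iff)
    have "f x = 0" if "x \<in> kernel Q p2" for x
      using f(2)[of "p1 x"] b(5)[of x] that hom_0[OF b(3)] by (simp add: kernel_def)
    then show "f \<in> {f\<in>homs Q Z. \<forall>x\<in>kernel Q p2. f x = 0}" using f by simp
  next
    fix f assume "f \<in> {f\<in>homs Q Z. \<forall>x\<in>kernel Q p2. f x = 0}"
    then have f: "f \<in> homs Q Z" "\<And>x. x\<in>kernel Q p2 \<Longrightarrow> f x = 0" by auto
    have "f (i1 x) = 0" for x
    proof (cases "x \<in> car X")
      case True
      then show ?thesis using f(2)[of "i1 x"] b(7)[of x] hom_in[OF b(1)] by (simp add: kernel_def)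
    next
      case False
      then show ?thesis using hom_out[OF b(1)] hom_0[OF f(1)] by simp
    qed
    then show "f \<in> {f\<in>homs Q Z. (\<lambda>x. f (i1 x)) = 0}" using f by (simp add: fun_eq_iff)
  qed
  have img: "(\<lambda>f x. f (i1 x)) ` homs Q Z = homs X Z"
  proof (intro equalityI subsetI)
    fix g assume g: "g \<in> homs X Z"
    have "g = (\<lambda>x. g (p1 (i1 x)))"
      by (rule hom_eqI[OF g hom_comp[OF hom_comp[OF b(1,2)] g]]) (simp add: b(6))
    moreover have "(\<lambda>x. g (p1 x)) \<in> homs Q Z" by (rule hom_comp[OF b(2) g])
    ultimately show "g \<in> (\<lambda>f x. f (i1 x)) ` homs Q Z"
      by (rule image_eqI[where f = "\<lambda>f x. f (i1 x)" and x = "\<lambda>x. g (p1 x)"])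
  qed (auto intro: hom_comp[OF b(1)])
  have "hom_dim Q Z = vector_space.dim (hscl Z) {f\<in>homs Q Z. (\<lambda>x. f (i1 x)) = 0} +
     vector_space.dim (hscl Z) ((\<lambda>f x. f (i1 x)) ` homs Q Z)"
    by (rule hom_rank(1)[OF Q Z Z]) (auto simp: fun_eq_iff)
  then show ?thesis unfolding ker img using hom_precomp_epi[OF Q Y Z b(4) im] by (simp add: hom_dim_def)
qed

context
  fixes P :: "'n::finite \<Rightarrow> ('k, 'a) umod"
  assumes fdP: "\<And>i. fdm (P i)"
begin

lemma dsum_vs: "vector_space (scl (dsum P m))"
proof -
  have "module (scl (P i))" for i by (rule mod_module[OF fdP])
  then show ?thesis unfolding dsum_def
    by unfold_locales (auto simp: fun_eq_iff module_def)
qed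

lemma dsum_in: "\<phi> \<in> car (dsum P m) \<longleftrightarrow> (\<forall>i j. if j < m i then \<phi> (i, j) \<in> car (P i) else \<phi> (i, j) = 0)"
  by (simp add: dsum_def)

lemma dsum_comp_in: "\<phi> \<in> car (dsum P m) \<Longrightarrow> \<phi> (i, j) \<in> car (P i)"
  using mod_0[OF fdP, of i] by (cases "j < m i") (auto simp: dsum_in)

lemma dsum_out: "\<phi> \<in> car (dsum P m) \<Longrightarrow> \<not> j < m i \<Longrightarrow> \<phi> (i, j) = 0"
  by (auto simp: dsum_in split: if_splits)

lemma dsum_step: "\<phi> \<in> car (dsum P (m(i := Suc (m i)))) \<and> \<phi> (i, m i) = 0 \<longleftrightarrow> \<phi> \<in> car (dsum P m)"
proof -
  have "(if j < (m(i := Suc (m i))) k then \<phi> (k, j) \<in> car (P k) else \<phi> (k, j) = 0) \<longleftrightarrow>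
      (if j < m k then \<phi> (k, j) \<in> car (P k) else \<phi> (k, j) = 0)" if "\<phi> (i, m i) = 0" for k j
    by (cases "k = i \<and> j = m i") (auto simp: that mod_0[OF fdP] less_Suc_eq)
  then show ?thesis using dsum_out[of \<phi> m "m i" i] unfolding dsum_in by (metis less_irrefl)
qed

lemma dsum_fdm: "fdm (dsum P m)"
proof -
  have "fin_sub (scl (dsum P m)) (car (dsum P m))"
  proof (induction m rule: nat_fun_induct)
    case zero
    have "car (dsum P (\<lambda>_. 0)) = {0}" by (auto simp: dsum_def fun_eq_iff)
    then show ?case using fin_sub_zero[OF dsum_vs] by simp
  next
    case (step m i)
    let ?m = "m(i := Suc (m i))"
    show ?case
    proof (rule fin_sub_eval[OF dsum_vs _ mod_vs[OF fdP] mod_fin[OF fdP], where f = "\<lambda>\<phi>. \<phi> (i, m i)"])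
      show "module.subspace (scl (dsum P ?m)) (car (dsum P ?m))"
        unfolding module.subspace_def[OF vs_module[OF dsum_vs]]
        by (auto simp: dsum_def mod_0[OF fdP] mod_add[OF fdP] mod_scl[OF fdP] module.scale_zero_right[OF mod_module[OF fdP]])
      show "Vector_Spaces.linear (scl (dsum P ?m)) (scl (P i)) (\<lambda>\<phi>. \<phi> (i, m i))"
        unfolding Vector_Spaces.linear_iff using dsum_vs mod_vs[OF fdP] by (simp add: dsum_def)
      show "(\<lambda>\<phi>. \<phi> (i, m i)) ` car (dsum P ?m) \<subseteq> car (P i)" using dsum_comp_in by auto
      have "{\<phi> \<in> car (dsum P ?m). \<phi> (i, m i) = 0} = car (dsum P m)"
        using dsum_step by blast
      moreover have "scl (dsum P ?m) = scl (dsum P m)" by (simp add: dsum_def)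
      ultimately show "fin_sub (scl (dsum P ?m)) {\<phi> \<in> car (dsum P ?m). \<phi> (i, m i) = 0}" using step by simp
    qed
  qed
  then have "\<exists>B. finite B \<and> car (dsum P m) = module.span (scl (dsum P m)) B" by (auto simp: fin_sub_def)
  moreover have "act (P i) x (b + c) = act (P i) x b + act (P i) x c" "act (P i) x (b * c) = act (P i) (act (P i) x b) c"
    "act (P i) x 1 = x" "act (P i) x (sc d b) = scl (P i) d (act (P i) x b)"
    if "x \<in> car (P i)" for x b c d i
    using fdP[of i] that by (simp_all add: fd_rmodule_def)
  ultimately show ?thesis unfolding fd_rmodule_def
    using dsum_vs by (auto simp: dsum_def fun_eq_iff mod_act[OF fdP] act_add[OF fdP] module.scale_zero_right[OF mod_module[OF fdP]])
qed

lemma dsum_biprod: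
  "\<exists>i1 p1 i2 p2. biprod (dsum P (m(i := Suc (m i)))) (dsum P m) (P i) i1 p1 i2 p2"
proof -
  let ?Q = "dsum P (m(i := Suc (m i)))" and ?X = "dsum P m"
  have sub: "\<phi> \<in> car ?X \<Longrightarrow> \<phi> \<in> car ?Q" for \<phi>
    using dsum_step by blast
  have ext: "\<phi> \<in> car ?X \<Longrightarrow> \<phi> (i, m i) = 0" for \<phi>
    using dsum_step by blast
  have act: "\<phi> \<in> car ?X \<Longrightarrow> act ?Q \<phi> a = act ?X \<phi> a" for \<phi> a
    using ext[of \<phi>] by (auto simp: dsum_def fun_eq_iff act_0[OF fdP] less_Suc_eq)
  have a1: "restr (car ?X) (\<lambda>x. x) \<in> homs ?X ?Q"
    by (rule homsI) (auto simp: restr_def sub act mod_add[OF dsum_fdm] mod_act[OF dsum_fdm])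
  have cut: "\<phi> \<in> car ?Q \<Longrightarrow> \<phi>((i, m i) := 0) \<in> car ?X" for \<phi>
    by (subst dsum_step[of _ m i, symmetric]) (auto simp: dsum_in mod_0[OF fdP])
  have cutact: "\<phi> \<in> car ?Q \<Longrightarrow> (act ?Q \<phi> a)((i, m i) := 0) = act ?X (\<phi>((i, m i) := 0)) a" for \<phi> a
    by (auto simp: dsum_def fun_eq_iff less_Suc_eq)
  have a2: "restr (car ?Q) (\<lambda>\<phi>. \<phi>((i, m i) := 0)) \<in> homs ?Q ?X"
    by (rule homsI) (auto simp: restr_def cut cutact mod_add[OF dsum_fdm] mod_act[OF dsum_fdm])
  have inn: "x \<in> car (P i) \<Longrightarrow> (\<lambda>q. if q = (i, m i) then x else 0) \<in> car ?Q" for x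
    by (auto simp: dsum_in mod_0[OF fdP])
  have a3: "restr (car (P i)) (\<lambda>x q. if q = (i, m i) then x else 0) \<in> homs (P i) ?Q"
    by (rule homsI) (auto simp: restr_def inn mod_add[OF fdP] mod_act[OF fdP] fun_eq_iff dsum_def act_0[OF fdP] mod_0[OF fdP])
  have a4: "restr (car ?Q) (\<lambda>\<phi>. \<phi> (i, m i)) \<in> homs ?Q (P i)"
    by (rule homsI) (auto simp: restr_def dsum_comp_in mod_add[OF dsum_fdm] mod_act[OF dsum_fdm], auto simp: dsum_def)
  have comp: "\<phi> \<in> car ?Q \<Longrightarrow> \<phi> (i, m i) \<in> car (P i)" for \<phi> by (rule dsum_comp_in)
  show ?thesis unfolding biprod_def
    by (rule exI, rule exI, rule exI, rule exI, intro conjI, rule a1, rule a2, rule a3, rule a4)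
      (auto simp: restr_def sub inn cut ext comp fun_eq_iff mod_0[OF dsum_fdm])
qed

lemma dsum_hom_dim:
  assumes Z: "fdm Z" shows "hom_dim (dsum P m) Z = (\<Sum>i\<in>UNIV. m i * hom_dim (P i) Z)"
proof (induction m rule: nat_fun_induct)
  case zero
  have "car (dsum P (\<lambda>_. 0)) = {0}" by (auto simp: dsum_def fun_eq_iff)
  then have "f x = 0" if "f \<in> homs (dsum P (\<lambda>_. 0)) Z" for f x
    by (cases "x = 0") (use hom_0[OF that] hom_out[OF that, of x] in auto)
  then have "homs (dsum P (\<lambda>_. 0)) Z = {0}"
    using hom_zero'[OF Z] by (auto simp: fun_eq_iff)
  then show ?case using hom_dim_0[OF dsum_fdm Z] by simp
next
  case (step m i)
  obtain i1 p1 i2 p2 where b: "biprod (dsum P (m(i := Suc (m i)))) (dsum P m) (P i) i1 p1 i2 p2"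
    using dsum_biprod by blast
  have "(\<Sum>j\<in>UNIV. (m(i := Suc (m i))) j * hom_dim (P j) Z) =
      (\<Sum>j\<in>UNIV. m j * hom_dim (P j) Z + (if j = i then hom_dim (P i) Z else 0))"
    by (rule sum.cong) auto
  also have "\<dots> = (\<Sum>j\<in>UNIV. m j * hom_dim (P j) Z) + hom_dim (P i) Z"
    by (simp add: sum.distrib)
  finally show ?case unfolding biprod_hom_dim[OF b dsum_fdm dsum_fdm fdP Z] step by (rule sym)
qed

lemma dsum_projective:
  assumes "\<And>i. projective sc (P i)" shows "projective sc (dsum P m)"
proof (induction m rule: nat_fun_induct)
  case zero
  have c: "car (dsum P (\<lambda>_. 0)) = {0}" by (auto simp: dsum_def fun_eq_iff)
  show ?case unfolding projective_def
  proof (intro allI ballI impI, elim conjE)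
    fix A B :: "('k, 'a) umod" and p f
    assume a: "p \<in> homs A B" "f \<in> homs (dsum P (\<lambda>_. 0)) B" "fdm A"
    show "\<exists>h\<in>homs (dsum P (\<lambda>_. 0)) A. \<forall>x\<in>car (dsum P (\<lambda>_. 0)). p (h x) = f x"
      using a(3) hom_0[OF a(1)] hom_0[OF a(2)] by (intro bexI[OF _ hom_zero[of A]]) (auto simp: c)
  qed
next
  case (step m i)
  obtain i1 p1 i2 p2 where "biprod (dsum P (m(i := Suc (m i)))) (dsum P m) (P i) i1 p1 i2 p2"
    using dsum_biprod by blast
  then show ?case using biprod_projective step assms by blast
qed

end

definition kdim :: "('k, 'a, 'm::ab_group_add) rmod \<Rightarrow> nat" where
  "kdim X = vector_space.dim (scl X) (car X)"

lemma kdim_0: "fdm X \<Longrightarrow> kdim X = 0 \<longleftrightarrow> car X = {0}"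
  unfolding kdim_def using fin_sub_dim_0[OF mod_fin] dim_zero_space[OF mod_vs] by metis

lemma kdim_sub:
  assumes "fdm X" "submodule X N"
  shows "kdim (submod X N) \<le> kdim X" "kdim (submod X N) = kdim X \<Longrightarrow> N = car X"
  using fin_sub_dim_le[OF mod_fin[OF assms(1)] sub_subspace[OF assms] sub_le[OF assms(2)]]
  by (auto simp: kdim_def)

lemma kdim_exact:
  assumes "fdm X" "fdm Y" "q \<in> homs X Y" "q ` car X = car Y"
  shows "kdim X = kdim (submod X (kernel X q)) + kdim Y"
proof -
  have "vector_space.dim (scl X) (car X) = vector_space.dim (scl X) {x \<in> car X. q x = 0} + vector_space.dim (scl Y) (q ` car X)"
    by (rule rank_nullity(3)[OF mod_vs[OF assms(2)] mod_fin[OF assms(1)]])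
      (use assms in \<open>simp_all add: hom_add hom_scl\<close>)
  then show ?thesis using assms(4) by (simp add: kdim_def kernel_def)
qed

lemma kdim_image:
  assumes "fdm X" "fdm Y" "q \<in> homs X Y"
  shows "kdim X = kdim (submod X (kernel X q)) + kdim (submod Y (q ` car X))"
proof (rule kdim_exact[OF assms(1)])
  have s: "submodule Y (q ` car X)" by (rule image_submodule[OF assms(1,3) submodule_car[OF assms(1)]])
  then show "fdm (submod Y (q ` car X))" by (rule sub_fdm[OF assms(2)])
  show "q \<in> homs X (submod Y (q ` car X))" using hom_sub_cod[OF sub_le[OF s]] assms(3) by auto
qed auto

lemma kdim_iso: "fdm X \<Longrightarrow> fdm Y \<Longrightarrow> iso X Y \<Longrightarrow> kdim X = kdim Y"
proof -
  assume X: "fdm X" and Y: "fdm Y" and "iso X Y"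
  then obtain f where f: "f \<in> homs X Y" "bij_betw f (car X) (car Y)" by (auto simp: iso_def)
  then have "f ` car X = car Y" "kernel X f = {0}"
    using inj_kernel[OF X f(1)] by (auto simp: bij_betw_def)
  then show "kdim X = kdim Y"
    using kdim_exact[OF X Y f(1)] kdim_0[OF sub_fdm[OF X submodule_0[OF X]]] by simp
qed

lemma simple_iso:
  assumes X: "fdm X" and Y: "fdm Y" and i: "iso X Y" and s: "simple X" shows "simple Y"
proof -
  obtain f where f: "f \<in> homs X Y" "bij_betw f (car X) (car Y)" using i by (auto simp: iso_def)
  then have im: "f ` car X = car Y" by (auto simp: bij_betw_def)
  show ?thesis unfolding simple_def
  proof (intro conjI allI impI)
    show "car Y \<noteq> {0}" using kdim_iso[OF X Y i] s kdim_0[OF X] kdim_0[OF Y] by (auto simp: simple_def)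
    fix N assume N: "submodule Y N"
    have "submodule X {x\<in>car X. f x \<in> N}" by (rule vimage_submodule[OF X f(1) N])
    then have "{x\<in>car X. f x \<in> N} = {0} \<or> {x\<in>car X. f x \<in> N} = car X"
      using s by (simp add: simple_def)
    moreover have "f ` {x\<in>car X. f x \<in> N} = N" using im sub_le[OF N] by auto
    ultimately show "N = {0} \<or> N = car Y" using im hom_0[OF f(1)] by auto
  qed
qed

lemma simple_sub_exists:
  assumes X: "fdm X" and "car X \<noteq> {0}"
  obtains L where "submodule X L" "simple (submod X L)"
proof -
  let ?A = "{N. submodule X N \<and> N \<noteq> {0}}"
  have "car X \<in> ?A" using submodule_car[OF X] assms(2) by simp
  from ex_has_least_nat[of "\<lambda>N. N \<in> ?A", OF this, of "\<lambda>N. kdim (submod X N)"]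
  obtain L where L: "L \<in> ?A" "\<And>N. N \<in> ?A \<Longrightarrow> kdim (submod X L) \<le> kdim (submod X N)" by blast
  have sL: "submodule X L" using L by simp
  have "simple (submod X L)"
    unfolding simple_def
  proof (intro conjI allI impI)
    show "car (submod X L) \<noteq> {0}" using L by simp
    fix N assume N: "submodule (submod X L) N"
    show "N = {0} \<or> N = car (submod X L)"
    proof (rule disjCI)
      assume "N \<noteq> car (submod X L)"
      then have "kdim (submod (submod X L) N) < kdim (submod X L)"
        using kdim_sub[OF sub_fdm[OF X sL] N] by linarith
      then show "N = {0}" using L(2)[of N] N by (force simp: submodule_trans[OF sL])
    qed
  qed
  then show ?thesis using that sL by blast
qed

lemma simple_hom_inj:
  assumes "fdm X" "fdm Y" "simple X" "f \<in> homs X Y" "f \<noteq> 0" shows "kernel X f = {0}"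
proof -
  have "kernel X f = {0} \<or> kernel X f = car X"
    using kernel_submodule[OF assms(1,2,4)] assms(3) by (simp add: simple_def)
  moreover have "kernel X f \<noteq> car X"
    using assms(5) hom_out[OF assms(4)] by (auto simp: kernel_def fun_eq_iff)
  ultimately show ?thesis by blast
qed

lemma simple_hom_surj:
  assumes "fdm X" "fdm Y" "simple Y" "f \<in> homs X Y" "f \<noteq> 0" shows "f ` car X = car Y"
proof -
  have "f ` car X = {0} \<or> f ` car X = car Y"
    using image_submodule[OF assms(1,4) submodule_car[OF assms(1)]] assms(3) by (simp add: simple_def)
  moreover have "f ` car X \<noteq> {0}"
    using assms(5) hom_out[OF assms(4)] by (auto simp: fun_eq_iff)
  ultimately show ?thesis by blast
qed

end

section \<open>Projective covers\<close>

locale hered_alg = fin_dim_alg sc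
  for sc :: "'k::field \<Rightarrow> 'a::ring_1 \<Rightarrow> 'a" +
  fixes S P :: "'n::finite \<Rightarrow> ('k, 'a) umod"
  assumes her: "hereditary sc" and simples: "simple_modules sc S"
    and cov: "\<And>i. \<exists>p. projective_cover sc (P i) p (S i)"
begin

lemma fdS: "fdm (S i)" and simpleS: "simple (S i)"
  and isoS: "iso (S i) (S j) \<Longrightarrow> i = j"
  using simples by (auto simp: simple_modules_def)

lemma simple_iso_S:
  assumes X: "fdm X" "simple X" obtains i where "iso X (S i)"
proof -
  obtain Y :: "('k, 'a) umod" and f where Y: "fdm Y" and f: "f \<in> homs X Y" "bij_betw f (car X) (car Y)"
    by (rule umod_exists[OF X(1)])
  have i: "iso X Y" using f by (auto simp: iso_def)
  have "simple Y" by (rule simple_iso[OF X(1) Y i X(2)])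
  then obtain j where "iso Y (S j)" using simples Y by (auto simp: simple_modules_def)
  then show ?thesis using that iso_trans[OF i] by blast
qed

definition top_map :: "'n \<Rightarrow> (nat \<Rightarrow> 'k) \<Rightarrow> (nat \<Rightarrow> 'k)" where
  "top_map i = (SOME p. projective_cover sc (P i) p (S i))"

lemma top_cover: "projective_cover sc (P i) (top_map i) (S i)"
  unfolding top_map_def by (rule someI_ex[OF cov])

lemma fdP: "fdm (P i)" and projP: "projective sc (P i)" and top_hom: "top_map i \<in> homs (P i) (S i)"
  and top_surj: "top_map i ` car (P i) = car (S i)"
  and top_superfluous: "submodule (P i) N \<Longrightarrow> top_map i ` N = car (S i) \<Longrightarrow> N = car (P i)"
  using top_cover[of i] by (auto simp: projective_cover_def)

lemma P_local:
  assumes N: "submodule (P i) N" "N \<noteq> car (P i)" shows "N \<subseteq> kernel (P i) (top_map i)"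
proof -
  have "submodule (S i) (top_map i ` N)" by (rule image_submodule[OF fdP top_hom N(1)])
  then have "top_map i ` N = {0} \<or> top_map i ` N = car (S i)" using simpleS by (simp add: simple_def)
  then show ?thesis using top_superfluous[OF N(1)] N(2) sub_le[OF N(1)] by (auto simp: kernel_def)
qed

lemma top_nonzero: "top_map i \<noteq> 0"
  using top_surj[of i] simpleS[of i] mod_0[OF fdP, of i] by (auto simp: simple_def fun_eq_iff)

lemma top_kernel_subset:
  assumes X: "fdm X" and f: "f \<in> homs (P i) X" "f \<noteq> 0" shows "kernel (P i) f \<subseteq> kernel (P i) (top_map i)"
proof (rule P_local[OF kernel_submodule[OF fdP X f(1)]])
  show "kernel (P i) f \<noteq> car (P i)" using f hom_out[OF f(1)] by (auto simp: kernel_def fun_eq_iff)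
qed

lemma hom_P_S_iso:
  assumes f: "f \<in> homs (P i) (S l)" "f \<noteq> 0"
  obtains h where "h \<in> homs (S l) (S i)" "\<And>x. x \<in> car (P i) \<Longrightarrow> h (f x) = top_map i x"
    "kernel (S l) h = {0}" "bij_betw h (car (S l)) (car (S i))"
proof -
  have im: "f ` car (P i) = car (S l)" by (rule simple_hom_surj[OF fdP fdS simpleS f])
  obtain h where h: "h \<in> homs (S l) (S i)" "\<And>x. x \<in> car (P i) \<Longrightarrow> h (f x) = top_map i x"
    by (rule hom_factor[OF fdP f(1) im top_hom top_kernel_subset[OF fdS f]]) blast
  have "h \<noteq> 0"
  proof
    assume "h = 0"
    then have "top_map i x = 0" for x using h(2)[of x] hom_out[OF top_hom] by (cases "x \<in> car (P i)") auto
    then show False using top_nonzero[of i] by (auto simp: fun_eq_iff)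
  qed
  then have "kernel (S l) h = {0}" "h ` car (S l) = car (S i)"
    using simple_hom_inj[OF fdS fdS simpleS h(1)] simple_hom_surj[OF fdS fdS simpleS h(1)] by auto
  then show ?thesis using that h hom_injD[OF fdS h(1)] by (auto simp: bij_betw_def)
qed

lemma hom_P_S_0: "i \<noteq> l \<Longrightarrow> hom_dim (P i) (S l) = 0"
proof (rule ccontr)
  assume "i \<noteq> l" "hom_dim (P i) (S l) \<noteq> 0"
  then obtain f where f: "f \<in> homs (P i) (S l)" "f \<noteq> 0" using hom_dim_posE[OF fdP fdS] by blast
  obtain h where "h \<in> homs (S l) (S i)" "bij_betw h (car (S l)) (car (S i))"
    by (rule hom_P_S_iso[OF f])
  then show False using isoS[of l i] \<open>i \<noteq> l\<close> by (auto simp: iso_def)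
qed

lemma hom_P_S_eq: "hom_dim (P i) (S i) = hom_dim (S i) (S i)"
proof -
  have "f x = 0" if f: "f \<in> homs (P i) (S i)" and x: "x \<in> kernel (P i) (top_map i)" for f x
  proof (cases "f = 0")
    case False
    obtain h where h: "h \<in> homs (S i) (S i)" "\<And>x. x \<in> car (P i) \<Longrightarrow> h (f x) = top_map i x" "kernel (S i) h = {0}"
      by (rule hom_P_S_iso[OF f False]) blast
    have "f x \<in> kernel (S i) h" using h(1,2) x hom_in[OF f] by (simp add: kernel_in)
    then show ?thesis using h by simp
  qed simp
  then have "{f\<in>homs (P i) (S i). \<forall>x\<in>kernel (P i) (top_map i). f x = 0} = homs (P i) (S i)" by blast
  then show ?thesis using hom_precomp_epi[OF fdP fdS fdS top_hom top_surj, of i i] by (simp add: hom_dim_def)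
qed

definition endim :: "'n \<Rightarrow> nat" where "endim i = hom_dim (S i) (S i)"

lemma endim_pos: "endim i > 0"
  unfolding endim_def hom_P_S_eq[symmetric]
  by (rule hom_dim_pos[OF fdP fdS top_hom top_nonzero])

lemma hom_P_S: "hom_dim (P i) (S l) = (if i = l then endim i else 0)"
  by (simp add: hom_P_S_0 hom_P_S_eq endim_def)

lemma dsumfd: "fdm (dsum P m)" and dsumproj: "projective sc (dsum P m)"
  by (auto intro: dsum_fdm dsum_projective fdP projP)

lemma cover_exists:
  fixes X :: "('k, 'a, 'm::ab_group_add) rmod"
  assumes "fdm X" shows "\<exists>m p. projective_cover sc (dsum P m) p X"
  using assms
proof (induction "kdim X" arbitrary: X rule: less_induct)
  case less
  note X = less.prems
  show ?case
  proof (cases "car X = {0}")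
    case True
    have c: "car (dsum P (\<lambda>_. 0)) = {0}" by (auto simp: dsum_def fun_eq_iff)
    have "projective_cover sc (dsum P (\<lambda>_. 0)) (\<lambda>x. 0) X"
      unfolding projective_cover_def
    proof (intro conjI allI impI dsumfd dsumproj hom_zero[OF X])
      fix N assume "submodule (dsum P (\<lambda>_. 0)) N \<and> (\<lambda>x. 0) ` N = car X"
      then show "N = car (dsum P (\<lambda>_. 0))" using c sub_le sub_0 by fastforce
    qed (use True c in auto)
    then show ?thesis by blast
  next
    case False
    obtain L where L: "submodule X L" "simple (submod X L)" by (rule simple_sub_exists[OF X False])
    note fL = sub_fdm[OF X L(1)]
    have L0: "L \<noteq> {0}" using L(2) by (simp add: simple_def)
    obtain Z :: "('k, 'a, 'm) rmod" and q where Z: "fdm Z" and q: "q \<in> homs X Z" "q ` car X = car Z" "kernel X q = L"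
      by (rule quotient_exists[OF X L(1)])
    have "kdim (submod X L) \<noteq> 0" using kdim_0[OF fL] L0 by simp
    then have "kdim Z < kdim X" using kdim_exact[OF X Z q(1,2)] q(3) by simp
    from less.hyps[OF this Z] obtain m p' where p': "projective_cover sc (dsum P m) p' Z" by blast
    let ?Q = "dsum P m"
    have ph: "p' \<in> homs ?Q Z" "p' ` car ?Q = car Z" using p' by (auto simp: projective_cover_def)
    have sup: "N = car ?Q" if "submodule ?Q N" "p' ` N = car Z" for N
      using p' that by (auto simp: projective_cover_def)
    obtain u where u: "u \<in> homs ?Q X" "\<And>x. x \<in> car ?Q \<Longrightarrow> q (u x) = p' x"
      by (rule proj_lift[OF dsumproj X Z q(1,2) ph(1)]) blast
    have qker: "x - u y \<in> L" if "x \<in> car X" "y \<in> car ?Q" "q x = p' y" for x y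
    proof -
      have "x - u y \<in> kernel X q"
        using that X hom_in[OF u(1)] by (simp add: kernel_in mod_diff hom_diff[OF X q(1)] u(2))
      then show ?thesis using q(3) by simp
    qed
    have sI: "submodule X (u ` car ?Q)" by (rule image_submodule[OF dsumfd u(1) submodule_car[OF dsumfd]])
    show ?thesis
    proof (cases "L \<subseteq> u ` car ?Q")
      case True
      have "x \<in> u ` car ?Q" if x: "x \<in> car X" for x
      proof -
        obtain y where y: "y \<in> car ?Q" "q x = p' y" using ph(2) hom_in[OF q(1) x] by (metis imageE)
        have "(x - u y) + u y \<in> u ` car ?Q"
          using sub_add[OF sI] qker[OF x y] True y(1) by blast
        then show ?thesis by simp
      qed
      then have im: "u ` car ?Q = car X" using sub_le[OF sI] by blast
      have "projective_cover sc ?Q u X"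
        unfolding projective_cover_def
      proof (intro conjI allI impI dsumfd dsumproj u(1) im)
        fix N assume N: "submodule ?Q N \<and> u ` N = car X"
        have "p' ` N = q ` u ` N" using u(2) sub_le N by (force simp: image_image intro!: image_cong)
        also have "\<dots> = car Z" using N q(2) by simp
        finally show "N = car ?Q" using sup N by blast
      qed
      then show ?thesis by blast
    next
      case False
      have "L \<inter> u ` car ?Q = {0} \<or> L \<inter> u ` car ?Q = L"
        using L(2) inter_submodule[OF L(1) sI] by (auto simp: simple_def submodule_trans[OF L(1)])
      then have dis: "L \<inter> u ` car ?Q = {0}" using False by blast
      obtain i where "iso (submod X L) (S i)" by (rule simple_iso_S[OF fL L(2)])
      then have "iso (S i) (submod X L)" by (rule iso_sym[OF fL])
      then obtain e where e: "e \<in> homs (S i) (submod X L)" "bij_betw e (car (S i)) L" by (auto simp: iso_def)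
      have eX: "e \<in> homs (S i) X" using e(1) hom_sub_cod[OF sub_le[OF L(1)]] by blast
      have einj: "x \<in> car (S i) \<Longrightarrow> e x = 0 \<Longrightarrow> x = 0" for x
        using inj_kernel[OF fdS e(1)] e(2) by (auto simp: bij_betw_def kernel_def)
      let ?eps = "\<lambda>z. e (top_map i z)"
      have eps: "?eps \<in> homs (P i) X" by (rule hom_comp[OF top_hom eX])
      have epsim: "?eps ` car (P i) = L"
      proof -
        have "?eps ` car (P i) = e ` top_map i ` car (P i)" by (simp add: image_image)
        then show ?thesis using e(2) top_surj by (simp add: bij_betw_def)
      qed
      let ?Q' = "dsum P (m(i := Suc (m i)))"
      obtain i1 p1 i2 p2 where bp: "biprod ?Q' ?Q (P i) i1 p1 i2 p2"
        using dsum_biprod[where P=P, OF fdP] by blast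
      note b = biprodD[OF bp]
      let ?p = "\<lambda>z. u (p1 z) + ?eps (p2 z)"
      have p: "?p \<in> homs ?Q' X" by (intro hom_plus[OF X] hom_comp[OF b(2) u(1)] hom_comp[OF b(4) eps])
      have im: "?p ` car ?Q' = car X"
      proof (intro equalityI subsetI)
        fix x assume x: "x \<in> car X"
        obtain y where y: "y \<in> car ?Q" "q x = p' y" using ph(2) hom_in[OF q(1) x] by (metis imageE)
        obtain z where z: "z \<in> car (P i)" "x - u y = ?eps z" using qker[OF x y] epsim by blast
        have w: "i1 y + i2 z \<in> car ?Q'"
          using y z hom_in[OF b(1)] hom_in[OF b(3)] by (simp add: mod_add[OF dsumfd])
        have "p1 (i1 y + i2 z) = y" "p2 (i1 y + i2 z) = z"
          using y z b hom_in[OF b(1)] hom_in[OF b(3)] by (simp_all add: hom_add[OF b(2)] hom_add[OF b(4)])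
        then have "?p (i1 y + i2 z) = x" using z(2) by (simp add: algebra_simps)
        then show "x \<in> ?p ` car ?Q'" using w by (rule_tac image_eqI[where x = "i1 y + i2 z"]) simp_all
      qed (use hom_in[OF p] in auto)
      have "projective_cover sc ?Q' ?p X"
        unfolding projective_cover_def
      proof (intro conjI allI impI dsumfd dsumproj p im)
        fix N assume "submodule ?Q' N \<and> ?p ` N = car X"
        then have N: "submodule ?Q' N" "?p ` N = car X" by auto
        let ?R = "kernel (P i) (top_map i)"
        have sR: "submodule (P i) ?R" by (rule kernel_submodule[OF fdP fdS top_hom])
        define A where "A = {x + y | x y. x \<in> N \<and> y \<in> i2 ` ?R}"
        have sA: "submodule ?Q' A" unfolding A_def
          by (rule sum_submodule[OF dsumfd N(1) image_submodule[OF fdP b(3) sR]])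
        \<comment> \<open>the kernel of the cover is the sum of the superfluous submodules \<open>i1 ` ker u\<close> and \<open>i2 ` ?R\<close>\<close>
        have split: "\<exists>n k r. n \<in> N \<and> k \<in> car ?Q \<and> u k = 0 \<and> r \<in> ?R \<and> z = n + i1 k + i2 r" if z: "z \<in> car ?Q'" for z
        proof -
          obtain n where n: "n \<in> N" "?p n = ?p z" using N(2) hom_in[OF p z] by (metis (no_types, lifting) imageE)
          have nQ: "n \<in> car ?Q'" using sub_in[OF N(1) n(1)] .
          let ?d = "z - n"
          have d: "?d \<in> car ?Q'" by (rule mod_diff[OF dsumfd z nQ])
          have "?p ?d = 0" using hom_diff[OF dsumfd p z nQ] n(2) by simp
          then have e0: "u (p1 ?d) = ?eps (- p2 ?d)"
            using hom_neg[OF fdP eps hom_in[OF b(4) d]] by (metis eq_neg_iff_add_eq_0)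
          have "u (p1 ?d) \<in> u ` car ?Q" using hom_in[OF b(2) d] by blast
          moreover have "u (p1 ?d) \<in> L"
            unfolding e0 epsim[symmetric] using mod_neg[OF fdP hom_in[OF b(4) d]] by blast
          ultimately have u0: "u (p1 ?d) = 0" using dis by blast
          then have "?eps (p2 ?d) = 0" using \<open>?p ?d = 0\<close> by simp
          then have "top_map i (p2 ?d) = 0" using einj hom_in[OF top_hom hom_in[OF b(4) d]] by blast
          then have "p2 ?d \<in> ?R" using hom_in[OF b(4) d] by (simp add: kernel_def)
          moreover have "z = n + i1 (p1 ?d) + i2 (p2 ?d)" using b(5)[OF d] by (simp add: algebra_simps)
          ultimately show ?thesis using n(1) u0 hom_in[OF b(2) d] by blast
        qed
        have A1: "i1 y \<in> A" if y: "y \<in> car ?Q" for y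
        proof -
          let ?B = "{y\<in>car ?Q. i1 y \<in> A}"
          have sB: "submodule ?Q ?B" by (rule vimage_submodule[OF dsumfd b(1) sA])
          have "p' y \<in> p' ` ?B" if y: "y \<in> car ?Q" for y
          proof -
            obtain n k r where nk: "n \<in> N" "k \<in> car ?Q" "u k = 0" "r \<in> ?R" "i1 y = n + i1 k + i2 r"
              using split[OF hom_in[OF b(1) y]] by blast
            have "i1 (y - k) = n + i2 r" using nk(5) hom_diff[OF dsumfd b(1) y nk(2)] by (simp add: algebra_simps)
            then have "y - k \<in> ?B" using nk mod_diff[OF dsumfd y nk(2)] unfolding A_def by blast
            moreover have "p' k = 0" using u(2)[OF nk(2)] nk(3) hom_0[OF q(1)] by simp
            then have "p' (y - k) = p' y" using hom_diff[OF dsumfd ph(1) y nk(2)] by simp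
            ultimately show ?thesis by - (rule image_eqI[where x = "y - k"], simp_all)
          qed
          then have "p' ` car ?Q \<subseteq> p' ` ?B" by (rule image_subsetI)
          then have "p' ` ?B = car Z" using ph(2) image_mono[OF sub_le[OF sB], of p'] by (simp add: subset_antisym)
          from sup[OF sB this] show ?thesis using y by auto
        qed
        have A2: "z \<in> A" if z: "z \<in> car ?Q'" for z
        proof -
          obtain n k r where nk: "n \<in> N" "k \<in> car ?Q" "u k = 0" "r \<in> ?R" "z = n + i1 k + i2 r"
            using split[OF z] by blast
          have "n + i2 r \<in> A" using nk unfolding A_def by blast
          then have "(n + i2 r) + i1 k \<in> A" using A1[OF nk(2)] by (rule sub_add[OF sA])
          then show ?thesis using nk(5) by (simp add: algebra_simps)
        qed
        let ?C = "{z\<in>car (P i). i2 z \<in> N}"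
        have sC: "submodule (P i) ?C" by (rule vimage_submodule[OF fdP b(3) N(1)])
        have "top_map i z \<in> top_map i ` ?C" if z: "z \<in> car (P i)" for z
        proof -
          obtain n r where nr: "n \<in> N" "r \<in> ?R" "i2 z = n + i2 r"
            using A2[OF hom_in[OF b(3) z]] unfolding A_def by blast
          have r: "r \<in> car (P i)" "top_map i r = 0" using nr(2) by (auto simp: kernel_def)
          have "i2 (z - r) = n" using nr(3) hom_diff[OF fdP b(3) z r(1)] by simp
          then have "z - r \<in> ?C" using nr(1) mod_diff[OF fdP z r(1)] by simp
          moreover have "top_map i (z - r) = top_map i z" using hom_diff[OF fdP top_hom z r(1)] r(2) by simp
          ultimately show ?thesis by - (rule image_eqI[where x = "z - r"], simp_all)
        qed
        then have "top_map i ` car (P i) \<subseteq> top_map i ` ?C" by (rule image_subsetI)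
        then have "top_map i ` ?C = car (S i)"
          using top_surj[of i] image_mono[OF sub_le[OF sC], of "top_map i"] by (simp add: subset_antisym)
        from top_superfluous[OF sC this] have C: "?C = car (P i)" .
        have "z \<in> N" if z: "z \<in> car ?Q'" for z
        proof -
          obtain n r where nr: "n \<in> N" "r \<in> ?R" "z = n + i2 r" using A2[OF z] unfolding A_def by blast
          have "r \<in> ?C" unfolding C using nr(2) by (simp add: kernel_def)
          then show ?thesis using nr sub_add[OF N(1)] by simp
        qed
        then show "N = car ?Q'" using sub_le[OF N(1)] by blast
      qed
      then show ?thesis by blast
    qed
  qed
qed

lemma cover_of_projective_iso:
  assumes Q: "projective_cover sc Q d X" and X: "fdm X" "projective sc X"
  shows "iso Q X"
proof -
  have Q: "fdm Q" "d \<in> homs Q X" "d ` car Q = car X" "\<And>N. submodule Q N \<Longrightarrow> d ` N = car X \<Longrightarrow> N = car Q"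
    using Q by (auto simp: projective_cover_def)
  obtain s where s: "s \<in> homs X Q" "\<And>x. x \<in> car X \<Longrightarrow> d (s x) = restr (car X) (\<lambda>x. x) x"
    by (rule proj_lift[OF X(2) Q(1) X(1) Q(2,3) id_hom[OF X(1)]]) blast
  have ds: "d (s x) = x" if "x \<in> car X" for x using s(2)[OF that] that by (simp add: restr_def)
  have "d ` s ` car X = car X" using ds by (force simp: image_image)
  then have im: "s ` car X = car Q"
    by (rule Q(4)[OF image_submodule[OF X(1) s(1) submodule_car[OF X(1)]]])
  have "inj_on d (car Q)"
    unfolding im[symmetric] by (rule inj_onI) (auto simp: ds)
  then show ?thesis using Q by (auto simp: iso_def bij_betw_def)
qed

lemma min_presentation_exists:
  assumes X: "fdm X" shows "\<exists>m n. min_presentation sc P X m n"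
proof -
  obtain m p where p: "projective_cover sc (dsum P m) p X" using cover_exists[OF X] by blast
  then have "p \<in> homs (dsum P m) X" by (simp add: projective_cover_def)
  then have "fdm (submod (dsum P m) (kernel (dsum P m) p))"
    by (intro sub_fdm[OF dsumfd] kernel_submodule[OF dsumfd X])
  from cover_exists[OF this] show ?thesis using p unfolding min_presentation_def by blast
qed

lemma min_presentation_resolution:
  assumes X: "fdm X" and mp: "min_presentation sc P X m n"
  obtains p where "proj_epi (dsum P m) p X" "iso (dsum P n) (submod (dsum P m) (kernel (dsum P m) p))"
proof -
  obtain p d where p: "projective_cover sc (dsum P m) p X"
    and d: "projective_cover sc (dsum P n) d (submod (dsum P m) (kernel (dsum P m) p))"
    using mp by (auto simp: min_presentation_def)
  have p': "p \<in> homs (dsum P m) X" "p ` car (dsum P m) = car X" using p by (auto simp: projective_cover_def)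
  have k: "submodule (dsum P m) (kernel (dsum P m) p)" by (rule kernel_submodule[OF dsumfd X p'(1)])
  have "iso (dsum P n) (submod (dsum P m) (kernel (dsum P m) p))"
    by (rule cover_of_projective_iso[OF d sub_fdm[OF dsumfd k] hereditary_sub[OF her dsumfd dsumproj k]])
  then show ?thesis using that p' dsumfd dsumproj by (auto simp: proj_epi_def)
qed

lemma proj_epiD:
  assumes "proj_epi Q p X"
  shows "fdm Q" "projective sc Q" "p \<in> homs Q X" "p ` car Q = car X"
  using assms by (auto simp: proj_epi_def)

lemma proj_epi_kernel:
  assumes "proj_epi Q p X" "fdm X"
  shows "submodule Q (kernel Q p)" "fdm (submod Q (kernel Q p))" "projective sc (submod Q (kernel Q p))"
proof -
  note Q = proj_epiD[OF assms(1)]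
  show k: "submodule Q (kernel Q p)" by (rule kernel_submodule[OF Q(1) assms(2) Q(3)])
  show "fdm (submod Q (kernel Q p))" "projective sc (submod Q (kernel Q p))"
    using sub_fdm[OF Q(1) k] hereditary_sub[OF her Q(1,2) k] by auto
qed

lemma proj_epi_exists:
  assumes X: "fdm X" obtains Q :: "('k, 'a) umod" and p where "proj_epi Q p X"
proof -
  obtain m n where "min_presentation sc P X m n" using min_presentation_exists[OF X] by blast
  then obtain p where "proj_epi (dsum P m) p X" by (rule min_presentation_resolution[OF X])
  then show ?thesis by (rule proj_epi_umod[OF X]) (rule that)
qed

section \<open>Dimension vectors\<close>

lemma maximal_sub_exists:
  assumes X: "fdm X" and "car X \<noteq> {0}"
  obtains N where "submodule X N" "N \<subset> car X"
    "\<And>L. submodule X L \<Longrightarrow> N \<subseteq> L \<Longrightarrow> L = N \<or> L = car X"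
proof -
  let ?A = "\<lambda>N. submodule X N \<and> N \<noteq> car X"
  have "?A {0}" using submodule_0[OF X] assms(2) by auto
  moreover have "\<forall>N. ?A N \<longrightarrow> kdim (submod X N) < Suc (kdim X)"
    using kdim_sub(1)[OF X] by (simp add: less_Suc_eq_le)
  ultimately obtain N where N: "?A N" "\<And>L. ?A L \<Longrightarrow> kdim (submod X L) \<le> kdim (submod X N)"
    using ex_has_greatest_nat[of ?A "{0}" "\<lambda>N. kdim (submod X N)"] by blast
  have "L = N \<or> L = car X" if L: "submodule X L" "N \<subseteq> L" for L
  proof (rule disjCI)
    assume "L \<noteq> car X"
    then have le: "kdim (submod X L) \<le> kdim (submod X N)" using N(2) L by simp
    have s: "submodule (submod X L) N" using submodule_trans[OF L(1)] N L by simp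
    have "kdim (submod X N) \<le> kdim (submod X L)" using kdim_sub(1)[OF sub_fdm[OF X L(1)] s] by simp
    then show "L = N" using kdim_sub(2)[OF sub_fdm[OF X L(1)] s] le by simp
  qed
  moreover have "N \<subset> car X" using N(1) sub_le by blast
  ultimately show ?thesis using that N(1) by blast
qed

lemma composition_series_exists:
  fixes X :: "('k, 'a, 'm::ab_group_add) rmod"
  assumes "fdm X" shows "\<exists>Ns. composition_series X Ns"
  using assms
proof (induction "kdim X" arbitrary: X rule: less_induct)
  case less
  note X = less.prems
  show ?case
  proof (cases "car X = {0}")
    case True
    then have "composition_series X [{0}]" using submodule_0[OF X] by (simp add: composition_series_def)
    then show ?thesis by blast
  next
    case False
    obtain N where N: "submodule X N" "N \<subset> car X" "\<And>L. submodule X L \<Longrightarrow> N \<subseteq> L \<Longrightarrow> L = N \<or> L = car X"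
      by (rule maximal_sub_exists[OF X False]) blast
    have "kdim (submod X N) < kdim X" using kdim_sub[OF X N(1)] N(2) by fastforce
    from less.hyps[OF this sub_fdm[OF X N(1)]] obtain Ns where Ns: "composition_series (submod X N) Ns" by blast
    then have ne: "Ns \<noteq> []" and hd: "hd Ns = {0}" and last: "last Ns = N"
      and sub: "\<And>L. L \<in> set Ns \<Longrightarrow> submodule X L \<and> L \<subseteq> N"
      and st: "\<And>j. Suc j < length Ns \<Longrightarrow> Ns ! j \<subset> Ns ! Suc j"
      and mx: "\<And>j L. Suc j < length Ns \<Longrightarrow> submodule X L \<Longrightarrow> L \<subseteq> N \<Longrightarrow> Ns ! j \<subseteq> L \<Longrightarrow> L \<subseteq> Ns ! Suc j \<Longrightarrow> L = Ns ! j \<or> L = Ns ! Suc j"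
      by (auto simp: composition_series_def submodule_trans[OF N(1)])
    have "composition_series X (Ns @ [car X])"
      unfolding composition_series_def
    proof (intro conjI allI impI ballI)
      show "hd (Ns @ [car X]) = {0}" using ne hd by simp
      show "submodule X L" if "L \<in> set (Ns @ [car X])" for L
        using that sub submodule_car[OF X] by auto
      fix j assume j: "Suc j < length (Ns @ [car X])"
      show "(Ns @ [car X]) ! j \<subset> (Ns @ [car X]) ! Suc j"
      proof (cases "Suc j < length Ns")
        case False
        then have "j = length Ns - 1" "Suc j = length Ns" using j by auto
        then show ?thesis using N(2) last ne by (simp add: nth_append last_conv_nth)
      qed (use st in \<open>simp add: nth_append\<close>)
      fix L assume L: "submodule X L \<and> (Ns @ [car X]) ! j \<subseteq> L \<and> L \<subseteq> (Ns @ [car X]) ! Suc j"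
      show "L = (Ns @ [car X]) ! j \<or> L = (Ns @ [car X]) ! Suc j"
      proof (cases "Suc j < length Ns")
        case True
        have "Ns ! Suc j \<subseteq> N" using sub True nth_mem by blast
        then show ?thesis using mx[OF True, of L] L True by (auto simp: nth_append)
      next
        case False
        then have "j = length Ns - 1" "Suc j = length Ns" using j by auto
        then show ?thesis using N(3) last ne L by (simp add: nth_append last_conv_nth)
      qed
    qed simp_all
    then show ?thesis by blast
  qed
qed

lemma same_kernel_iso:
  assumes X: "fdm X" and Y: "fdm Y" and p: "p \<in> homs X Y" "p ` car X = car Y"
    and q: "q \<in> homs X Z" "q ` car X = car Z" and k: "kernel X p = kernel X q"
  shows "iso Y Z"
proof -
  obtain h where h: "h \<in> homs Y Z" "\<And>x. x \<in> car X \<Longrightarrow> h (p x) = q x"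
    by (rule hom_factor[OF X p q(1)]) (use k in auto)
  have "h ` car Y = car Z" using h(2) q(2) p(2) by (force simp flip: p(2) q(2) simp: image_image)
  moreover have "inj_on h (car Y)"
  proof (rule hom_injD[OF Y h(1)])
    have "y = 0" if "y \<in> kernel Y h" for y
    proof -
      have "y \<in> p ` car X" using that p(2) by (simp add: kernel_in)
      then obtain x where x: "x \<in> car X" "y = p x" by blast
      then have "x \<in> kernel X q" using that h(2) by (simp add: kernel_def)
      then have "x \<in> kernel X p" using k by simp
      then show ?thesis using x(2) by (simp add: kernel_in)
    qed
    then show "kernel Y h = {0}" using hom_0[OF h(1)] mod_0[OF Y] by (auto simp: kernel_in)
  qed
  ultimately show ?thesis using h(1) by (auto simp: iso_def bij_betw_def)
qed

lemma factor_simple: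
  fixes X :: "('k, 'a, 'm::ab_group_add) rmod"
  assumes X: "fdm X" and N: "submodule X N" "N \<noteq> car X"
    and mx: "\<And>L. submodule X L \<Longrightarrow> N \<subseteq> L \<Longrightarrow> L = N \<or> L = car X"
  obtains l p where "p \<in> homs X (S l)" "p ` car X = car (S l)" "kernel X p = N"
proof -
  obtain Y :: "('k, 'a, 'm) rmod" and q where Y: "fdm Y" and q: "q \<in> homs X Y" "q ` car X = car Y" "kernel X q = N"
    by (rule quotient_exists[OF X N(1)])
  have "simple Y" unfolding simple_def
  proof (intro conjI allI impI)
    show "car Y \<noteq> {0}"
    proof
      assume "car Y = {0}"
      then have "kernel X q = car X" using q(2) by (auto simp: kernel_def)
      then show False using q(3) N(2) by simp
    qed
    fix K assume K: "submodule Y K"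
    let ?L = "{x\<in>car X. q x \<in> K}"
    have sL: "submodule X ?L" by (rule vimage_submodule[OF X q(1) K])
    have "N \<subseteq> ?L" using sub_0[OF K] unfolding q(3)[symmetric] by (auto simp: kernel_def)
    then have "?L = N \<or> ?L = car X" by (rule mx[OF sL])
    moreover have im: "q ` ?L = K" using q(2) sub_le[OF K] by auto
    moreover have "q ` N \<subseteq> {0}" unfolding q(3)[symmetric] by (auto simp: kernel_def)
    ultimately have "K \<subseteq> {0} \<or> K = car Y" using q(2) by metis
    then show "K = {0} \<or> K = car Y" using sub_0[OF K] by blast
  qed
  then obtain l where "iso Y (S l)" using simple_iso_S[OF Y] by blast
  then obtain f where f: "f \<in> homs Y (S l)" "bij_betw f (car Y) (car (S l))" by (auto simp: iso_def)
  have "(\<lambda>x. f (q x)) ` car X = f ` q ` car X" by (simp add: image_image)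
  then have "(\<lambda>x. f (q x)) ` car X = car (S l)" using f(2) q(2) by (simp add: bij_betw_def)
  moreover have "f y = 0 \<longleftrightarrow> y = 0" if "y \<in> car Y" for y
    using inj_kernel[OF Y f(1)] f(2) that hom_0[OF f(1)] by (auto simp: bij_betw_def kernel_def)
  then have "kernel X (\<lambda>x. f (q x)) = kernel X q" using hom_in[OF q(1)] by (auto simp: kernel_def)
  ultimately show ?thesis using that hom_comp[OF q(1) f(1)] q(3) by auto
qed

lemma hom_dim_to_zero: "fdm X \<Longrightarrow> fdm Y \<Longrightarrow> car Y = {0} \<Longrightarrow> hom_dim X Y = 0"
  using hom_dim_0[of X Y] hom_in_all[of _ X Y] hom_zero'[of Y X] by (auto simp: fun_eq_iff)

lemma hom_dim_composition:
  assumes X: "fdm X" and Ns: "composition_series X Ns" and "t < length Ns"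
  shows "hom_dim (P i) (submod X (Ns ! t)) =
    endim i * card {j. Suc j \<le> t \<and> factor_iso X (Ns ! Suc j) (Ns ! j) (S i)}"
  using assms(3)
proof (induction t)
  case 0
  have "Ns \<noteq> []" "hd Ns = {0}" using Ns by (auto simp: composition_series_def)
  then have "Ns ! 0 = {0}" using hd_conv_nth[of Ns] by simp
  then show ?case using hom_dim_to_zero[OF fdP sub_fdm[OF X submodule_0[OF X]]] by simp
next
  case (Suc t)
  have sub: "submodule X (Ns ! t)" "submodule X (Ns ! Suc t)"
    using Ns Suc.prems by (auto simp: composition_series_def)
  have st: "Ns ! t \<subset> Ns ! Suc t" and mx: "\<And>L. submodule X L \<Longrightarrow> Ns ! t \<subseteq> L \<Longrightarrow> L \<subseteq> Ns ! Suc t \<Longrightarrow> L = Ns ! t \<or> L = Ns ! Suc t"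
    using Ns Suc.prems by (auto simp: composition_series_def)
  let ?Y = "submod X (Ns ! Suc t)"
  have Y: "fdm ?Y" by (rule sub_fdm[OF X sub(2)])
  have sY: "submodule ?Y (Ns ! t)" using submodule_trans[OF sub(2)] sub(1) st by simp
  have neq: "Ns ! t \<noteq> car ?Y" using st by simp
  have mxY: "L = Ns ! t \<or> L = car ?Y" if "submodule ?Y L" "Ns ! t \<subseteq> L" for L
    using mx[of L] that submodule_trans[OF sub(2)] by simp
  obtain l p where p: "p \<in> homs ?Y (S l)" "p ` car ?Y = car (S l)" "kernel ?Y p = Ns ! t"
    by (rule factor_simple[OF Y sY neq mxY])
  have F: "factor_iso X (Ns ! Suc t) (Ns ! t) (S i) \<longleftrightarrow> i = l"
  proof
    assume "factor_iso X (Ns ! Suc t) (Ns ! t) (S i)"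
    then obtain q where q: "q \<in> homs ?Y (S i)" "q ` car ?Y = car (S i)" "kernel ?Y q = Ns ! t"
      by (auto simp: factor_iso_def)
    have "kernel ?Y p = kernel ?Y q" using p(3) q(3) by simp
    then have "iso (S l) (S i)" by (rule same_kernel_iso[OF Y fdS p(1,2) q(1,2)])
    then show "i = l" using isoS by blast
  next
    assume "i = l"
    then show "factor_iso X (Ns ! Suc t) (Ns ! t) (S i)" using p by (auto simp: factor_iso_def)
  qed
  have "hom_dim (P i) ?Y = hom_dim (P i) (submod X (Ns ! t)) + hom_dim (P i) (S l)"
    using hom_dim_exact[OF fdP projP Y fdS p(1,2), of i] p(3) by simp
  moreover have "{j. Suc j \<le> Suc t \<and> factor_iso X (Ns ! Suc j) (Ns ! j) (S i)} =
      {j. Suc j \<le> t \<and> factor_iso X (Ns ! Suc j) (Ns ! j) (S i)} \<union> (if i = l then {t} else {})"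
    using F by (auto simp: le_Suc_eq)
  moreover have "finite {j. Suc j \<le> t \<and> factor_iso X (Ns ! Suc j) (Ns ! j) (S i)}"
    by (rule finite_subset[of _ "{..<t}"]) auto
  ultimately show ?case using Suc by (cases "i = l") (simp_all add: hom_P_S)
qed

lemma submod_car: "submod X (car X) = X"
  by (cases X) simp

lemma hom_dim_multiplicity:
  assumes X: "fdm X" shows "hom_dim (P i) X = endim i * multiplicity (S i) X"
proof -
  define Ns where "Ns = (SOME Ns. composition_series X Ns)"
  have Ns: "composition_series X Ns"
    unfolding Ns_def by (rule someI_ex[OF composition_series_exists[OF X]])
  then have ne: "Ns \<noteq> []" and l: "Ns ! (length Ns - 1) = car X"
    by (auto simp: composition_series_def last_conv_nth)
  have "Suc j \<le> length Ns - 1 \<longleftrightarrow> Suc j < length Ns" for j using ne by (cases Ns) auto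
  then show ?thesis
    using hom_dim_composition[OF X Ns, of "length Ns - 1" i, unfolded l submod_car] ne
    by (simp add: multiplicity_def Let_def Ns_def[symmetric])
qed

abbreviation dv :: "('k, 'a, 'm::ab_group_add) rmod \<Rightarrow> real ^ 'n" where "dv \<equiv> dim_vec S"

lemma hom_dim_dv: "fdm X \<Longrightarrow> real (hom_dim (P i) X) = real (endim i) * dv X $ i"
  by (simp add: hom_dim_multiplicity dim_vec_def)

lemma dv_eqI:
  assumes "\<And>i. real (endim i) * x $ i = real (endim i) * y $ i" shows "x = (y :: real ^ 'n)"
proof -
  have "x $ i = y $ i" for i using assms[of i] endim_pos[of i] by simp
  then show ?thesis by (simp add: vec_eq_iff)
qed

lemma dv_nonneg: "dv X $ i \<ge> 0" by (simp add: dim_vec_def)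

lemma dv_exact:
  assumes "fdm Y" "fdm Z" "q \<in> homs Y Z" "q ` car Y = car Z"
  shows "dv Y = dv (submod Y (kernel Y q)) + dv Z"
proof (rule dv_eqI)
  fix i
  have k: "fdm (submod Y (kernel Y q))" by (rule sub_fdm[OF assms(1) kernel_submodule[OF assms(1-3)]])
  have "real (hom_dim (P i) Y) = real (hom_dim (P i) (submod Y (kernel Y q))) + real (hom_dim (P i) Z)"
    using hom_dim_exact[OF fdP projP assms, of i] by simp
  then show "real (endim i) * dv Y $ i = real (endim i) * (dv (submod Y (kernel Y q)) + dv Z) $ i"
    by (simp add: hom_dim_dv[OF assms(1)] hom_dim_dv[OF assms(2)] hom_dim_dv[OF k] distrib_left)
qed

lemma dv_iso: "fdm X \<Longrightarrow> fdm Y \<Longrightarrow> iso X Y \<Longrightarrow> dv X = dv Y"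
  by (rule dv_eqI) (metis hom_dim_dv hom_dim_iso2 fdP)

lemma dv_biprod:
  assumes bp: "biprod Q X Y i1 p1 i2 p2" and Q: "fdm Q" and X: "fdm X" and Y: "fdm Y"
  shows "dv Q = dv X + dv Y"
proof -
  note b = biprodD[OF bp] and im = biprod_surj[OF bp]
  have ki: "i1 ` car X = kernel Q p2"
  proof (intro equalityI subsetI)
    fix z assume z: "z \<in> kernel Q p2"
    then have "i1 (p1 z) = z" using b(5)[of z] hom_0[OF b(3)] by (simp add: kernel_def)
    then show "z \<in> i1 ` car X" using z hom_in[OF b(2), of z] by (metis imageI kernel_in)
  qed (use b(7) hom_in[OF b(1)] in \<open>auto simp: kernel_def\<close>)
  have k: "submodule Q (kernel Q p2)" by (rule kernel_submodule[OF Q Y b(4)])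
  have "i1 \<in> homs X (submod Q (kernel Q p2))" using hom_sub_cod[OF sub_le[OF k]] b(1) ki by auto
  moreover have "inj_on i1 (car X)" using b(6) by (metis inj_onI)
  ultimately have "iso X (submod Q (kernel Q p2))" using ki by (auto simp: iso_def bij_betw_def)
  then have "dv X = dv (submod Q (kernel Q p2))" by (rule dv_iso[OF X sub_fdm[OF Q k]])
  then show ?thesis using dv_exact[OF Q Y b(4) im] by simp
qed

lemma dv_zero: "fdm X \<Longrightarrow> car X = {0} \<Longrightarrow> dv X = 0"
  by (rule dv_eqI) (simp add: hom_dim_dv[symmetric] hom_dim_to_zero fdP)

lemma dsum_zero: "car (dsum P (\<lambda>_. 0)) = {0}"
  by (auto simp: dsum_def fun_eq_iff)

lemma dv_dsum: "dv (dsum P m) = (\<Sum>i\<in>UNIV. real (m i) *\<^sub>R dv (P i))"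
proof (induction m rule: nat_fun_induct)
  case zero
  then show ?case using dv_zero[OF dsumfd dsum_zero] by simp
next
  case (step m i)
  obtain i1 p1 i2 p2 where b: "biprod (dsum P (m(i := Suc (m i)))) (dsum P m) (P i) i1 p1 i2 p2"
    using dsum_biprod[where P=P, OF fdP] by blast
  have "(\<Sum>j\<in>UNIV. real ((m(i := Suc (m i))) j) *\<^sub>R dv (P j)) =
      (\<Sum>j\<in>UNIV. real (m j) *\<^sub>R dv (P j) + (if j = i then dv (P i) else 0))"
    by (rule sum.cong) (auto simp: algebra_simps)
  also have "\<dots> = (\<Sum>j\<in>UNIV. real (m j) *\<^sub>R dv (P j)) + dv (P i)"
    by (simp add: sum.distrib)
  finally show ?case unfolding dv_biprod[OF b dsumfd dsumfd fdP] step by (rule sym)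
qed

lemma hom_dim_dsum_dv:
  assumes "fdm Y" shows "real (hom_dim (dsum P m) Y) = (\<Sum>i\<in>UNIV. real (m i) * (real (endim i) * dv Y $ i))"
  using dsum_hom_dim[where P=P, OF fdP assms, of m] hom_dim_dv[OF assms] by simp

lemma dv_eq_0D:
  assumes X: "fdm X" and "dv X = 0" shows "car X = {0}"
proof -
  obtain m p where "projective_cover sc (dsum P m) p X" using cover_exists[OF X] by blast
  then have p: "p \<in> homs (dsum P m) X" "p ` car (dsum P m) = car X" by (auto simp: projective_cover_def)
  have "real (hom_dim (dsum P m) X) = 0" using hom_dim_dsum_dv[OF X] assms(2) by simp
  then have "p = 0" using p(1) hom_dim_0[OF dsumfd X, of m] by simp
  then show ?thesis using p(2) mod_0[OF dsumfd] by auto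
qed

section \<open>The Euler form\<close>

definition pres :: "('k, 'a, 'm::ab_group_add) rmod \<Rightarrow> ('n \<Rightarrow> nat) \<times> ('n \<Rightarrow> nat)" where
  "pres X = (SOME (m, n). min_presentation sc P X m n)"

definition coef :: "('k, 'a, 'm::ab_group_add) rmod \<Rightarrow> real ^ 'n" where
  "coef X = (\<chi> i. real (fst (pres X) i) - real (snd (pres X) i))"

lemma pres_min: assumes "fdm X" shows "min_presentation sc P X (fst (pres X)) (snd (pres X))"
proof -
  have "case pres X of (m, n) \<Rightarrow> min_presentation sc P X m n"
    unfolding pres_def by (rule someI_ex) (use min_presentation_exists[OF assms] in auto)
  then show ?thesis by (simp add: case_prod_beta)
qed

lemma g_module_nth: "g_module sc S P X $ i = real (endim i) * coef X $ i"
  by (simp add: g_module_def pres_def[symmetric] coef_def endim_def case_prod_beta)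

lemma dv_coef:
  assumes X: "fdm X" shows "dv X = (\<Sum>i\<in>UNIV. coef X $ i *\<^sub>R dv (P i))"
proof -
  let ?m = "fst (pres X)" and ?n = "snd (pres X)"
  obtain p where p: "proj_epi (dsum P ?m) p X" and i: "iso (dsum P ?n) (submod (dsum P ?m) (kernel (dsum P ?m) p))"
    by (rule min_presentation_resolution[OF X pres_min[OF X]])
  have ph: "p \<in> homs (dsum P ?m) X" "p ` car (dsum P ?m) = car X" using p by (auto simp: proj_epi_def)
  have k: "fdm (submod (dsum P ?m) (kernel (dsum P ?m) p))"
    by (rule sub_fdm[OF dsumfd kernel_submodule[OF dsumfd X ph(1)]])
  have "dv X = dv (dsum P ?m) - dv (dsum P ?n)"
    using dv_exact[OF dsumfd X ph] dv_iso[OF dsumfd k i] by simp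
  then show ?thesis by (simp add: dv_dsum coef_def sum_subtractf scaleR_left_diff_distrib)
qed

lemma euler_resolution:
  assumes X: "fdm X" and Y: "fdm Y"
  obtains m p where "proj_epi (dsum P m) p X"
    "g_module sc S P X \<bullet> dv Y = real (hom_dim (dsum P m) Y) - real (hom_dim (submod (dsum P m) (kernel (dsum P m) p)) Y)"
proof -
  let ?m = "fst (pres X)" and ?n = "snd (pres X)"
  obtain p where p: "proj_epi (dsum P ?m) p X" and i: "iso (dsum P ?n) (submod (dsum P ?m) (kernel (dsum P ?m) p))"
    by (rule min_presentation_resolution[OF X pres_min[OF X]])
  have k: "fdm (submod (dsum P ?m) (kernel (dsum P ?m) p))" by (rule proj_epi_kernel(2)[OF p X])
  have "g_module sc S P X \<bullet> dv Y = real (hom_dim (dsum P ?m) Y) - real (hom_dim (dsum P ?n) Y)"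
    by (simp add: hom_dim_dsum_dv[OF Y] inner_vec_def g_module_nth coef_def algebra_simps sum_subtractf)
  then show ?thesis using that[OF p] hom_dim_iso1[OF dsumfd k Y i] by simp
qed

lemma euler_form:
  assumes X: "fdm X" and Y: "fdm Y"
  shows "g_module sc S P X \<bullet> dv Y \<le> real (hom_dim X Y)"
    and "g_module sc S P X \<bullet> dv Y = real (hom_dim X Y) \<longleftrightarrow> Ext0 X Y"
proof -
  obtain m p where p: "proj_epi (dsum P m) p X"
    and e: "g_module sc S P X \<bullet> dv Y = real (hom_dim (dsum P m) Y) - real (hom_dim (submod (dsum P m) (kernel (dsum P m) p)) Y)"
    by (rule euler_resolution[OF X Y])
  note d = Ext0_dim[OF X Y p]
  show "g_module sc S P X \<bullet> dv Y \<le> real (hom_dim X Y)" using e d(1) by linarith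
  have "g_module sc S P X \<bullet> dv Y = real (hom_dim X Y) \<longleftrightarrow>
     hom_dim (dsum P m) Y = hom_dim X Y + hom_dim (submod (dsum P m) (kernel (dsum P m) p)) Y"
    using e by linarith
  then show "g_module sc S P X \<bullet> dv Y = real (hom_dim X Y) \<longleftrightarrow> Ext0 X Y" using d(2) by simp
qed

lemma P_hom_inj:
  assumes f: "f \<in> homs (P i) (P l)" "f \<noteq> 0" shows "kernel (P i) f = {0}"
proof -
  let ?I = "f ` car (P i)"
  have sI: "submodule (P l) ?I" by (rule image_submodule[OF fdP f(1) submodule_car[OF fdP]])
  have pI: "projective sc (submod (P l) ?I)" by (rule hereditary_sub[OF her fdP projP sI])
  note fI = sub_fdm[OF fdP sI]
  have fh: "f \<in> homs (P i) (submod (P l) ?I)" using hom_sub_cod[OF sub_le[OF sI]] f(1) by auto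
  obtain s where s: "s \<in> homs (submod (P l) ?I) (P i)" "\<And>y. y \<in> ?I \<Longrightarrow> f (s y) = y"
    by (rule proj_lift[OF pI fdP fI fh _ id_hom[OF fI]]) (auto simp: restr_def)
  let ?J = "s ` ?I"
  have sJ: "submodule (P i) ?J" using image_submodule[OF fI s(1) submodule_car[OF fI]] by simp
  have "?J = car (P i)"
  proof (rule ccontr)
    assume "?J \<noteq> car (P i)"
    then have J: "?J \<subseteq> kernel (P i) (top_map i)" by (rule P_local[OF sJ])
    have "top_map i x = 0" if x: "x \<in> car (P i)" for x
    proof -
      have sf: "s (f x) \<in> car (P i)" using x sub_in[OF sJ] by blast
      have "f (x - s (f x)) = 0" using hom_diff[OF fdP f(1) x sf] s(2) x by simp
      then have "x - s (f x) \<in> kernel (P i) f" using mod_diff[OF fdP x sf] by (simp add: kernel_def)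
      then have "top_map i (x - s (f x)) = 0" using top_kernel_subset[OF fdP f] by (auto simp: kernel_def)
      moreover have "top_map i (s (f x)) = 0" using J x by (auto simp: kernel_def)
      ultimately show ?thesis using hom_diff[OF fdP top_hom x sf] by simp
    qed
    then show False using top_nonzero[of i] hom_out[OF top_hom, of _ i] by (metis ext zero_fun_apply)
  qed
  then have "x = 0" if "x \<in> kernel (P i) f" for x
  proof -
    have "x \<in> ?J" using that \<open>?J = car (P i)\<close> by (auto simp: kernel_def)
    then obtain y where "y \<in> ?I" "x = s y" by blast
    then show ?thesis using that s(2)[of y] hom_0[OF s(1)] by (simp add: kernel_def)
  qed
  then show ?thesis using mod_0[OF fdP] hom_0[OF f(1)] by (auto simp: kernel_in)
qed

lemma P_hom_kdim:
  assumes "i \<noteq> l" and f: "f \<in> homs (P i) (P l)" "f \<noteq> 0" shows "kdim (P i) < kdim (P l)"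
proof -
  have k0: "kernel (P i) f = {0}" by (rule P_hom_inj[OF f])
  have sI: "submodule (P l) (f ` car (P i))" by (rule image_submodule[OF fdP f(1) submodule_car[OF fdP]])
  have e: "kdim (P i) = kdim (submod (P l) (f ` car (P i)))"
    using kdim_image[OF fdP fdP f(1)] k0 kdim_0[OF sub_fdm[OF fdP submodule_0[OF fdP]], of i] by simp
  show ?thesis
  proof (rule ccontr)
    assume "\<not> ?thesis"
    then have "f ` car (P i) = car (P l)"
      using kdim_sub[OF fdP sI] e by linarith
    then have "bij_betw f (car (P i)) (car (P l))"
      using hom_injD[OF fdP f(1) k0] by (simp add: bij_betw_def)
    then obtain g where g: "g \<in> homs (P l) (P i)" "bij_betw g (car (P l)) (car (P i))"
      by (rule iso_inverse[OF fdP f(1)])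
    let ?h = "\<lambda>x. top_map i (g x)"
    have h: "?h \<in> homs (P l) (S i)" by (rule hom_comp[OF g(1) top_hom])
    have "?h ` car (P l) = top_map i ` g ` car (P l)" by (simp add: image_image)
    then have "?h ` car (P l) = car (S i)" using g(2) top_surj by (simp add: bij_betw_def)
    then have "?h \<noteq> 0" using simpleS[of i] mod_0[OF fdP, of l] by (auto simp: simple_def fun_eq_iff)
    then have "hom_dim (P l) (S i) > 0" by (rule hom_dim_pos[OF fdP fdS h])
    then show False using assms(1) hom_P_S[of l i] by simp
  qed
qed

lemma P_hom_self: "hom_dim (P i) (P i) > 0"
proof (rule hom_dim_pos[OF fdP fdP id_hom[OF fdP]])
  obtain x where x: "top_map i x \<noteq> 0" using top_nonzero[of i] by (auto simp: fun_eq_iff)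
  then have "x \<in> car (P i)" using hom_out[OF top_hom] by metis
  moreover have "x \<noteq> 0" using x hom_0[OF top_hom] by metis
  ultimately have "restr (car (P i)) (\<lambda>x. x) x \<noteq> 0" unfolding restr_def by simp
  then show "restr (car (P i)) (\<lambda>x. x) \<noteq> 0" by (metis zero_fun_apply)
qed

lemma cartan_independent:
  assumes "(\<Sum>i\<in>UNIV. a $ i *\<^sub>R dv (P i)) = 0" shows "a = 0"
proof (rule ccontr)
  assume "a \<noteq> 0"
  then have ne: "{i. a $ i \<noteq> 0} \<noteq> {}" by (auto simp: vec_eq_iff)
  let ?M = "Max ((\<lambda>i. kdim (P i)) ` {i. a $ i \<noteq> 0})"
  have "?M \<in> (\<lambda>i. kdim (P i)) ` {i. a $ i \<noteq> 0}" using ne by (intro Max_in) auto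
  then obtain l where l: "a $ l \<noteq> 0" "kdim (P l) = ?M" by auto
  have mx: "kdim (P i) \<le> kdim (P l)" if "a $ i \<noteq> 0" for i unfolding l(2) using that by (intro Max_ge) auto
  have "0 = real (endim l) * (\<Sum>i\<in>UNIV. a $ i *\<^sub>R dv (P i)) $ l" using assms by simp
  also have "\<dots> = (\<Sum>i\<in>UNIV. a $ i * real (hom_dim (P l) (P i)))"
    by (simp add: sum_distrib_left hom_dim_dv[OF fdP] algebra_simps)
  also have "\<dots> = (\<Sum>i\<in>UNIV. if i = l then a $ l * real (hom_dim (P l) (P l)) else 0)"
  proof (rule sum.cong)
    fix i
    show "a $ i * real (hom_dim (P l) (P i)) = (if i = l then a $ l * real (hom_dim (P l) (P l)) else 0)"
    proof (cases "i = l \<or> a $ i = 0")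
      case False
      have "hom_dim (P l) (P i) = 0"
      proof (rule ccontr)
        assume "hom_dim (P l) (P i) \<noteq> 0"
        then obtain f where "f \<in> homs (P l) (P i)" "f \<noteq> 0" using hom_dim_posE[OF fdP fdP] by blast
        then have "kdim (P l) < kdim (P i)" using P_hom_kdim[of l i f] False by auto
        then show False using mx[of i] False by simp
      qed
      then show ?thesis using False by simp
    qed auto
  qed simp
  also have "\<dots> = a $ l * real (hom_dim (P l) (P l))" by simp
  finally show False using l(1) P_hom_self[of l] by simp
qed

definition cartan :: "real ^ 'n \<Rightarrow> real ^ 'n" where
  "cartan a = (\<Sum>i\<in>UNIV. a $ i *\<^sub>R dv (P i))"

lemma cartan_linear: "linear cartan"
  by (rule linearI) (simp_all add: cartan_def algebra_simps sum.distrib scaleR_sum_right)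

lemma cartan_inj: "inj cartan"
  using cartan_independent by (subst linear_injective_0[OF cartan_linear]) (auto simp: cartan_def)

definition form :: "real ^ 'n \<Rightarrow> real ^ 'n \<Rightarrow> real" where
  "form x y = (\<Sum>i\<in>UNIV. real (endim i) * inv cartan x $ i * y $ i)"

lemma inv_cartan: "inv cartan (cartan a) = a"
  using cartan_inj by simp

lemma inv_cartan_linear: "linear (inv cartan)"
proof -
  have "surj cartan" by (rule linear_injective_imp_surjective[OF cartan_linear cartan_inj refl])
  then show ?thesis using cartan_inj cartan_linear
    by (metis bijI inj_linear_imp_inv_linear)
qed

lemma form_bilinear: "bounded_bilinear form"
  unfolding bilinear_conv_bounded_bilinear[symmetric] bilinear_def form_def
  by (intro conjI allI linearI)
    (simp_all add: linear_add[OF inv_cartan_linear] linear_scale[OF inv_cartan_linear] algebra_simps sum.distrib sum_distrib_left)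

lemma form_module: "fdm X \<Longrightarrow> form (dv X) y = g_module sc S P X \<bullet> y"
proof -
  assume X: "fdm X"
  have "dv X = cartan (coef X)" using dv_coef[OF X] by (simp add: cartan_def)
  then show ?thesis by (simp add: form_def inv_cartan inner_vec_def g_module_nth)
qed

lemma form_P: "form (- dv (P i)) y = - real (endim i) * y $ i"
proof -
  have "dv (P i) = cartan (axis i 1)" by (simp add: cartan_def axis_def if_distrib[of "\<lambda>c. c *\<^sub>R _"] cong: if_cong)
  then have "inv cartan (- dv (P i)) = - axis i 1"
    using linear_neg[OF inv_cartan_linear] inv_cartan by metis
  then have "form (- dv (P i)) y = (\<Sum>j\<in>UNIV. if j = i then - real (endim i) * y $ i else 0)"
    unfolding form_def by (intro sum.cong) (auto simp: axis_def)
  then show ?thesis by simp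
qed

lemma g_vec_form:
  "exceptional_object sc T \<Longrightarrow> g_vec sc S P T \<bullet> y =
     form (case T of Mod X \<Rightarrow> dv X | Sh i \<Rightarrow> - dv (P i)) y"
  by (cases T) (simp_all add: form_module form_P endim_def inner_axis' mult.commute)

section \<open>Exactness properties of Ext\<close>

lemma Ext0_quotient:
  assumes X: "fdm X" and Y: "fdm Y" and Z: "fdm Z" and e: "Ext0 X Y"
    and q: "q \<in> homs Y Z" "q ` car Y = car Z"
  shows "Ext0 X Z"
proof -
  obtain Q :: "('k, 'a) umod" and p where p: "proj_epi Q p X" by (rule proj_epi_exists[OF X])
  note Q = proj_epiD[OF p] and K = proj_epi_kernel[OF p X]
  have "extends Q (kernel Q p) Z" unfolding extends_def
  proof
    fix h assume h: "h \<in> homs (submod Q (kernel Q p)) Z"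
    obtain g where g: "g \<in> homs (submod Q (kernel Q p)) Y" "\<And>x. x \<in> car (submod Q (kernel Q p)) \<Longrightarrow> q (g x) = h x"
      by (rule proj_lift[OF K(3) Y Z q h]) blast
    obtain G where G: "G \<in> homs Q Y" "\<And>x. x \<in> kernel Q p \<Longrightarrow> G x = g x"
      by (rule Ext0_E[OF X Y p e g(1)]) blast
    show "\<exists>H\<in>homs Q Z. \<forall>x\<in>kernel Q p. H x = h x"
      by (rule bexI[OF _ hom_comp[OF G(1) q(1)]]) (use g(2) G(2) in auto)
  qed
  then show ?thesis by (rule Ext0I[OF X Z p])
qed

lemma Ext0_extension2:
  assumes X: "fdm X" and Y: "fdm Y" and Z: "fdm Z"
    and q: "q \<in> homs Y Z" "q ` car Y = car Z"
    and e1: "Ext0 X (submod Y (kernel Y q))" and e2: "Ext0 X Z"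
  shows "Ext0 X Y"
proof -
  let ?A = "kernel Y q"
  have sA: "submodule Y ?A" by (rule kernel_submodule[OF Y Z q(1)])
  obtain Q :: "('k, 'a) umod" and p where p: "proj_epi Q p X" by (rule proj_epi_exists[OF X])
  note Q = proj_epiD[OF p] and K = proj_epi_kernel[OF p X]
  let ?K = "kernel Q p"
  have "extends Q ?K Y" unfolding extends_def
  proof
    fix h assume h: "h \<in> homs (submod Q ?K) Y"
    obtain H where H: "H \<in> homs Q Z" "\<And>x. x \<in> ?K \<Longrightarrow> H x = q (h x)"
      by (rule Ext0_E[OF X Z p e2 hom_comp[OF h q(1)]]) blast
    obtain G where G: "G \<in> homs Q Y" "\<And>x. x \<in> car Q \<Longrightarrow> q (G x) = H x"
      by (rule proj_lift[OF Q(2) Y Z q H(1)]) blast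
    have rG: "restr ?K G \<in> homs (submod Q ?K) Y" by (rule restr_hom[OF G(1) K(1)])
    have im: "h x - restr ?K G x \<in> ?A" if x: "x \<in> ?K" for x
    proof -
      have xQ: "x \<in> car Q" using x by (simp add: kernel_in)
      have hx: "h x \<in> car Y" using hom_in[OF h] x by simp
      show ?thesis using x hom_diff[OF Y q(1) hx hom_in[OF G(1) xQ]] G(2)[OF xQ] H(2)[OF x]
        mod_diff[OF Y hx hom_in[OF G(1) xQ]] by (simp add: kernel_in restr_def)
    qed
    have "(\<lambda>x. h x - restr ?K G x) \<in> homs (submod Q ?K) (submod Y ?A)"
      using hom_minus[OF Y h rG] im by (subst hom_sub_cod[OF sub_le[OF sA]]) auto
    then obtain F where F: "F \<in> homs Q (submod Y ?A)" "\<And>x. x \<in> ?K \<Longrightarrow> F x = h x - restr ?K G x"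
      by (rule Ext0_E[OF X sub_fdm[OF Y sA] p e1]) blast
    have "F \<in> homs Q Y" using F(1) hom_sub_cod[OF sub_le[OF sA]] by blast
    then have "(\<lambda>x. G x + F x) \<in> homs Q Y" by (rule hom_plus[OF Y G(1)])
    then show "\<exists>H\<in>homs Q Y. \<forall>x\<in>?K. H x = h x"
      by (rule bexI[rotated]) (auto simp: F(2) restr_def)
  qed
  then show ?thesis by (rule Ext0I[OF X Y p])
qed

lemma Ext0_extension1:
  assumes W: "fdm W" and Y: "fdm Y" and Z: "fdm Z"
    and q: "q \<in> homs Y Z" "q ` car Y = car Z"
    and e1: "Ext0 (submod Y (kernel Y q)) W" and e2: "Ext0 Z W"
  shows "Ext0 Y W"
proof -
  let ?A = "kernel Y q"
  have sA: "submodule Y ?A" by (rule kernel_submodule[OF Y Z q(1)])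
  obtain Q :: "('k, 'a) umod" and p where p: "proj_epi Q p Y" by (rule proj_epi_exists[OF Y])
  note Q = proj_epiD[OF p] and K = proj_epi_kernel[OF p Y]
  let ?K = "kernel Q p"
  define B where "B = kernel Q (\<lambda>x. q (p x))"
  have sB: "submodule Q B" unfolding B_def by (rule kernel_submodule[OF Q(1) Z hom_comp[OF Q(3) q(1)]])
  have B: "B = {x\<in>car Q. p x \<in> ?A}" using hom_in[OF Q(3)] by (auto simp: B_def kernel_in)
  have KB: "?K \<subseteq> B" using hom_0[OF q(1)] by (auto simp: B_def kernel_in)
  have "(\<lambda>x. q (p x)) ` car Q = q ` p ` car Q" by (simp add: image_image)
  then have pZ: "proj_epi Q (\<lambda>x. q (p x)) Z"
    using Q q hom_comp[OF Q(3) q(1)] by (simp add: proj_epi_def)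
  have im: "restr B p ` B = ?A"
  proof (intro equalityI subsetI)
    fix y assume y: "y \<in> ?A"
    then have "y \<in> p ` car Q" using Q(4) sub_in[OF sA] by simp
    then show "y \<in> restr B p ` B" using y unfolding B by (auto simp: restr_def image_iff)
  qed (auto simp: restr_def B)
  have rp: "restr B p \<in> homs (submod Q B) (submod Y ?A)"
    using restr_hom[OF Q(3) sB] im by (subst hom_sub_cod[OF sub_le[OF sA]]) auto
  have pA: "proj_epi (submod Q B) (restr B p) (submod Y ?A)"
    using rp im sub_fdm[OF Q(1) sB] hereditary_sub[OF her Q(1,2) sB] by (simp add: proj_epi_def)
  have kA: "kernel (submod Q B) (restr B p) = ?K"
    using KB sub_le[OF sB] by (auto simp: kernel_def restr_def)
  have "extends Q ?K W" unfolding extends_def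
  proof
    fix h assume h: "h \<in> homs (submod Q ?K) W"
    then have "h \<in> homs (submod (submod Q B) (kernel (submod Q B) (restr B p))) W" by (simp add: kA)
    then obtain g where g: "g \<in> homs (submod Q B) W" "\<And>x. x \<in> kernel (submod Q B) (restr B p) \<Longrightarrow> g x = h x"
      by (rule Ext0_E[OF sub_fdm[OF Y sA] W pA e1]) blast
    obtain G where G: "G \<in> homs Q W" "\<And>x. x \<in> B \<Longrightarrow> G x = g x"
      by (rule Ext0_E[OF Z W pZ e2 g(1)[unfolded B_def]]) (auto simp: B_def)
    show "\<exists>H\<in>homs Q W. \<forall>x\<in>?K. H x = h x"
      by (rule bexI[OF _ G(1)]) (use G(2) g(2) KB kA in auto)
  qed
  then show ?thesis by (rule Ext0I[OF Y W p])
qed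

lemma Ext0_iso1:
  assumes X: "fdm X" and Y: "fdm Y" and Z: "fdm Z" and "iso X Y" and e: "Ext0 X Z"
  shows "Ext0 Y Z"
proof -
  obtain f where f: "f \<in> homs X Y" "bij_betw f (car X) (car Y)" using assms by (auto simp: iso_def)
  obtain Q :: "('k, 'a) umod" and p where p: "proj_epi Q p X" by (rule proj_epi_exists[OF X])
  note Q = proj_epiD[OF p]
  have "(\<lambda>x. f (p x)) ` car Q = f ` p ` car Q" by (simp add: image_image)
  then have pY: "proj_epi Q (\<lambda>x. f (p x)) Y"
    using Q f hom_comp[OF Q(3) f(1)] by (simp add: proj_epi_def bij_betw_def)
  have "x = 0" if "x \<in> car X" "f x = 0" for x
    using inj_kernel[OF X f(1)] f(2) that by (auto simp: bij_betw_def kernel_def)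
  then have "kernel Q (\<lambda>x. f (p x)) = kernel Q p"
    using hom_in[OF Q(3)] hom_0[OF f(1)] by (auto simp: kernel_def)
  then show ?thesis using Ext0I[OF Y Z pY] Ext0D[OF X Z p e] by simp
qed

lemma Ext0_iso2:
  assumes "fdm X" "fdm Y" "fdm Z" "iso Y Z" "Ext0 X Y" shows "Ext0 X Z"
proof -
  obtain f where "f \<in> homs Y Z" "bij_betw f (car Y) (car Z)" using assms by (auto simp: iso_def)
  then show ?thesis using Ext0_quotient[OF assms(1-3,5)] by (simp add: bij_betw_def)
qed

lemma Ext0_zero:
  assumes "fdm X" "fdm Y" "car Y = {0}" shows "Ext0 X Y"
proof -
  obtain Q :: "('k, 'a) umod" and p where p: "proj_epi Q p X" by (rule proj_epi_exists[OF assms(1)])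
  have "extends Q (kernel Q p) Y" unfolding extends_def
    by (intro ballI bexI[OF _ hom_zero[OF assms(2)]]) (use assms hom_in_all in \<open>fastforce\<close>)
  then show ?thesis by (rule Ext0I[OF assms(1,2) p])
qed

lemma Ext0_zero1:
  assumes "fdm X" "fdm Y" "car X = {0}" shows "Ext0 X Y"
proof -
  obtain Q :: "('k, 'a) umod" and p where p: "proj_epi Q p X" by (rule proj_epi_exists[OF assms(1)])
  note Q = proj_epiD[OF p]
  have k: "kernel Q p = car Q" using Q(4) assms(3) by (auto simp: kernel_def)
  have "extends Q (kernel Q p) Y" unfolding extends_def k submod_car by blast
  then show ?thesis by (rule Ext0I[OF assms(1,2) p])
qed

lemma Ext0_ext1_zero:
  assumes X: "fdm X" and Y: "fdm Y" and e: "Ext0 X Y" shows "ext1_zero sc X Y"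
  unfolding ext1_zero_def
proof (intro allI impI, elim conjE)
  fix E :: "('k, 'a) umod" and i p assume E: "fdm E" and se: "short_exact Y i E p X"
  have i: "i \<in> homs Y E" "inj_on i (car Y)" and p: "p \<in> homs E X" "p ` car E = car X" and ik: "i ` car Y = kernel E p"
    using se by (auto simp: short_exact_def)
  obtain Q :: "('k, 'a) umod" and \<pi> where \<pi>: "proj_epi Q \<pi> X" by (rule proj_epi_exists[OF X])
  note Q = proj_epiD[OF \<pi>] and K = proj_epi_kernel[OF \<pi> X]
  let ?K = "kernel Q \<pi>"
  obtain g where g: "g \<in> homs Q E" "\<And>x. x \<in> car Q \<Longrightarrow> p (g x) = \<pi> x"
    by (rule proj_lift[OF Q(2) E X p Q(3)]) blast
  have sk: "submodule E (kernel E p)" by (rule kernel_submodule[OF E X p(1)])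
  have i': "i \<in> homs Y (submod E (kernel E p))" using hom_sub_cod[OF sub_le[OF sk]] i ik by blast
  obtain j where j: "j \<in> homs (submod E (kernel E p)) Y" "\<And>y. y \<in> kernel E p \<Longrightarrow> i (j y) = y"
    by (rule iso_inverse[OF Y i']) (use i ik in \<open>auto simp: bij_betw_def\<close>)
  have gk: "g x \<in> kernel E p" if "x \<in> ?K" for x
    using that g hom_in[OF g(1)] by (simp add: kernel_in)
  have "restr ?K g \<in> homs (submod Q ?K) (submod E (kernel E p))"
    using restr_hom[OF g(1) K(1)] gk by (subst hom_sub_cod[OF sub_le[OF sk]]) (auto simp: restr_def)
  from hom_comp[OF this j(1)] obtain H where H: "H \<in> homs Q Y" "\<And>x. x \<in> ?K \<Longrightarrow> H x = j (restr ?K g x)"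
    by (rule Ext0_E[OF X Y \<pi> e]) blast
  let ?G = "\<lambda>x. g x - i (H x)"
  have G: "?G \<in> homs Q E" by (rule hom_minus[OF E g(1) hom_comp[OF H(1) i(1)]])
  have "kernel Q \<pi> \<subseteq> kernel Q ?G"
    using H(2) j(2) gk by (auto simp: kernel_in restr_def)
  then obtain s where s: "s \<in> homs X E" "\<And>x. x \<in> car Q \<Longrightarrow> s (\<pi> x) = ?G x"
    by (rule hom_factor[OF Q(1,3,4) G]) blast
  have "p (s x) = x" if x: "x \<in> car X" for x
  proof -
    have "x \<in> \<pi> ` car Q" using x Q(4) by simp
    then obtain z where z: "z \<in> car Q" "x = \<pi> z" by blast
    have "i (H z) \<in> kernel E p" using hom_in[OF H(1) z(1)] ik by blast
    then have iH: "i (H z) \<in> car E" "p (i (H z)) = 0" by (auto simp: kernel_in)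
    have "p (s x) = p (g z) - p (i (H z))"
      unfolding z(2) s(2)[OF z(1)] by (rule hom_diff[OF E p(1) hom_in[OF g(1) z(1)] iH(1)])
    then show ?thesis using g(2)[OF z(1)] z iH by simp
  qed
  then show "\<exists>s\<in>homs X E. \<forall>x\<in>car X. p (s x) = x" using s(1) by blast
qed

definition division :: "('k, 'a, 'm::ab_group_add) rmod \<Rightarrow> bool" where
  "division X \<longleftrightarrow> (\<forall>f\<in>homs X X. f \<noteq> 0 \<longrightarrow> (\<exists>g\<in>homs X X. \<forall>x\<in>car X. g (f x) = x \<and> f (g x) = x))"

lemma divisionE:
  assumes "division X" "f \<in> homs X X" "f \<noteq> 0"
  obtains g where "g \<in> homs X X" "\<And>x. x \<in> car X \<Longrightarrow> g (f x) = x" "\<And>x. x \<in> car X \<Longrightarrow> f (g x) = x"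
  using assms unfolding division_def by blast

text \<open>The Happel--Ringel lemma.\<close>

lemma mono_or_epi:
  assumes X: "fdm X" "division X" and Y: "fdm Y" "division Y" and e: "Ext0 Y X"
    and f: "f \<in> homs X Y" "f \<noteq> 0"
  shows "kernel X f = {0} \<or> f ` car X = car Y"
proof -
  obtain Q :: "('k, 'a) umod" and p where p: "proj_epi Q p Y" by (rule proj_epi_exists[OF Y(1)])
  note Q = proj_epiD[OF p] and K = proj_epi_kernel[OF p Y(1)]
  let ?K = "kernel Q p" and ?I = "f ` car X"
  have sI: "submodule Y ?I" by (rule image_submodule[OF X(1) f(1) submodule_car[OF X(1)]])
  note fI = sub_fdm[OF Y(1) sI]
  define B where "B = {x\<in>car Q. p x \<in> ?I}"
  have sB: "submodule Q B" unfolding B_def by (rule vimage_submodule[OF Q(1,3) sI])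
  have KB: "?K \<subseteq> B" using sub_0[OF sI] by (auto simp: B_def kernel_in)
  have BQ: "x \<in> B \<Longrightarrow> x \<in> car Q" for x by (simp add: B_def)
  have rp: "restr B p \<in> homs (submod Q B) (submod Y ?I)"
    using restr_hom[OF Q(3) sB] by (subst hom_sub_cod[OF sub_le[OF sI]]) (auto simp: restr_def B_def)
  have rpim: "restr B p ` B = ?I"
  proof (intro equalityI subsetI)
    fix y assume y: "y \<in> ?I"
    then have "y \<in> p ` car Q" using Q(4) sub_in[OF sI] by simp
    then show "y \<in> restr B p ` B" using y unfolding B_def by (auto simp: restr_def image_iff)
  qed (auto simp: restr_def B_def)
  have fI': "f \<in> homs X (submod Y ?I)" using hom_sub_cod[OF sub_le[OF sI]] f(1) by blast
  obtain q where q: "q \<in> homs (submod Q B) X" "\<And>x. x \<in> B \<Longrightarrow> f (q x) = restr B p x"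
    by (rule proj_lift[OF hereditary_sub[OF her Q(1,2) sB] X(1) fI fI' _ rp]) auto
  have fq: "f (q x) = p x" if "x \<in> B" for x using q(2)[OF that] that by (simp add: restr_def)
  have sKB: "submodule (submod Q B) ?K" using submodule_trans[OF sB] K(1) KB by simp
  have "restr ?K q \<in> homs (submod Q ?K) X" using restr_hom[OF q(1) sKB] by simp
  then obtain r where r: "r \<in> homs Q X" "\<And>x. x \<in> ?K \<Longrightarrow> r x = restr ?K q x"
    by (rule Ext0_E[OF Y(1) X(1) p e]) blast
  have rB: "restr B r \<in> homs (submod Q B) X" by (rule restr_hom[OF r(1) sB])
  let ?d = "\<lambda>x. q x - restr B r x"
  have d: "?d \<in> homs (submod Q B) X" by (rule hom_minus[OF X(1) q(1) rB])
  have kd: "kernel (submod Q B) (restr B p) \<subseteq> kernel (submod Q B) ?d"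
    using r(2) BQ by (auto simp: kernel_def restr_def)
  obtain s where s: "s \<in> homs (submod Y ?I) X" "\<And>x. x \<in> B \<Longrightarrow> s (restr B p x) = ?d x"
    by (rule hom_factor[OF sub_fdm[OF Q(1) sB] rp _ d kd]) (use rpim in auto)
  have sf: "(\<lambda>x. s (f x)) \<in> homs X X" by (rule hom_comp[OF fI' s(1)])
  show ?thesis
  proof (cases "(\<lambda>x. s (f x)) = 0")
    case False
    obtain g where g: "g \<in> homs X X" "\<And>x. x \<in> car X \<Longrightarrow> g (s (f x)) = x"
      by (rule divisionE[OF X(2) sf False]) blast
    have "x = 0" if "x \<in> kernel X f" for x
      using that g(2)[of x] hom_0[OF s(1)] hom_0[OF g(1)] by (simp add: kernel_in)
    then show ?thesis using mod_0[OF X(1)] hom_0[OF f(1)] by (auto simp: kernel_in)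
  next
    case True
    have s0: "s y = 0" if "y \<in> ?I" for y using that True by (auto simp: fun_eq_iff)
    have qr: "q x = r x" if "x \<in> B" for x
    proof -
      have "restr B p x \<in> ?I" using rpim that by blast
      then show ?thesis using s(2)[OF that] s0 that by (simp add: restr_def)
    qed
    have fr: "(\<lambda>x. f (r x)) \<in> homs Q Y" by (rule hom_comp[OF r(1) f(1)])
    have "f (r x) = 0" if "x \<in> ?K" for x
    proof -
      have "x \<in> B" using that KB by blast
      then show ?thesis using fq[of x] qr[of x] that by (simp add: kernel_in)
    qed
    then have "?K \<subseteq> kernel Q (\<lambda>x. f (r x))" by (auto simp: kernel_in)
    then obtain e' where e': "e' \<in> homs Y Y" "\<And>x. x \<in> car Q \<Longrightarrow> e' (p x) = f (r x)"
      by (rule hom_factor[OF Q(1,3,4) fr]) blast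
    have e'I: "e' y = y" if "y \<in> ?I" for y
    proof -
      have "y \<in> restr B p ` B" using that rpim by simp
      then obtain x where x: "x \<in> B" "y = p x" by (auto simp: restr_def)
      then show ?thesis using e'(2)[OF BQ[OF x(1)]] qr[OF x(1)] fq[OF x(1)] by simp
    qed
    have "e' \<noteq> 0"
    proof
      assume "e' = 0"
      then have "f x = 0" for x using e'I hom_out[OF f(1)] by (cases "x \<in> car X") force+
      then show False using f(2) by (auto simp: fun_eq_iff)
    qed
    then obtain g where g: "\<And>x. x \<in> car Y \<Longrightarrow> e' (g x) = x" "g \<in> homs Y Y"
      by (rule divisionE[OF Y(2) e'(1)]) blast
    have "y \<in> ?I" if y: "y \<in> car Y" for y
    proof -
      have "g y \<in> p ` car Q" using hom_in[OF g(2) y] Q(4) by simp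
      then obtain z where z: "z \<in> car Q" "g y = p z" by blast
      then have "y = f (r z)" using g(1)[OF y] e'(2)[OF z(1)] by simp
      then show ?thesis using hom_in[OF r(1) z(1)] by blast
    qed
    then show ?thesis using sub_le[OF sI] by blast
  qed
qed

section \<open>Derived category\<close>

lemma zero_sub: "fdm X \<Longrightarrow> fdm (submod X {0})"
  by (rule sub_fdm[OF _ submodule_0])

lemma ext1_D_zero_Ext0:
  fixes X Y :: "('k, 'a) umod"
  assumes X: "fdm X" and Y: "fdm Y" and ext: "ext1_D_zero sc (stalk X) (stalk Y)"
  shows "Ext0 X Y"
proof -
  obtain Q :: "('k, 'a) umod" and p where p: "proj_epi Q p X" by (rule proj_epi_exists[OF X])
  note Q = proj_epiD[OF p] and K = proj_epi_kernel[OF p X]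
  let ?K = "kernel Q p"
  note fQ0 = zero_sub[OF Q(1)] and fX0 = zero_sub[OF X] and fY0 = zero_sub[OF Y]
  have K0: "0 \<in> ?K" by (rule sub_0[OF K(1)])
  \<comment> \<open>\<open>Z\<close> is the projective resolution of \<open>X\<close>, placed in degrees \<open>-1\<close> and \<open>0\<close>\<close>
  define Z :: "('k, 'a) ucpx" where
    "Z = \<lparr>ob = (\<lambda>i. if i = 0 then Q else if i = -1 then submod Q ?K else submod Q {0}),
          dif = (\<lambda>i. if i = -1 then restr ?K (\<lambda>x. x) else (\<lambda>x. 0))\<rparr>"
  have obZ: "ob Z 0 = Q" "ob Z (-1) = submod Q ?K" "i \<noteq> 0 \<Longrightarrow> i \<noteq> -1 \<Longrightarrow> ob Z i = submod Q {0}" for i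
    by (auto simp: Z_def)
  have difZ: "dif Z (-1) = restr ?K (\<lambda>x. x)" "i \<noteq> -1 \<Longrightarrow> dif Z i = (\<lambda>x. 0)" for i
    by (auto simp: Z_def)
  have fZ: "fdm (ob Z i)" for i
    using Q(1) K(2) fQ0 by (cases "i = 0"; cases "i = -1") (auto simp: obZ)
  have difhom: "dif Z i \<in> homs (ob Z i) (ob Z (i + 1))" for i
  proof (cases "i = -1")
    case True
    then show ?thesis using incl_hom[OF K(1)] by (simp add: obZ difZ)
  next
    case False
    then show ?thesis using hom_zero[OF fZ] by (simp add: difZ)
  qed
  have "{i. car (ob Z i) \<noteq> {0}} \<subseteq> {0, -1}" using obZ(3) by force
  then have "finite {i. car (ob Z i) \<noteq> {0}}" by (rule finite_subset) simp
  moreover have "dif Z (i + 1) (dif Z i x) = 0" for i x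
    by (cases "i = -1") (auto simp: difZ(2) hom_0[OF difhom])
  ultimately have bZ: "bounded_complex sc Z"
    unfolding bounded_complex_def using fZ difhom by blast
  have sX: "ob (stalk X) 0 = X" "i \<noteq> 0 \<Longrightarrow> ob (stalk X) i = submod X {0}" "dif (stalk X) i = (\<lambda>x. 0)" for i
    by (auto simp: stalk_def)
  define s where "s i = (if i = 0 then p else (\<lambda>x. 0))" for i :: int
  have s: "s 0 = p" "i \<noteq> 0 \<Longrightarrow> s i = (\<lambda>x. 0)" for i by (auto simp: s_def)
  have shom: "s i \<in> homs (ob Z i) (ob (stalk X) i)" for i
    using Q(3) hom_zero[OF fX0] by (cases "i = 0") (auto simp: s obZ sX)
  have sdif: "s (i + 1) (dif Z i x) = 0" if "x \<in> car (ob Z i)" for i x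
  proof (cases "i = -1")
    case True
    then have "x \<in> ?K" using that by (simp add: obZ)
    then show ?thesis using True by (simp add: difZ restr_def s kernel_in)
  next
    case False
    then show ?thesis by (simp add: difZ s_def hom_0[OF Q(3)])
  qed
  have qs: "quasi_iso Z (stalk X) s"
    unfolding quasi_iso_def
  proof (intro conjI allI ballI impI)
    show "chain_map Z (stalk X) s" unfolding chain_map_def using shom sdif by (simp add: sX)
  next
    fix i x assume x: "x \<in> cycles Z i" "s i x \<in> boundaries (stalk X) i"
    show "x \<in> boundaries Z i"
    proof (cases "i = 0")
      case True
      have "p x = 0" using x(2) True by (auto simp: boundaries_def sX s)
      then have "x \<in> ?K" using x(1) True by (simp add: cycles_def kernel_in obZ)
      then show ?thesis unfolding boundaries_def True by (auto simp: obZ difZ restr_def image_iff)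
    next
      case False
      have "x = 0"
        using x(1) False by (cases "i = -1") (auto simp: cycles_def kernel_in obZ difZ restr_def)
      moreover have "0 \<in> car (ob Z (i - 1))" "dif Z (i - 1) 0 = 0"
        using mod_0[OF fZ] hom_0[OF difhom] by blast+
      ultimately show ?thesis unfolding boundaries_def by (metis imageI)
    qed
  next
    fix i y assume y: "y \<in> cycles (stalk X) i"
    have b0: "0 \<in> boundaries (stalk X) i"
    proof -
      have "0 \<in> car (ob (stalk X) (i - 1))" using mod_0[OF X] by (simp add: stalk_def)
      then show ?thesis unfolding boundaries_def by (auto simp: sX)
    qed
    show "\<exists>x\<in>cycles Z i. y - s i x \<in> boundaries (stalk X) i"
    proof (cases "i = 0")
      case True
      then have "y \<in> p ` car Q" using y Q(4) by (simp add: cycles_def kernel_in sX)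
      then obtain x where x: "x \<in> car Q" "y = p x" by blast
      then have "x \<in> cycles Z i" using True by (simp add: cycles_def kernel_in obZ difZ)
      moreover have "y - s i x = 0" using x True by (simp add: s)
      ultimately show ?thesis using b0 by metis
    next
      case False
      then have "y - s i 0 = 0" using y by (simp add: cycles_def kernel_in sX s)
      moreover have "0 \<in> cycles Z i" using mod_0[OF fZ] hom_0[OF difhom] by (simp add: cycles_def kernel_in)
      ultimately show ?thesis using b0 by metis
    qed
  qed
  have "extends Q ?K Y" unfolding extends_def
  proof
    fix h assume h: "h \<in> homs (submod Q ?K) Y"
    let ?Y1 = "shift (stalk Y) 1"
    have obY: "ob ?Y1 (-1) = Y" "i \<noteq> -1 \<Longrightarrow> ob ?Y1 i = submod Y {0}" for i
      by (auto simp: shift_def stalk_def)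
    have fY1: "fdm (ob ?Y1 i)" for i using Y fY0 by (cases "i = -1") (auto simp: obY)
    have difY: "dif ?Y1 i x = 0" for i x by (simp add: shift_def stalk_def)
    define f where "f i = (if i = -1 then h else (\<lambda>x. 0))" for i :: int
    have fm: "f (-1) = h" "i \<noteq> -1 \<Longrightarrow> f i = (\<lambda>x. 0)" for i by (auto simp: f_def)
    have fhom: "f i \<in> homs (ob Z i) (ob ?Y1 i)" for i
      using h hom_zero[OF fY0] by (cases "i = -1") (auto simp: fm obZ obY)
    have "f (i + 1) (dif Z i x) = 0" for i x
      using hom_0[OF h] by (cases "i = -1") (auto simp: fm difZ, auto simp: f_def)
    then have "chain_map Z ?Y1 f" unfolding chain_map_def using fhom by (simp add: difY)
    then obtain W :: "('k, 'a) ucpx" and t where W: "bounded_complex sc W" and t: "quasi_iso W Z t"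
      and nh: "null_homotopic W ?Y1 (\<lambda>i x. f i (t i x))"
      using ext bZ qs unfolding ext1_D_zero_def hom_D_zero_def by blast
    have fW: "fdm (ob W i)" and dW: "dif W i \<in> homs (ob W i) (ob W (i + 1))" for i
      using W by (auto simp: bounded_complex_def)
    have thom: "t i \<in> homs (ob W i) (ob Z i)" and tdif: "x \<in> car (ob W i) \<Longrightarrow> t (i + 1) (dif W i x) = dif Z i (t i x)"
      and tinj: "x \<in> cycles W i \<Longrightarrow> t i x \<in> boundaries Z i \<Longrightarrow> x \<in> boundaries W i"
      and tsur: "y \<in> cycles Z i \<Longrightarrow> \<exists>x\<in>cycles W i. y - t i x \<in> boundaries Z i" for i x y
      using t by (auto simp: quasi_iso_def chain_map_def)
    obtain k where k: "\<And>i. k i \<in> homs (ob W i) (ob ?Y1 (i - 1))"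
      "\<And>i x. x \<in> car (ob W i) \<Longrightarrow> f i (t i x) = dif ?Y1 (i - 1) (k i x) + k (i + 1) (dif W i x)"
      using nh by (auto simp: null_homotopic_def)
    have k0: "k 0 \<in> homs (ob W 0) Y" using k(1)[of 0] by (simp add: obY)
    have hk: "h (t (-1) w) = k 0 (dif W (-1) w)" if "w \<in> car (ob W (-1))" for w
      using k(2)[OF that] by (simp add: fm difY)
    have t0: "t 0 \<in> homs (ob W 0) Q" using thom[of 0] by (simp add: obZ)
    have bZ0: "boundaries Z 0 = ?K" by (auto simp: boundaries_def obZ difZ restr_def image_iff)
    let ?C = "cycles W 0"
    have sC: "submodule (ob W 0) ?C"
      unfolding cycles_def using kernel_submodule[OF fW fW dW[of 0]] by simp
    note fC = sub_fdm[OF fW sC]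
    let ?q = "\<lambda>w. p (restr ?C (t 0) w)"
    have q: "?q \<in> homs (submod (ob W 0) ?C) X" by (rule hom_comp[OF restr_hom[OF t0 sC] Q(3)])
    have qim: "?q ` car (submod (ob W 0) ?C) = car X"
    proof (intro equalityI subsetI)
      fix x assume "x \<in> car X"
      then obtain y where y: "y \<in> car Q" "x = p y" using Q(4) by blast
      then have "y \<in> cycles Z 0" by (simp add: cycles_def kernel_in obZ difZ)
      then obtain w where w: "w \<in> ?C" "y - t 0 w \<in> ?K" using tsur bZ0 by blast
      have "t 0 w \<in> car Q" by (rule hom_in[OF t0 sub_in[OF sC w(1)]])
      then have "p y = p (t 0 w)" using w(2) hom_diff[OF Q(1,3) y(1)] by (simp add: kernel_in)
      then show "x \<in> ?q ` car (submod (ob W 0) ?C)" using w(1) y(2) by (auto simp: restr_def image_iff)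
    qed (use hom_in[OF q] in auto)
    obtain u where u: "u \<in> homs Q (submod (ob W 0) ?C)" "\<And>x. x \<in> car Q \<Longrightarrow> ?q (u x) = p x"
      by (rule proj_lift[OF Q(2) fC X q qim Q(3)]) blast
    have uC: "u x \<in> ?C" for x using hom_in_all[OF u(1) fC] by simp
    have u0: "u \<in> homs Q (ob W 0)" using u(1) hom_sub_cod[OF sub_le[OF sC]] by blast
    have tu: "t 0 (u x) \<in> car Q" if "x \<in> car Q" for x using hom_in[OF t0 hom_in[OF u0 that]] .
    have diffK: "x - t 0 (u x) \<in> ?K" if "x \<in> car Q" for x
      using u(2)[OF that] uC[of x] hom_diff[OF Q(1,3) that tu[OF that]] mod_diff[OF Q(1) that tu[OF that]]
      by (simp add: kernel_in restr_def)
    let ?h0 = "\<lambda>x. restr (car Q) (\<lambda>x. x) x - t 0 (u x)"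
    have h0: "?h0 \<in> homs Q (submod Q ?K)"
      using hom_minus[OF Q(1) id_hom[OF Q(1)] hom_comp[OF u0 t0]] diffK
      by (subst hom_sub_cod[OF sub_le[OF K(1)]]) (auto simp: restr_def)
    have "(\<lambda>x. k 0 (u x) + h (?h0 x)) \<in> homs Q Y"
      by (rule hom_plus[OF Y hom_comp[OF u0 k0] hom_comp[OF h0 h]])
    moreover have "k 0 (u y) + h (?h0 y) = h y" if y: "y \<in> ?K" for y
    proof -
      have yQ: "y \<in> car Q" using y by (simp add: kernel_in)
      have tuK: "t 0 (u y) \<in> ?K"
      proof -
        have "y - (y - t 0 (u y)) \<in> ?K" by (rule sub_diff[OF Q(1) K(1) y diffK[OF yQ]])
        then show ?thesis by simp
      qed
      then have "u y \<in> boundaries W 0" using tinj[OF uC] bZ0 by simp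
      then obtain w where w: "w \<in> car (ob W (-1))" "u y = dif W (-1) w" by (auto simp: boundaries_def)
      have tw: "t (-1) w \<in> ?K" using hom_in[OF thom w(1)] by (simp add: obZ)
      have "t 0 (u y) = t (-1) w" using tdif[OF w(1)] w(2) tw by (simp add: difZ restr_def)
      then have "k 0 (u y) = h (t 0 (u y))" using hk[OF w(1)] w(2) by simp
      moreover have "h (y - t 0 (u y)) = h y - h (t 0 (u y))"
        using hom_diff[OF K(2) h] y tuK by simp
      ultimately show ?thesis using yQ by (simp add: restr_def)
    qed
    ultimately show "\<exists>H\<in>homs Q Y. \<forall>x\<in>?K. H x = h x"
      by (intro bexI[of _ "\<lambda>x. k 0 (u x) + h (?h0 x)"] ballI)
  qed
  then show ?thesis by (rule Ext0I[OF X Y p])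
qed

lemma stalk_bounded: "fdm X \<Longrightarrow> bounded_complex sc (stalk X)"
proof -
  assume X: "fdm X"
  have "{i. car (ob (stalk X) i) \<noteq> {0}} \<subseteq> {0}" by (auto simp: stalk_def)
  moreover have f: "fdm (ob (stalk X) i)" for i using X zero_sub[OF X] by (simp add: stalk_def)
  moreover have "dif (stalk X) i = (\<lambda>x. 0)" for i by (simp add: stalk_def)
  ultimately show ?thesis unfolding bounded_complex_def
    by (auto intro: finite_subset simp: hom_zero)
qed

lemma shift_bounded:
  assumes X: "bounded_complex sc X" shows "bounded_complex sc (shift X 1)"
proof -
  have "{i. car (ob X (i + 1)) \<noteq> {0}} = (\<lambda>i. i - 1) ` {i. car (ob X i) \<noteq> {0}}"
    by (force simp: image_iff)
  then have fin: "finite {i. car (ob X (i + 1)) \<noteq> {0}}" using X by (simp add: bounded_complex_def)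
  have hd: "(\<lambda>x. - dif X i x) \<in> homs (ob X i) (ob X (i + 1))" for i
    using hom_minus[OF _ hom_zero, of "ob X (i + 1)" "dif X i" "ob X i"] X by (simp add: bounded_complex_def)
  have dd: "dif X (i + 1) (- dif X i x) = 0" if "x \<in> car (ob X i)" for i x
  proof -
    have "dif X i x \<in> car (ob X (i + 1))" using X that hom_in unfolding bounded_complex_def by blast
    then have "dif X (i + 1) (- dif X i x) = - dif X (i + 1) (dif X i x)"
      using X hom_neg[of "ob X (i + 1)" "dif X (i + 1)"] unfolding bounded_complex_def by blast
    then show ?thesis using X that by (simp add: bounded_complex_def)
  qed
  have "dif X (i + 2) (- dif X (i + 1) x) = 0" if "x \<in> car (ob X (i + 1))" for i x
    using dd[OF that] by (simp add: add.assoc)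
  moreover have "(\<lambda>x. - dif X (i + 1) x) \<in> homs (ob X (i + 1)) (ob X (i + 2))" for i
    using hd[of "i + 1"] by (simp add: add.assoc)
  ultimately show ?thesis using X fin
    unfolding bounded_complex_def shift_def by (simp add: add.commute add.left_commute)
qed

lemma id_quasi_iso:
  assumes X: "bounded_complex sc X" shows "quasi_iso X X (\<lambda>i. restr (car (ob X i)) (\<lambda>x. x))"
proof -
  have f: "fdm (ob X i)" and d: "dif X i \<in> homs (ob X i) (ob X (i + 1))" for i
    using X by (auto simp: bounded_complex_def)
  have b0: "0 \<in> boundaries X i" for i
    using mod_0[OF f, of "i - 1"] hom_0[OF d, of "i - 1"] unfolding boundaries_def by (metis imageI)
  have "\<exists>x\<in>cycles X i. y - restr (car (ob X i)) (\<lambda>x. x) x \<in> boundaries X i" if "y \<in> cycles X i" for i y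
    using that b0[of i] by (intro bexI[of _ y]) (auto simp: restr_def cycles_def kernel_in)
  then show ?thesis unfolding quasi_iso_def chain_map_def
    using id_hom[OF f] hom_in[OF d] by (auto simp: restr_def cycles_def kernel_in)
qed

lemma ext1_D_zero_shift:
  fixes X :: "('k, 'a) umod"
  assumes X: "fdm X" and ext: "ext1_D_zero sc (shift (stalk (P i)) 1) (stalk X)"
  shows "homs (P i) X = {0}"
proof -
  let ?Z = "shift (stalk (P i)) 1" and ?Y = "shift (stalk X) 1"
  have bZ: "bounded_complex sc ?Z" by (rule shift_bounded[OF stalk_bounded[OF fdP]])
  have obZ: "ob ?Z (-1) = P i" "j \<noteq> -1 \<Longrightarrow> ob ?Z j = submod (P i) {0}" for j
    by (auto simp: shift_def stalk_def)
  have obY: "ob ?Y (-1) = X" "j \<noteq> -1 \<Longrightarrow> ob ?Y j = submod X {0}" for j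
    by (auto simp: shift_def stalk_def)
  have dif: "dif ?Z j x = 0" "dif ?Y j x' = 0" for j x x' by (simp_all add: shift_def stalk_def)
  have "f = 0" if f: "f \<in> homs (P i) X" for f
  proof -
    define g where "g j = (if j = -1 then f else (\<lambda>x. 0))" for j :: int
    have "g j \<in> homs (ob ?Z j) (ob ?Y j)" for j
      using f hom_zero[OF zero_sub[OF X]] by (cases "j = -1") (auto simp: g_def obZ obY)
    moreover have "g j 0 = 0" for j using hom_0[OF f] by (simp add: g_def)
    ultimately have "chain_map ?Z ?Y g" by (simp add: chain_map_def dif)
    then obtain W :: "('k, 'a) ucpx" and t where W: "bounded_complex sc W" and t: "quasi_iso W ?Z t"
      and nh: "null_homotopic W ?Y (\<lambda>i x. g i (t i x))"
      using ext bZ id_quasi_iso[OF bZ] unfolding ext1_D_zero_def hom_D_zero_def by blast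
    obtain k where k: "\<And>i. k i \<in> homs (ob W i) (ob ?Y (i - 1))"
      "\<And>i x. x \<in> car (ob W i) \<Longrightarrow> g i (t i x) = dif ?Y (i - 1) (k i x) + k (i + 1) (dif W i x)"
      using nh by (auto simp: null_homotopic_def)
    have "f x = 0" if x: "x \<in> car (P i)" for x
    proof -
      have "x \<in> cycles ?Z (-1)" using x by (simp add: cycles_def kernel_in obZ dif)
      then obtain w where w: "w \<in> cycles W (-1)" "x - t (-1) w \<in> boundaries ?Z (-1)"
        using t unfolding quasi_iso_def by blast
      have "x = t (-1) w" using w(2) by (auto simp: boundaries_def dif)
      moreover have "g (-1) (t (-1) w) = k 0 (dif W (-1) w)"
        using k(2)[of w "-1"] w(1) by (simp add: dif cycles_def kernel_in)
      moreover have "dif W (-1) w = 0" using w(1) by (simp add: cycles_def kernel_in)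
      ultimately show ?thesis using hom_0[OF k(1)[of 0]] by (simp add: g_def)
    qed
    then have "f x = 0" for x using hom_out[OF f] by (cases "x \<in> car (P i)") auto
    then show "f = 0" by (simp add: fun_eq_iff)
  qed
  then show ?thesis using hom_zero'[OF X] by blast
qed

lemma iso_D_refl: "bounded_complex sc X \<Longrightarrow> iso_D sc X X"
  unfolding iso_D_def using id_quasi_iso by blast

lemma iso_D_stalk:
  fixes X Y :: "('k, 'a) umod"
  assumes X: "fdm X" and Y: "fdm Y" and "iso X Y" shows "iso_D sc (stalk X) (stalk Y)"
proof -
  obtain f where f: "f \<in> homs X Y" "bij_betw f (car X) (car Y)" using assms by (auto simp: iso_def)
  have im: "f ` car X = car Y" and ker: "kernel X f = {0}"
    using f inj_kernel[OF X f(1)] by (auto simp: bij_betw_def)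
  define g where "g i = (if i = 0 then f else (\<lambda>x. 0))" for i :: int
  have bd: "boundaries (stalk X) i = {0}" "boundaries (stalk Y) i = {0}" for i
    using mod_0[OF X] mod_0[OF Y] by (auto simp: boundaries_def stalk_def)
  have cy: "cycles (stalk X) i = (if i = 0 then car X else {0})" "cycles (stalk Y) i = (if i = 0 then car Y else {0})" for i
    by (auto simp: cycles_def kernel_in stalk_def)
  have "chain_map (stalk X) (stalk Y) g"
    using f(1) hom_zero[OF zero_sub[OF Y]] hom_0[OF f(1)] by (auto simp: chain_map_def g_def stalk_def)
  moreover have "x \<in> cycles (stalk X) i \<Longrightarrow> g i x = 0 \<Longrightarrow> x = 0" for i x
    using ker by (cases "i = 0") (auto simp: cy g_def kernel_def)
  moreover have "\<exists>x\<in>cycles (stalk X) i. y - g i x = 0" if "y \<in> cycles (stalk Y) i" for i y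
  proof (cases "i = 0")
    case True
    then have "y \<in> f ` car X" using that im by (simp add: cy)
    then show ?thesis using True by (auto simp: cy g_def)
  qed (use that in \<open>auto simp: cy g_def\<close>)
  ultimately have "quasi_iso (stalk X) (stalk Y) g" unfolding quasi_iso_def bd by auto
  then show ?thesis unfolding iso_D_def
    using stalk_bounded[OF X] id_quasi_iso[OF stalk_bounded[OF X]] by blast
qed

section \<open>Exceptional objects\<close>

text \<open>
  If \<open>h\<close> represents a nonzero class of \<open>Ext\<^sup>1(X, X)\<close>, its multiples by the division algebra \<open>End(X)\<close> span a
  subspace of dimension \<open>hom(X, X)\<close>, which makes the Euler form nonpositive.
\<close>

lemma division_rigid:
  assumes X: "fdm X" "division X" and pos: "g_module sc S P X \<bullet> dv X > 0"
  shows "Ext0 X X"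
proof (rule ccontr)
  assume ne: "\<not> Ext0 X X"
  obtain m p where p: "proj_epi (dsum P m) p X"
    and g: "g_module sc S P X \<bullet> dv X = real (hom_dim (dsum P m) X) - real (hom_dim (submod (dsum P m) (kernel (dsum P m) p)) X)"
    by (rule euler_resolution[OF X(1,1)])
  let ?Q = "dsum P m" and ?K = "kernel (dsum P m) p"
  note Q = proj_epiD[OF p] and K = proj_epi_kernel[OF p X(1)]
  have "\<not> extends ?Q ?K X" using ne Ext0I[OF X(1,1) p] by blast
  then obtain h where h: "h \<in> homs (submod ?Q ?K) X" and nh: "\<And>H. H \<in> homs ?Q X \<Longrightarrow> \<exists>x\<in>?K. H x \<noteq> h x"
    unfolding extends_def by blast
  let ?U = "restr ?K ` homs ?Q X" and ?V = "(\<lambda>\<phi> x. \<phi> (h x)) ` homs X X"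
  note U = hom_dim_restrict[OF Q(1) X(1,1) Q(3,4)]
  have comp0: "\<phi> = 0" if \<phi>: "\<phi> \<in> homs X X" "\<And>x. x \<in> ?K \<Longrightarrow> \<phi> (h x) = H x" "H \<in> homs ?Q X" for \<phi> H
  proof (rule ccontr)
    assume "\<phi> \<noteq> 0"
    then obtain \<psi> where \<psi>: "\<psi> \<in> homs X X" "\<And>x. x \<in> car X \<Longrightarrow> \<psi> (\<phi> x) = x"
      by (rule divisionE[OF X(2) \<phi>(1)]) blast
    have "\<psi> (H x) = h x" if x: "x \<in> ?K" for x
      using \<psi>(2)[of "h x"] hom_in[OF h] \<phi>(2)[OF x] x by simp
    then show False using nh[OF hom_comp[OF \<phi>(3) \<psi>(1)]] by blast
  qed
  have V: "vector_space.dim (hscl X) ?V = hom_dim X X"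
  proof (rule hom_rank_inj[OF X(1,1,1)])
    fix \<phi> assume "\<phi> \<in> homs X X" "(\<lambda>x. \<phi> (h x)) = 0"
    then show "\<phi> = 0" by (intro comp0[OF _ _ hom_zero[OF X(1)]]) (simp_all add: fun_eq_iff)
  qed (auto simp: fun_eq_iff)
  have Vf: "fin_sub (hscl X) ?V" by (rule hom_rank(2)[OF X(1,1,1)]) (auto simp: fun_eq_iff)
  have UV: "?U \<inter> ?V = {0}"
  proof (intro equalityI subsetI)
    fix v assume "v \<in> ?U \<inter> ?V"
    then obtain H \<phi> where v: "H \<in> homs ?Q X" "v = restr ?K H" "\<phi> \<in> homs X X" "v = (\<lambda>x. \<phi> (h x))" by blast
    have "\<phi> (h x) = H x" if "x \<in> ?K" for x using fun_cong[OF v(4), of x] v(2) that by (simp add: restr_def)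
    then have "\<phi> = 0" using comp0 v by blast
    then show "v \<in> {0}" using v(4) by (simp add: fun_eq_iff)
  next
    fix v
    show "v \<in> ?U \<inter> ?V" if "v \<in> {0}" for v
      using that module.subspace_0[OF vs_module[OF hom_vs[OF X(1)]] fin_sub_subspace[OF U(2)]]
        module.subspace_0[OF vs_module[OF hom_vs[OF X(1)]] fin_sub_subspace[OF Vf]] by simp
  qed
  have "vector_space.dim (hscl X) ?U + vector_space.dim (hscl X) ?V \<le> vector_space.dim (hscl X) (homs (submod ?Q ?K) X)"
    by (rule fin_sub_dim_disjoint[OF hom_fin[OF K(2) X(1)] fin_sub_subspace[OF U(2)] _ fin_sub_subspace[OF Vf] _ UV])
      (use restr_hom[OF _ K(1)] hom_comp[OF h] in auto)
  then have "hom_dim ?Q X \<le> hom_dim (submod ?Q ?K) X"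
    using U(1) V by (simp add: hom_dim_def)
  then show False using g pos by simp
qed

definition perp :: "('k, 'a, 'n) cobj \<Rightarrow> ('k, 'a, 'm::ab_group_add) rmod \<Rightarrow> bool" where
  "perp t X \<longleftrightarrow> (case t of Mod Y \<Rightarrow> homs Y X = {0} \<and> Ext0 Y X | Sh i \<Rightarrow> homs (P i) X = {0})"

definition tvec :: "('k, 'a, 'n) cobj \<Rightarrow> real ^ 'n" where
  "tvec t = (case t of Mod X \<Rightarrow> dv X | Sh i \<Rightarrow> - dv (P i))"

lemma g_vec_tvec: "exceptional_object sc t \<Longrightarrow> g_vec sc S P t \<bullet> y = form (tvec t) y"
  by (simp add: g_vec_form tvec_def)

lemma form_Mod: "fdm X \<Longrightarrow> form (tvec (Mod X)) y = g_module sc S P X \<bullet> y"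
  by (simp add: tvec_def form_module)

lemma form_Sh: "fdm X \<Longrightarrow> form (tvec (Sh i)) (dv X) = - real (hom_dim (P i) X)"
  by (simp add: tvec_def form_P hom_dim_dv)

lemma perp_form:
  assumes "exceptional_object sc t" "fdm X" "perp t X" shows "form (tvec t) (dv X) = 0"
proof (cases t)
  case (Mod Y)
  then have Y: "fdm Y" "hom_dim Y X = 0" "Ext0 Y X" using assms hom_dim_0[of Y X] by (auto simp: perp_def)
  then show ?thesis using euler_form(2)[OF Y(1) assms(2)] form_Mod Mod by simp
next
  case (Sh i)
  then show ?thesis using assms hom_dim_0[OF fdP assms(2), of i] form_Sh[OF assms(2)] by (simp add: perp_def)
qed

lemma perp_iso:
  assumes t: "exceptional_object sc t" and X: "fdm X" and Y: "fdm Y" and i: "iso X Y" and p: "perp t X"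
  shows "perp t Y"
proof (cases t)
  case (Mod Z)
  then have Z: "fdm Z" "homs Z X = {0}" "Ext0 Z X" using t p by (auto simp: perp_def)
  then have "homs Z Y = {0}" using hom_dim_iso2[OF Z(1) X Y i] hom_dim_0[OF Z(1) X] hom_dim_0[OF Z(1) Y] by simp
  then show ?thesis using Ext0_iso2[OF Z(1) X Y i Z(3)] Mod by (simp add: perp_def)
next
  case (Sh j)
  then show ?thesis using p hom_dim_iso2[OF fdP X Y i, of j] hom_dim_0[OF fdP X, of j] hom_dim_0[OF fdP Y, of j]
    by (simp add: perp_def)
qed

lemma homs_sub_zero:
  assumes "fdm Y" "submodule Y N" "homs X Y = {0}" shows "homs X (submod Y N) = {0}"
  using assms hom_sub_cod[OF sub_le[OF assms(2)]] hom_zero'[OF sub_fdm[OF assms(1,2)], of X] by blast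

lemma perp_image:
  assumes t: "exceptional_object sc t" and X: "fdm X" and Y: "fdm Y" and f: "f \<in> homs X Y"
    and pX: "perp t X" and pY: "perp t Y"
  shows "perp t (submod Y (f ` car X))"
proof -
  have s: "submodule Y (f ` car X)" by (rule image_submodule[OF X f submodule_car[OF X]])
  have fI: "f \<in> homs X (submod Y (f ` car X))" using hom_sub_cod[OF sub_le[OF s]] f by blast
  show ?thesis
  proof (cases t)
    case (Mod Z)
    then have Z: "fdm Z" "homs Z Y = {0}" "Ext0 Z X" using t pX pY by (auto simp: perp_def)
    have "Ext0 Z (submod Y (f ` car X))"
      by (rule Ext0_quotient[OF Z(1) X sub_fdm[OF Y s] Z(3) fI]) simp
    then show ?thesis using homs_sub_zero[OF Y s Z(2)] Mod by (simp add: perp_def)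
  next
    case (Sh i)
    then show ?thesis using pY homs_sub_zero[OF Y s] by (simp add: perp_def)
  qed
qed

lemma perp_quotient:
  assumes t: "exceptional_object sc t" and Y: "fdm Y" and Z: "fdm Z" and q: "q \<in> homs Y Z" "q ` car Y = car Z"
    and pY: "perp t Y" and pK: "perp t (submod Y (kernel Y q))"
  shows "perp t Z"
proof -
  have k: "fdm (submod Y (kernel Y q))" by (rule sub_fdm[OF Y kernel_submodule[OF Y Z q(1)]])
  have "form (tvec t) (dv Y) = form (tvec t) (dv (submod Y (kernel Y q))) + form (tvec t) (dv Z)"
    unfolding dv_exact[OF Y Z q] by (rule bounded_bilinear.add_right[OF form_bilinear])
  then have f0: "form (tvec t) (dv Z) = 0" using perp_form[OF t Y pY] perp_form[OF t k pK] by simp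
  show ?thesis
  proof (cases t)
    case (Mod X)
    then have X: "fdm X" "Ext0 X Y" using t pY by (auto simp: perp_def)
    have e: "Ext0 X Z" by (rule Ext0_quotient[OF X(1) Y Z X(2) q])
    then have "hom_dim X Z = 0" using euler_form(2)[OF X(1) Z] f0 form_Mod[OF X(1)] Mod by simp
    then show ?thesis using e Mod hom_dim_0[OF X(1) Z] by (simp add: perp_def)
  next
    case (Sh i)
    then show ?thesis using f0 form_Sh[OF Z] hom_dim_0[OF fdP Z] by (simp add: perp_def)
  qed
qed

section \<open>Cluster tilting objects\<close>

lemma exceptional_division: "exceptional sc X \<Longrightarrow> division X"
  by (simp add: exceptional_def division_def)

context
  fixes T :: "'n \<Rightarrow> ('k, 'a, 'n) cobj"
  assumes ct: "cluster_tilting sc P T"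
begin

lemma exc: "exceptional_object sc (T i)"
  using ct by (simp add: cluster_tilting_def)

lemma Mod_facts:
  assumes "T i = Mod X" shows "fdm X" "division X" "car X \<noteq> {0}"
  using exc[of i] assms exceptional_division by (auto simp: exceptional_def)

lemma Mod_Ext0: "T i = Mod X \<Longrightarrow> T j = Mod Y \<Longrightarrow> Ext0 X Y"
  using ct Mod_facts by (intro ext1_D_zero_Ext0) (auto simp: cluster_tilting_def, metis complex_of.simps(1))

lemma Mod_iso: "T i = Mod X \<Longrightarrow> T j = Mod Y \<Longrightarrow> iso X Y \<Longrightarrow> i = j"
  using ct Mod_facts iso_D_stalk[of X Y] unfolding cluster_tilting_def by (metis complex_of.simps(1))

lemma Sh_inj: "T i = Sh a \<Longrightarrow> T j = Sh a \<Longrightarrow> i = j"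
  using ct iso_D_refl[OF shift_bounded[OF stalk_bounded[OF fdP]]]
  unfolding cluster_tilting_def by (metis complex_of.simps(2))

lemma Sh_Mod: "T i = Sh a \<Longrightarrow> T j = Mod X \<Longrightarrow> homs (P a) X = {0}"
  using ct Mod_facts unfolding cluster_tilting_def
  by (intro ext1_D_zero_shift) (auto, metis complex_of.simps)

lemma form_Mod_Mod: "T i = Mod X \<Longrightarrow> T j = Mod Y \<Longrightarrow> form (tvec (T i)) (tvec (T j)) = real (hom_dim X Y)"
  using euler_form(2)[of X Y] Mod_Ext0[of i X j Y] Mod_facts form_Mod[of X] by (simp add: tvec_def form_module)

lemma form_Sh_Mod: "T i = Sh a \<Longrightarrow> T j = Mod Y \<Longrightarrow> form (tvec (T i)) (tvec (T j)) = 0"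
  using form_Sh[of Y a] Sh_Mod[of i a j Y] Mod_facts(1)[of j Y] hom_dim_0[OF fdP, of Y a] by (simp add: tvec_def)

lemma form_Sh_Sh: "T i = Sh a \<Longrightarrow> T j = Sh b \<Longrightarrow> form (tvec (T i)) (tvec (T j)) = real (hom_dim (P a) (P b))"
  by (simp add: tvec_def form_P hom_dim_dv[OF fdP])

lemma gram_pos: "form (tvec (T i)) (tvec (T i)) > 0"
proof (cases "T i")
  case (Mod X)
  note X = Mod_facts[OF Mod]
  obtain x where "x \<in> car X" "x \<noteq> 0" using X(3) mod_0[OF X(1)] by blast
  then have "restr (car X) (\<lambda>x. x) x \<noteq> 0" by (simp add: restr_def)
  then have "restr (car X) (\<lambda>x. x) \<noteq> 0" by (metis zero_fun_apply)
  then show ?thesis using form_Mod_Mod[OF Mod Mod] hom_dim_pos[OF X(1,1) id_hom[OF X(1)]] by simp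
next
  case (Sh a)
  then show ?thesis using form_Sh_Sh P_hom_self by simp
qed

definition proper_mono :: "('k, 'a) umod \<Rightarrow> ('k, 'a) umod \<Rightarrow> bool" where
  "proper_mono X Y \<longleftrightarrow> (\<exists>f\<in>homs X Y. kernel X f = {0} \<and> f ` car X \<noteq> car Y)"

lemma proper_mono_kdim:
  assumes X: "fdm X" and Y: "fdm Y" and "proper_mono X Y" shows "kdim X < kdim Y"
proof -
  obtain f where f: "f \<in> homs X Y" "kernel X f = {0}" "f ` car X \<noteq> car Y"
    using assms by (auto simp: proper_mono_def)
  have s: "submodule Y (f ` car X)" by (rule image_submodule[OF X f(1) submodule_car[OF X]])
  have "kdim X = kdim (submod Y (f ` car X))"
    using kdim_image[OF X Y f(1)] f(2) kdim_0[OF zero_sub[OF X]] by simp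
  then show ?thesis using kdim_sub[OF Y s] f(3) by linarith
qed

lemma Mod_hom_cases:
  assumes i: "T i = Mod X" and j: "T j = Mod Y" and "i \<noteq> j" and f: "f \<in> homs X Y" "f \<noteq> 0"
  shows "proper_mono X Y \<or> (f ` car X = car Y \<and> kernel X f \<noteq> {0} \<and> kdim Y < kdim X)"
proof -
  note X = Mod_facts[OF i] and Y = Mod_facts[OF j]
  have me: "kernel X f = {0} \<or> f ` car X = car Y"
    by (rule mono_or_epi[OF X(1,2) Y(1,2) Mod_Ext0[OF j i] f])
  have "\<not> (kernel X f = {0} \<and> f ` car X = car Y)"
  proof
    assume a: "kernel X f = {0} \<and> f ` car X = car Y"
    then have "iso X Y" using hom_injD[OF X(1) f(1)] f(1) by (auto simp: iso_def bij_betw_def)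
    then show False using Mod_iso[OF i j] \<open>i \<noteq> j\<close> by blast
  qed
  moreover have "kdim Y < kdim X" if "f ` car X = car Y" "kernel X f \<noteq> {0}"
  proof -
    have "kdim (submod X (kernel X f)) \<noteq> 0"
      using kdim_0[OF sub_fdm[OF X(1) kernel_submodule[OF X(1) Y(1) f(1)]]] that(2) by simp
    then show ?thesis using kdim_exact[OF X(1) Y(1) f(1) that(1)] by simp
  qed
  ultimately show ?thesis
    using me f(1) unfolding proper_mono_def by (cases "kernel X f = {0}") auto
qed

lemma epi_mono_impossible:
  assumes l: "T l = Mod X" and i: "T i = Mod Y" and j: "T j = Mod Z"
    and e: "e \<in> homs X Y" "e \<noteq> 0" "kernel X e \<noteq> {0}" and m: "proper_mono Y Z"
  shows False
proof -
  note X = Mod_facts[OF l] and Y = Mod_facts[OF i] and Z = Mod_facts[OF j]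
  obtain f where f: "f \<in> homs Y Z" "kernel Y f = {0}" "f ` car Y \<noteq> car Z"
    using m by (auto simp: proper_mono_def)
  have c: "(\<lambda>x. f (e x)) \<in> homs X Z" by (rule hom_comp[OF e(1) f(1)])
  have f0: "f y = 0 \<Longrightarrow> y \<in> car Y \<Longrightarrow> y = 0" for y using f(2) by (auto simp: kernel_def)
  have "(\<lambda>x. f (e x)) \<noteq> 0"
  proof
    assume "(\<lambda>x. f (e x)) = 0"
    then have "e x = 0" for x using f0 hom_in_all[OF e(1) Y(1), of x] by (simp add: fun_eq_iff)
    then show False using e(2) by (simp add: fun_eq_iff)
  qed
  then have "kernel X (\<lambda>x. f (e x)) = {0} \<or> (\<lambda>x. f (e x)) ` car X = car Z"
    by (rule mono_or_epi[OF X(1,2) Z(1,2) Mod_Ext0[OF j l] c])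
  moreover have "kernel X e \<subseteq> kernel X (\<lambda>x. f (e x))" using hom_0[OF f(1)] by (auto simp: kernel_def)
  then have "kernel X (\<lambda>x. f (e x)) \<noteq> {0}"
    using e(3) mod_0[OF X(1)] hom_0[OF e(1)] by (auto simp: kernel_in)
  moreover have "(\<lambda>x. f (e x)) ` car X \<subseteq> f ` car Y" using hom_in[OF e(1)] by auto
  then have "(\<lambda>x. f (e x)) ` car X \<noteq> car Z" using f(1,3) hom_in[OF f(1)] by blast
  ultimately show False by blast
qed

definition arrows :: "('n \<times> 'n) set" where
  "arrows = {(i, j). i \<noteq> j \<and> form (tvec (T i)) (tvec (T j)) \<noteq> 0}"

text \<open>
  An epimorphism followed by a monomorphism, both proper, composes to a nonzero map that is neither,
  against the Happel--Ringel lemma.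
  So if every member of \<open>A\<close> had a predecessor in \<open>A\<close>, dimensions would strictly decrease forever
  against the arrows from the target of any monomorphism on, or increase forever if there is none.
\<close>

lemma Mod_source:
  assumes ne: "A \<noteq> {}" and A: "\<And>i. i \<in> A \<Longrightarrow> \<exists>X. T i = Mod X"
  shows "\<exists>z\<in>A. \<forall>y\<in>A. (y, z) \<notin> arrows"
proof (rule ccontr)
  assume "\<not> ?thesis"
  then have pred: "\<exists>i\<in>A. (i, j) \<in> arrows" if "j \<in> A" for j using that by blast
  define md where "md i = (case T i of Mod X \<Rightarrow> X | Sh _ \<Rightarrow> undefined)" for i
  have T: "T i = Mod (md i)" if "i \<in> A" for i using A[OF that] by (auto simp: md_def)
  have predE: "\<exists>i\<in>A. \<exists>f\<in>homs (md i) (md j). i \<noteq> j \<and> f \<noteq> 0" if j: "j \<in> A" for j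
  proof -
    obtain i where i: "i \<in> A" "i \<noteq> j" "form (tvec (T i)) (tvec (T j)) \<noteq> 0"
      using pred[OF j] by (auto simp: arrows_def)
    then have "hom_dim (md i) (md j) > 0" using form_Mod_Mod[OF T[OF i(1)] T[OF j]] by simp
    then obtain f where "f \<in> homs (md i) (md j)" "f \<noteq> 0"
      by (rule hom_dim_posE[OF Mod_facts(1)[OF T[OF i(1)]] Mod_facts(1)[OF T[OF j]]])
    then show ?thesis using i by blast
  qed
  define B where "B = {j\<in>A. \<exists>i\<in>A. proper_mono (md i) (md j)}"
  have finA: "finite A" by (rule finite_subset[OF subset_UNIV]) simp
  show False
  proof (cases "B = {}")
    case True
    let ?M = "Max ((\<lambda>i. kdim (md i)) ` A)"
    have "?M \<in> (\<lambda>i. kdim (md i)) ` A" using ne finA by (intro Max_in) auto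
    then obtain j where j: "j \<in> A" "kdim (md j) = ?M" by auto
    obtain i f where i: "i \<in> A" "f \<in> homs (md i) (md j)" "i \<noteq> j" "f \<noteq> 0" using predE[OF j(1)] by blast
    have "\<not> proper_mono (md i) (md j)" using True j(1) i(1) by (auto simp: B_def)
    then have "kdim (md j) < kdim (md i)"
      using Mod_hom_cases[OF T[OF i(1)] T[OF j(1)] i(3,2,4)] by blast
    moreover have "kdim (md i) \<le> kdim (md j)" unfolding j(2) using i(1) finA by (intro Max_ge) auto
    ultimately show False by simp
  next
    case False
    then obtain j0 where "j0 \<in> B" by blast
    from ex_has_least_nat[of "\<lambda>j. j \<in> B", OF this, of "\<lambda>j. kdim (md j)"]
    obtain j where j: "j \<in> B" "\<And>i. i \<in> B \<Longrightarrow> kdim (md j) \<le> kdim (md i)" by blast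
    obtain i where i: "i \<in> A" "proper_mono (md i) (md j)" using j(1) by (auto simp: B_def)
    have jA: "j \<in> A" using j(1) by (simp add: B_def)
    obtain l e where l: "l \<in> A" "e \<in> homs (md l) (md i)" "l \<noteq> i" "e \<noteq> 0" using predE[OF i(1)] by blast
    have "kernel (md l) e = {0}"
      using epi_mono_impossible[OF T[OF l(1)] T[OF i(1)] T[OF jA] l(2,4) _ i(2)] by blast
    then have "proper_mono (md l) (md i)"
      using Mod_hom_cases[OF T[OF l(1)] T[OF i(1)] l(3,2,4)] by blast
    then have "i \<in> B" using i(1) l(1) by (auto simp: B_def)
    then have "kdim (md j) \<le> kdim (md i)" by (rule j(2))
    moreover have "kdim (md i) < kdim (md j)"
      by (rule proper_mono_kdim[OF Mod_facts(1)[OF T[OF i(1)]] Mod_facts(1)[OF T[OF jA]] i(2)])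
    ultimately show False by simp
  qed
qed

lemma arrows_wf: "wf arrows"
  unfolding wf_eq_minimal
proof (intro allI impI)
  fix A and x :: 'n assume x: "x \<in> A"
  let ?AM = "{i\<in>A. \<exists>X. T i = Mod X}"
  show "\<exists>z\<in>A. \<forall>y. (y, z) \<in> arrows \<longrightarrow> y \<notin> A"
  proof (cases "?AM = {}")
    case False
    then obtain z where z: "z \<in> ?AM" "\<forall>y\<in>?AM. (y, z) \<notin> arrows" using Mod_source[of ?AM] by blast
    have "y \<notin> A" if y: "(y, z) \<in> arrows" for y
    proof
      assume yA: "y \<in> A"
      obtain X where X: "T z = Mod X" using z(1) by blast
      show False
      proof (cases "T y")
        case (Mod Y)
        then show False using z(2) yA y by blast
      next
        case (Sh a)
        then show False using form_Sh_Mod[OF Sh X] y by (simp add: arrows_def)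
      qed
    qed
    then show ?thesis using z(1) by blast
  next
    case True
    then have Sh: "\<exists>a. T i = Sh a" if "i \<in> A" for i using that by (cases "T i") auto
    define pd where "pd i = (case T i of Mod _ \<Rightarrow> 0 | Sh a \<Rightarrow> kdim (P a))" for i
    from ex_has_least_nat[of "\<lambda>i. i \<in> A", OF x, of pd]
    obtain z where z: "z \<in> A" "\<And>y. y \<in> A \<Longrightarrow> pd z \<le> pd y" by blast
    have "y \<notin> A" if y: "(y, z) \<in> arrows" for y
    proof
      assume yA: "y \<in> A"
      obtain a b where ab: "T y = Sh a" "T z = Sh b" using Sh z(1) yA by blast
      have "y \<noteq> z" and "hom_dim (P a) (P b) > 0" using y form_Sh_Sh[OF ab] by (auto simp: arrows_def)
      then have "a \<noteq> b" using Sh_inj ab by blast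
      obtain f where "f \<in> homs (P a) (P b)" "f \<noteq> 0"
        by (rule hom_dim_posE[OF fdP fdP \<open>hom_dim (P a) (P b) > 0\<close>])
      then have "kdim (P a) < kdim (P b)" by (rule P_hom_kdim[OF \<open>a \<noteq> b\<close>])
      then show False using z(2)[OF yA] ab by (simp add: pd_def)
    qed
    then show ?thesis using z(1) by blast
  qed
qed

lemma form_nondegenerate: "(\<And>j. form (tvec (T j)) y = 0) \<Longrightarrow> y = 0"
  using triangular_gram(1)[OF form_bilinear arrows_wf[unfolded arrows_def] gram_pos] by blast

lemma form_positive: "(\<And>j. j \<noteq> k \<Longrightarrow> form (tvec (T j)) d = 0) \<Longrightarrow> d \<noteq> 0 \<Longrightarrow> form d d > 0"
  by (rule triangular_gram(2)[OF form_bilinear arrows_wf[unfolded arrows_def] gram_pos])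

context
  fixes k :: 'n
begin

definition wide :: "('k, 'a) umod \<Rightarrow> bool" where
  "wide X \<longleftrightarrow> fdm X \<and> (\<forall>j. j \<noteq> k \<longrightarrow> perp (T j) X)"

lemma wide_fdm: "wide X \<Longrightarrow> fdm X" by (simp add: wide_def)

lemma wide_form: "wide X \<Longrightarrow> j \<noteq> k \<Longrightarrow> form (tvec (T j)) (dv X) = 0"
  by (rule perp_form[OF exc wide_fdm]) (simp_all add: wide_def)

lemma wide_form_pos:
  assumes X: "wide X" "car X \<noteq> {0}" and Y: "wide Y" "car Y \<noteq> {0}"
  shows "form (dv X) (dv Y) > 0"
proof -
  interpret form: bounded_bilinear form by (rule form_bilinear)
  let ?d = "dv X" and ?y = "dv Y"
  have d0: "?d \<noteq> 0" and y0: "?y \<noteq> 0" using dv_eq_0D wide_fdm X Y by blast+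
  let ?c = "form (tvec (T k)) ?d" and ?c' = "form (tvec (T k)) ?y"
  have c: "?c \<noteq> 0"
  proof
    assume "?c = 0"
    then have "form (tvec (T j)) ?d = 0" for j using wide_form[OF X(1)] by (cases "j = k") auto
    then show False using form_nondegenerate d0 by blast
  qed
  have c': "?c' \<noteq> 0"
  proof
    assume "?c' = 0"
    then have "form (tvec (T j)) ?y = 0" for j using wide_form[OF Y(1)] by (cases "j = k") auto
    then show False using form_nondegenerate y0 by blast
  qed
  have "?c' *\<^sub>R ?d - ?c *\<^sub>R ?y = 0"
  proof (rule form_nondegenerate)
    fix j show "form (tvec (T j)) (?c' *\<^sub>R ?d - ?c *\<^sub>R ?y) = 0"
      using wide_form[OF X(1), of j] wide_form[OF Y(1), of j]
      by (cases "j = k") (auto simp: form.diff_right form.scaleR_right)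
  qed
  then have "(1 / ?c) *\<^sub>R (?c *\<^sub>R ?y) = (1 / ?c) *\<^sub>R (?c' *\<^sub>R ?d)" by simp
  then have e: "?y = (?c' / ?c) *\<^sub>R ?d" using c by simp
  obtain i where i: "?d $ i \<noteq> 0" using d0 by (auto simp: vec_eq_iff)
  then have "?d $ i > 0" using dv_nonneg[of X i] by simp
  moreover have "(?c' / ?c) * ?d $ i \<ge> 0" using arg_cong[OF e, of "\<lambda>v. v $ i"] dv_nonneg[of Y i] by simp
  ultimately have "?c' / ?c \<ge> 0" by (metis mult_neg_pos not_le)
  then have "?c' / ?c > 0" using c c' by (simp add: less_le)
  moreover have "form ?d ?d > 0" by (rule form_positive[OF wide_form[OF X(1)] d0])
  moreover have "form ?d ?y = (?c' / ?c) * form ?d ?d" using arg_cong[OF e, of "form ?d"] by (simp add: form.scaleR_right)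
  ultimately show ?thesis by (metis mult_pos_pos)
qed

lemma wide_hom:
  assumes X: "wide X" "car X \<noteq> {0}" and Y: "wide Y" "car Y \<noteq> {0}"
  obtains f where "f \<in> homs X Y" "f \<noteq> 0"
proof -
  have "real (hom_dim X Y) > 0"
    using wide_form_pos[OF X Y] euler_form(1)[OF wide_fdm[OF X(1)] wide_fdm[OF Y(1)]] form_module[OF wide_fdm[OF X(1)]] by simp
  then have "hom_dim X Y > 0" by simp
  then show ?thesis by (rule hom_dim_posE[OF wide_fdm[OF X(1)] wide_fdm[OF Y(1)]]) (rule that)
qed

lemma wide_image:
  assumes X: "wide X" and Y: "wide Y" and f: "f \<in> homs X Y"
  shows "wide (submod Y (f ` car X))"
  using perp_image[OF exc wide_fdm[OF X] wide_fdm[OF Y] f] X Y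
    sub_fdm[OF wide_fdm[OF Y] image_submodule[OF wide_fdm[OF X] f submodule_car[OF wide_fdm[OF X]]]]
  by (simp add: wide_def)

lemma wide_quotient:
  assumes Y: "wide Y" and Z: "fdm Z" and q: "q \<in> homs Y Z" "q ` car Y = car Z"
    and K: "wide (submod Y (kernel Y q))"
  shows "wide Z"
  using perp_quotient[OF exc wide_fdm[OF Y] Z q] Y K Z by (simp add: wide_def)

lemma wide_rigid:
  assumes M: "wide M" shows "Ext0 M M"
proof (cases "car M = {0}")
  case True
  then show ?thesis using Ext0_zero wide_fdm[OF M] by blast
next
  case False
  from ex_has_least_nat[of "\<lambda>X. wide X \<and> car X \<noteq> {0}", of M kdim] M False
  obtain X where X: "wide X" "car X \<noteq> {0}" and mn: "\<And>Y. wide Y \<Longrightarrow> car Y \<noteq> {0} \<Longrightarrow> kdim X \<le> kdim Y" by blast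
  note fX = wide_fdm[OF X(1)]
  have inj: "kernel X f = {0}" and imne: "f ` car X \<noteq> {0}" if Y: "wide Y" and f: "f \<in> homs X Y" "f \<noteq> 0" for Y f
  proof -
    have s: "submodule X (kernel X f)" by (rule kernel_submodule[OF fX wide_fdm[OF Y] f(1)])
    show ne: "f ` car X \<noteq> {0}"
    proof
      assume "f ` car X = {0}"
      then have "f x = 0" for x using hom_out[OF f(1)] by (cases "x \<in> car X") auto
      then show False using f(2) by (simp add: fun_eq_iff)
    qed
    then have "kdim X \<le> kdim (submod Y (f ` car X))" using mn[OF wide_image[OF X(1) Y f(1)]] by simp
    then have "kdim (submod X (kernel X f)) = 0" using kdim_image[OF fX wide_fdm[OF Y] f(1)] by simp
    then show "kernel X f = {0}" using kdim_0[OF sub_fdm[OF fX s]] by simp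
  qed
  have "division X"
    unfolding division_def
  proof (intro ballI impI)
    fix f assume f: "f \<in> homs X X" "f \<noteq> 0"
    have k: "kernel X f = {0}" by (rule inj[OF X(1) f])
    have s: "submodule X (f ` car X)" by (rule image_submodule[OF fX f(1) submodule_car[OF fX]])
    have "kdim X = kdim (submod X (f ` car X))"
      using kdim_image[OF fX fX f(1)] k kdim_0[OF zero_sub[OF fX]] by simp
    then have "f ` car X = car X" using kdim_sub(2)[OF fX s] by simp
    then have "bij_betw f (car X) (car X)" using hom_injD[OF fX f(1) k] by (simp add: bij_betw_def)
    then obtain g where "g \<in> homs X X" "\<And>x. x \<in> car X \<Longrightarrow> g (f x) = x" "\<And>y. y \<in> car X \<Longrightarrow> f (g y) = y"
      by (rule iso_inverse[OF fX f(1)]) blast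
    then show "\<exists>g\<in>homs X X. \<forall>x\<in>car X. g (f x) = x \<and> f (g x) = x" by blast
  qed
  then have XX: "Ext0 X X"
    by (rule division_rigid[OF fX]) (use wide_form_pos[OF X X] form_module[OF fX] in simp)
  have step: "\<exists>(Z :: ('k, 'a) umod) q. wide Z \<and> q \<in> homs Y Z \<and> q ` car Y = car Z \<and> iso X (submod Y (kernel Y q)) \<and>
      fdm (submod Y (kernel Y q)) \<and> kdim Z < kdim Y"
    if Y: "wide Y" "car Y \<noteq> {0}" for Y
  proof -
    note fY = wide_fdm[OF Y(1)]
    obtain u where u: "u \<in> homs X Y" "u \<noteq> 0" by (rule wide_hom[OF X Y])
    let ?I = "u ` car X"
    have s: "submodule Y ?I" by (rule image_submodule[OF fX u(1) submodule_car[OF fX]])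
    obtain Z :: "('k, 'a) umod" and q where Z: "fdm Z" and q: "q \<in> homs Y Z" "q ` car Y = car Z" "kernel Y q = ?I"
      by (rule quotient_exists[OF fY s])
    have wI: "wide (submod Y ?I)" by (rule wide_image[OF X(1) Y(1) u(1)])
    have wZ: "wide Z" by (rule wide_quotient[OF Y(1) Z q(1,2)]) (simp add: q(3) wI)
    have "u \<in> homs X (submod Y ?I)" using hom_sub_cod[OF sub_le[OF s]] u(1) by blast
    then have "iso X (submod Y ?I)" using hom_injD[OF fX u(1) inj[OF Y(1) u]] by (auto simp: iso_def bij_betw_def)
    moreover have "kdim (submod Y ?I) \<noteq> 0" using kdim_0[OF wide_fdm[OF wI]] imne[OF Y(1) u] by simp
    then have "kdim Z < kdim Y" using kdim_exact[OF fY Z q(1,2)] q(3) by simp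
    ultimately show ?thesis using wZ q wide_fdm[OF wI] by (intro exI[of _ Z] exI[of _ q]) simp
  qed
  have XY: "Ext0 X Y" if "wide Y" for Y
    using that
  proof (induction "kdim Y" arbitrary: Y rule: less_induct)
    case less
    note fY = wide_fdm[OF less.prems]
    show ?case
    proof (cases "car Y = {0}")
      case True
      then show ?thesis using Ext0_zero fX fY by blast
    next
      case False
      obtain Z :: "('k, 'a) umod" and q where Z: "wide Z" "q \<in> homs Y Z" "q ` car Y = car Z" "iso X (submod Y (kernel Y q))"
          "fdm (submod Y (kernel Y q))" "kdim Z < kdim Y"
        using step[OF less.prems False] by blast
      show ?thesis
        by (rule Ext0_extension2[OF fX fY wide_fdm[OF Z(1)] Z(2,3) Ext0_iso2[OF fX fX Z(5,4) XX] less.hyps[OF Z(6,1)]])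
    qed
  qed
  have "Ext0 Y M" if "wide Y" for Y
    using that
  proof (induction "kdim Y" arbitrary: Y rule: less_induct)
    case less
    note fY = wide_fdm[OF less.prems] and fM = wide_fdm[OF M]
    show ?case
    proof (cases "car Y = {0}")
      case True
      then show ?thesis using Ext0_zero1 fM fY by blast
    next
      case False
      obtain Z :: "('k, 'a) umod" and q where Z: "wide Z" "q \<in> homs Y Z" "q ` car Y = car Z" "iso X (submod Y (kernel Y q))"
          "fdm (submod Y (kernel Y q))" "kdim Z < kdim Y"
        using step[OF less.prems False] by blast
      show ?thesis
        by (rule Ext0_extension1[OF fM fY wide_fdm[OF Z(1)] Z(2,3) Ext0_iso1[OF fX Z(5) fM Z(4) XY[OF M]] less.hyps[OF Z(6,1)]])
    qed
  qed
  then show ?thesis using M by blast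
qed

lemma perp_rigid:
  fixes M :: "('k, 'a, 'm::ab_group_add) rmod"
  assumes M: "fdm M" and p: "\<And>j. j \<noteq> k \<Longrightarrow> perp (T j) M" shows "rigid sc M"
proof -
  obtain N :: "('k, 'a) umod" and f where N: "fdm N" and f: "f \<in> homs M N" "bij_betw f (car M) (car N)"
    by (rule umod_exists[OF M])
  have i: "iso M N" using f by (auto simp: iso_def)
  then have i': "iso N M" by (rule iso_sym[OF M])
  have "wide N" using N perp_iso[OF exc M N i p] by (simp add: wide_def)
  then have "Ext0 N N" by (rule wide_rigid)
  then have "Ext0 M M" using Ext0_iso1[OF N M M i'] Ext0_iso2[OF N N M i'] by blast
  then show ?thesis using Ext0_ext1_zero[OF M M] by (simp add: rigid_def)
qed

end

section \<open>Semistability\<close>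

lemma semistable_perp:
  fixes M :: "('k, 'a, 'm::ab_group_add) rmod"
  assumes M: "fdm M" and pos: "\<And>j. j \<in> J \<Longrightarrow> c j > 0"
    and x: "(\<Sum>j\<in>J. c j *\<^sub>R g_vec sc S P (T j)) \<in> semistability_set S M"
    and j: "j \<in> J"
  shows "perp (T j) M"
proof -
  have finJ: "finite J" by (rule finite_subset[OF subset_UNIV]) simp
  let ?x = "\<Sum>j\<in>J. c j *\<^sub>R g_vec sc S P (T j)"
  have xd: "?x \<bullet> y = (\<Sum>j\<in>J. c j * form (tvec (T j)) y)" for y
    by (simp add: inner_sum_left g_vec_tvec[OF exc])
  let ?G = "\<lambda>N. submodule M N \<and> (\<forall>j\<in>J. case T j of Mod X \<Rightarrow> Ext0 X (submod M N) | Sh i \<Rightarrow> homs (P i) (submod M N) = {0})"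
  have "case T j of Mod X \<Rightarrow> Ext0 X (submod M {0}) | Sh i \<Rightarrow> homs (P i) (submod M {0}) = {0}" if "j \<in> J" for j
  proof (cases "T j")
    case (Mod X)
    then show ?thesis using Ext0_zero[OF Mod_facts(1)[OF Mod] zero_sub[OF M]] by simp
  next
    case (Sh i)
    then show ?thesis using hom_dim_to_zero[OF fdP zero_sub[OF M]] hom_dim_0[OF fdP zero_sub[OF M]] by simp
  qed
  then have G0: "?G {0}" using submodule_0[OF M] by blast
  have "\<forall>N. ?G N \<longrightarrow> kdim (submod M N) < Suc (kdim M)"
    using kdim_sub(1)[OF M] by (simp add: less_Suc_eq_le)
  then obtain R where R: "?G R" "\<And>N. ?G N \<Longrightarrow> kdim (submod M N) \<le> kdim (submod M R)"
    using ex_has_greatest_nat[of ?G "{0}" "\<lambda>N. kdim (submod M N)", OF G0] by blast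
  have sR: "submodule M R" using R(1) by blast
  note fR = sub_fdm[OF M sR]
  have trace: "f ` car X \<subseteq> R" if i: "T i = Mod X" "i \<in> J" and f: "f \<in> homs X M" for i X f
  proof -
    note X = Mod_facts[OF i(1)]
    have sf: "submodule M (f ` car X)" by (rule image_submodule[OF X(1) f submodule_car[OF X(1)]])
    define N where "N = {x + y | x y. x \<in> R \<and> y \<in> f ` car X}"
    have sN: "submodule M N" unfolding N_def by (rule sum_submodule[OF M sR sf])
    note fN = sub_fdm[OF M sN]
    have RN: "R \<subseteq> N"
    proof
      fix x assume "x \<in> R"
      then show "x \<in> N" unfolding N_def using sub_0[OF sf] by (intro CollectI exI[of _ x] exI[of _ 0]) auto
    qed
    have FN: "f ` car X \<subseteq> N"
    proof
      fix y assume "y \<in> f ` car X"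
      then show "y \<in> N" unfolding N_def using sub_0[OF sR] by (intro CollectI exI[of _ 0] exI[of _ y]) auto
    qed
    have sRN: "submodule (submod M N) R" using submodule_trans[OF sN] sR RN by simp
    obtain Y :: "('k, 'a, 'm) rmod" and q where Y: "fdm Y"
      and q: "q \<in> homs (submod M N) Y" "q ` car (submod M N) = car Y" "kernel (submod M N) q = R"
      by (rule quotient_exists[OF fN sRN])
    have fN': "f \<in> homs X (submod M N)" using hom_sub_cod[OF sub_le[OF sN]] f FN by blast
    have qf: "(\<lambda>x. q (f x)) \<in> homs X Y" by (rule hom_comp[OF fN' q(1)])
    have im: "(\<lambda>x. q (f x)) ` car X = car Y"
    proof (intro equalityI subsetI)
      fix y assume "y \<in> car Y"
      then have "y \<in> q ` N" using q(2) by simp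
      then obtain r x where rx: "y = q (r + f x)" "r \<in> R" "x \<in> car X" unfolding N_def by blast
      have "r + f x \<in> N" "r \<in> N" "f x \<in> N" using rx RN FN sub_add[OF sN] by blast+
      then have "y = q r + q (f x)" using hom_add[OF q(1)] rx(1) by simp
      moreover have "q r = 0" using rx(2) q(3) by (auto simp: kernel_def)
      ultimately show "y \<in> (\<lambda>x. q (f x)) ` car X" using rx(3) by simp
    qed (use hom_in[OF qf] in auto)
    have "case T j of Mod X' \<Rightarrow> Ext0 X' (submod M N) | Sh i \<Rightarrow> homs (P i) (submod M N) = {0}" if j: "j \<in> J" for j
    proof (cases "T j")
      case (Mod X')
      note X' = Mod_facts(1)[OF Mod]
      have "Ext0 X' Y" by (rule Ext0_quotient[OF X' X(1) Y Mod_Ext0[OF Mod i(1)] qf im])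
      moreover have "Ext0 X' (submod (submod M N) (kernel (submod M N) q))"
        using R(1) j Mod q(3) by fastforce
      ultimately have "Ext0 X' (submod M N)" by (intro Ext0_extension2[OF X' fN Y q(1,2)])
      then show ?thesis using Mod by simp
    next
      case (Sh a)
      have "hom_dim (P a) X = 0" using Sh_Mod[OF Sh i(1)] hom_dim_0[OF fdP X(1)] by simp
      then have "hom_dim (P a) Y = 0" using hom_dim_exact[OF fdP projP X(1) Y qf im, of a] by simp
      moreover have "homs (P a) (submod M R) = {0}" using R(1) j Sh by fastforce
      then have "hom_dim (P a) (submod M R) = 0" using hom_dim_0[OF fdP fR] by simp
      ultimately have "hom_dim (P a) (submod M N) = 0"
        using hom_dim_exact[OF fdP projP fN Y q(1,2), of a] q(3) by simp
      then show ?thesis using Sh hom_dim_0[OF fdP fN] by simp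
    qed
    then have "kdim (submod M N) \<le> kdim (submod M R)" using R(2) sN by blast
    moreover have "kdim (submod M R) \<le> kdim (submod M N)" using kdim_sub(1)[OF fN sRN] by simp
    ultimately have "R = N" using kdim_sub(2)[OF fN sRN] by simp
    then show ?thesis using FN by simp
  qed
  have fR0: "form (tvec (T j)) (dv (submod M R)) = (case T j of Mod X \<Rightarrow> real (hom_dim X (submod M R)) | Sh i \<Rightarrow> 0)"
    if j: "j \<in> J" for j
  proof (cases "T j")
    case (Mod X)
    have "Ext0 X (submod M R)" using R(1) j Mod by fastforce
    then show ?thesis using euler_form(2)[OF Mod_facts(1)[OF Mod] fR] form_Mod[OF Mod_facts(1)[OF Mod]] Mod by simp
  next
    case (Sh a)
    have "homs (P a) (submod M R) = {0}" using R(1) j Sh by fastforce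
    then show ?thesis using form_Sh[OF fR] hom_dim_0[OF fdP fR] Sh by simp
  qed
  have "(\<Sum>j\<in>J. c j * form (tvec (T j)) (dv (submod M R))) \<le> 0"
    using x sR unfolding semistability_set_def xd[symmetric] by blast
  moreover have nn: "c j * form (tvec (T j)) (dv (submod M R)) \<ge> 0" if "j \<in> J" for j
    using fR0[OF that] pos[OF that] by (cases "T j") auto
  ultimately have "(\<Sum>j\<in>J. c j * form (tvec (T j)) (dv (submod M R))) = 0"
    using sum_nonneg[of J "\<lambda>j. c j * form (tvec (T j)) (dv (submod M R))"] by force
  then have z: "c j * form (tvec (T j)) (dv (submod M R)) = 0" if "j \<in> J" for j
    using sum_nonneg_eq_0_iff[OF finJ, of "\<lambda>j. c j * form (tvec (T j)) (dv (submod M R))"] nn that by blast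
  have hom0: "homs X M = {0}" if i: "T i = Mod X" "i \<in> J" for i X
  proof -
    have "hom_dim X (submod M R) = 0" using z[OF i(2)] fR0[OF i(2)] pos[OF i(2)] i(1) by simp
    then have h: "homs X (submod M R) = {0}" using hom_dim_0[OF Mod_facts(1)[OF i(1)] fR] by simp
    have "f = 0" if "f \<in> homs X M" for f
      using that trace[OF i that] hom_sub_cod[OF sub_le[OF sR]] h by blast
    then show ?thesis using hom_zero'[OF M] by blast
  qed
  have le: "form (tvec (T j)) (dv M) \<le> 0" if j: "j \<in> J" for j
  proof (cases "T j")
    case (Mod X)
    note X = Mod_facts(1)[OF Mod]
    show ?thesis using euler_form(1)[OF X M] form_Mod[OF X] hom0[OF Mod j] hom_dim_0[OF X M] Mod by simp
  next
    case (Sh a)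
    then show ?thesis using form_Sh[OF M] by simp
  qed
  have "(\<Sum>j\<in>J. - (c j * form (tvec (T j)) (dv M))) = 0"
    using x unfolding semistability_set_def by (simp add: sum_negf xd[symmetric])
  moreover have "- (c j * form (tvec (T j)) (dv M)) \<ge> 0" if "j \<in> J" for j
    using le[OF that] pos[OF that] by (simp add: mult_le_0_iff)
  ultimately have "- (c j * form (tvec (T j)) (dv M)) = 0"
    using sum_nonneg_eq_0_iff[OF finJ, of "\<lambda>j. - (c j * form (tvec (T j)) (dv M))"] j by blast
  then have e: "form (tvec (T j)) (dv M) = 0" using pos[OF j] by simp
  show ?thesis
  proof (cases "T j")
    case (Mod X)
    note X = Mod_facts(1)[OF Mod]
    have "Ext0 X M" using euler_form(2)[OF X M] e form_Mod[OF X] hom0[OF Mod j] hom_dim_0[OF X M] Mod by simp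
    then show ?thesis using hom0[OF Mod j] Mod by (simp add: perp_def)
  next
    case (Sh a)
    then show ?thesis using e form_Sh[OF M] hom_dim_0[OF fdP M] by (simp add: perp_def)
  qed
qed

end

end

theorem theorem5p4:
  fixes sc :: "'k::field \<Rightarrow> 'a::ring_1 \<Rightarrow> 'a"
    and S P :: "'n::finite \<Rightarrow> ('k, 'a) umod"
    and M :: "('k, 'a, 'm::ab_group_add) rmod"
  assumes "fd_algebra sc" and "hereditary sc"
    and "simple_modules sc S"
    and "\<And>i. \<exists>p. projective_cover sc (P i) p (S i)"
    and "fd_rmodule sc M" and "\<not> rigid sc M"
    and "k = 0 \<or> k = 1"
    and "U \<in> simplex_interiors sc S P k"
  shows "semistability_set S M \<inter> U = {}"
proof (rule ccontr)
  interpret hered_alg sc S P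
    by (intro hered_alg.intro fin_dim_alg.intro hered_alg_axioms.intro assms(1-4))
  assume "semistability_set S M \<inter> U \<noteq> {}"
  then obtain x where x: "x \<in> semistability_set S M" "x \<in> U" by blast
  obtain T J where T: "cluster_tilting sc P T" and J: "card J + k = CARD('n)"
    and U: "U = {\<Sum>j\<in>J. c j *\<^sub>R g_vec sc S P (T j) | c. \<forall>j\<in>J. c j > 0}"
    using assms(8) by (auto simp: simplex_interiors_def)
  obtain c where c: "\<And>j. j \<in> J \<Longrightarrow> c j > 0" "x = (\<Sum>j\<in>J. c j *\<^sub>R g_vec sc S P (T j))"
    using x(2) U by blast
  have "card (UNIV - J) = k" using J by (simp add: card_Diff_subset)
  then have "card (UNIV - J) \<le> 1" using assms(7) by linarith
  then obtain l where l: "UNIV - J \<subseteq> {l}"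
    by (metis card_le_Suc0_iff_eq finite One_nat_def insertI1 subsetI singletonI empty_iff)
  have "perp (T j) M" if "j \<noteq> l" for j
    by (rule semistable_perp[OF T assms(5) c(1)]) (use x(1) c(2) l that in auto)
  then have "rigid sc M" by (rule perp_rigid[OF T assms(5)])
  then show False using assms(6) by simp
qed

end
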